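(* Let $p\ge1$, $\theta\in\mathbb{R}^p$, $|\rho|<1$, and consider the adaptively controlled ARX$(p,0)$ process with first-order autoregressive noise described in the context, with the estimators $\widehat\theta_n$ and $\widehat\rho_n$ of $\theta$ and $\rho$. Assume that $\rho\ne0$ and that $(V_n)$ has a finite conditional moment of order $>2$. Then $\widehat\theta_n$ and $\widehat\rho_n$ converge almost surely to $\theta$ and $\rho$ respectively, and $$\|\widehat\theta_n-\theta\|^2=\mathcal{O}\left(\frac{\log n}{n}\right)\quad\text{a.s.},\qquad (\widehat\rho_n-\rho)^2=\mathcal{O}\left(\frac{\log n}{n}\right)\quad\text{a.s.}$$
   Context: Model. For all $n\ge 0$, $$X_{n+1}=\sum_{k=1}^p\theta_kX_{n-k+1}+U_n+\varepsilon_{n+1},\qquad \varepsilon_{n+1}=\rho\varepsilon_n+V_{n+1},$$ with $\theta=(\theta_1,\dots,\theta_p)^t\in\mathbb{R}^p$, $|\rho|<1$. Initial values ($X_k$ for $k\le 0$, $\varepsilon_0$, $U_0$, $U_{-1}$) are arbitrary ($\mathcal F_0$-measurable). $(V_n)$ is a martingale difference sequence adapted to a filtration $(\mathcal F_n)$ with $\mathbb{E}[V_{n+1}^2\mid\mathcal F_n]=\sigma^2$ a.s. for all $n\ge0$, where $\sigma^2>0$ is a constant. "Finite conditional moment of order $>2$" means: there is $a>2$ with $\sup_{n\ge0}\mathbb{E}[|V_{n+1}|^a\mid\mathcal F_n]<\infty$ a.s. Regression vector and parameter. $\Phi_n=(X_n,X_{n-1},\dots,X_{n-p+1},X_{n-p},U_{n-1})^t\in\mathbb{R}^{p+2}$,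 and $\vartheta\in\mathbb{R}^{p+2}$ is $$\vartheta=\begin{pmatrix}\theta\\0\\0\end{pmatrix}-\rho\begin{pmatrix}-1\\ \theta\\ 1\end{pmatrix},$$ so that for $n\ge 1$, $X_{n+1}=\vartheta^t\Phi_n+U_n+V_{n+1}$. Estimator and control. $S_n=\sum_{k=0}^n\Phi_k\Phi_k^t+I_{p+2}$; the least squares estimator satisfies, for $n\ge0$, $$\widehat\vartheta_{n+1}=\widehat\vartheta_n+S_n^{-1}\Phi_n\bigl(X_{n+1}-U_n-\widehat\vartheta_n^{\,t}\Phi_n\bigr),$$ with $\widehat\vartheta_0$ arbitrary. The adaptive tracking control is $U_n=x_{n+1}-\widehat\vartheta_n^{\,t}\Phi_n$ (for $n\ge 1$; $U_0$ may be arbitrary), where $(x_n)$ is a predictable real reference trajectory ($x_{n+1}$ is $\mathcal F_n$-measurable) satisfying $\sum_{k=1}^n x_k^2=o(n)$ a.s. Estimators of $\theta$ and $\rho$. $\widehat\rho_n$ is the opposite of the last coordinate of $\widehat\vartheta_n$, i.e. $\widehat\rho_n=-\widehat\vartheta_{n,p+2}$, and $\widehat\theta_n=(\widehat\theta_{n,1},\dots,\widehat\theta_{n,p})^t$ with, for $1\le k\le p$, $$\widehat\theta_{n,k}=\sum_{i=1}^{k}\widehat\rho_n^{\,k-i}\,\widehat\vartheta_{n,i}+\widehat\rho_n^{\,k-1}\,\widehat\vartheta_{n,p+2}$$ (convention $0^0=1$). The same formulas applied to $\vartheta$ return $\theta$ and $\rho$. *)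

theory Defs
  imports "HOL-Probability.Probability" "HOL-Library.Landau_Symbols"
begin

text \<open>
  The dimension $p \geq 1$ is the cardinality of the index type \<open>'p\<close>, so that $\theta$ is a vector of
  type \<open>real ^ 'p\<close>; regression vectors have type \<open>real ^ ('p + 2)\<close>, the index type of which has
  cardinality $p + 2$.  An index type carries no order, so the numbering $1, \dots, p$ of the
  coordinates is given by a bijection \<open>e\<close> from \<open>{1..CARD('p)}\<close> onto \<open>'p\<close>: the $k$-th coordinate
  of \<open>\<theta>\<close> is \<open>\<theta> $ e k\<close>.
\<close>

definition ext_enum :: "(nat \<Rightarrow> 'p::finite) \<Rightarrow> nat \<Rightarrow> 'p + 2" where
  "ext_enum e k =
    (if k \<le> CARD('p) then Inl (e k) else if k = CARD('p) + 1 then Inr 0 else Inr 1)"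

text \<open>The vector $(f(1), \dots, f(n))$, for coordinates numbered by \<open>e\<close>.\<close>

definition tuple :: "(nat \<Rightarrow> 'n::finite) \<Rightarrow> (nat \<Rightarrow> real) \<Rightarrow> real ^ 'n" where
  "tuple e f = (\<chi> i. f (inv_into {1..CARD('n)} e i))"

lemma tuple_nth:
  fixes e :: "nat \<Rightarrow> 'n::finite"
  assumes "bij_betw e {1..CARD('n)} UNIV" and "k \<in> {1..CARD('n)}"
  shows "tuple e f $ e k = f k"
  using assms by (simp add: tuple_def bij_betw_def inv_into_f_f)

lemma bij_betw_ext_enum:
  fixes e :: "nat \<Rightarrow> 'p::finite"
  assumes "bij_betw e {1..CARD('p)} UNIV"
  shows "bij_betw (ext_enum e) {1..CARD('p + 2)} UNIV"
proof -
  have "inj_on (ext_enum e) {1..CARD('p) + 2}"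
  proof (rule inj_onI)
    fix k l
    assume "k \<in> {1..CARD('p) + 2}" "l \<in> {1..CARD('p) + 2}" "ext_enum e k = ext_enum e l"
    thus "k = l"
      using bij_betw_imp_inj_on[OF assms, THEN inj_onD, of k l]
      by (simp add: ext_enum_def split: if_splits)
  qed
  hence inj: "inj_on (ext_enum e) {1..CARD('p + 2)}"
    by simp
  hence "card (ext_enum e ` {1..CARD('p + 2)}) = CARD('p + 2)"
    by (subst card_image) simp_all
  hence "ext_enum e ` {1..CARD('p + 2)} = UNIV"
    by (intro card_subset_eq) simp_all
  with inj show ?thesis
    by (simp add: bij_betw_def)
qed

text \<open>
  \<open>X\<close> and \<open>U\<close> are indexed by integers because the regression vectors involve the initial values
  $X_0, X_{-1}, \dots, X_{-p}$ and $U_{-1}$.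
\<close>

definition regressor ::
  "(nat \<Rightarrow> 'p::finite) \<Rightarrow> (int \<Rightarrow> 'a \<Rightarrow> real) \<Rightarrow> (int \<Rightarrow> 'a \<Rightarrow> real) \<Rightarrow> nat \<Rightarrow> 'a \<Rightarrow> real ^ ('p + 2)"
  where
  "regressor e X U n \<omega> = tuple (ext_enum e)
     (\<lambda>k. if k \<le> CARD('p) + 1 then X (int n - int k + 1) \<omega> else U (int n - 1) \<omega>)"

definition gram :: "(nat \<Rightarrow> 'a \<Rightarrow> real ^ 'n) \<Rightarrow> nat \<Rightarrow> 'a \<Rightarrow> real ^ 'n ^ 'n::finite" where
  "gram \<Phi> n \<omega> = (\<Sum>k\<le>n. (columnvector (\<Phi> k \<omega>) :: real ^ 1 ^ 'n) ** rowvector (\<Phi> k \<omega>)) + mat 1"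

definition rho_est :: "(nat \<Rightarrow> 'p::finite) \<Rightarrow> real ^ ('p + 2) \<Rightarrow> real" where
  "rho_est e v = - v $ ext_enum e (CARD('p) + 2)"

definition theta_est :: "(nat \<Rightarrow> 'p::finite) \<Rightarrow> real ^ ('p + 2) \<Rightarrow> real ^ 'p" where
  "theta_est e v = tuple e
     (\<lambda>k. (\<Sum>i=1..k. rho_est e v ^ (k - i) * v $ ext_enum e i)
          + rho_est e v ^ (k - 1) * v $ ext_enum e (CARD('p) + 2))"

text \<open>
  The parameter $(\theta, 0, 0) - \rho\,(-1, \theta, 1)$ estimated by least squares;
  the estimators recover $\theta$ and $\rho$ from it.
\<close>

definition vartheta :: "(nat \<Rightarrow> 'p::finite) \<Rightarrow> real ^ 'p \<Rightarrow> real \<Rightarrow> real ^ ('p + 2)" where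
  "vartheta e \<theta> \<rho> =
     tuple (ext_enum e) (\<lambda>k. if k \<le> CARD('p) then \<theta> $ e k else 0)
     - \<rho> *\<^sub>R tuple (ext_enum e)
         (\<lambda>k. if k = 1 then - 1 else if k \<le> CARD('p) + 1 then \<theta> $ e (k - 1) else 1)"

lemma vartheta_nth:
  fixes e :: "nat \<Rightarrow> 'p::finite"
  assumes "bij_betw e {1..CARD('p)} UNIV" and "k \<in> {1..CARD('p) + 2}"
  shows "vartheta e \<theta> \<rho> $ ext_enum e k = (if k \<le> CARD('p) then \<theta> $ e k else 0)
    - \<rho> * (if k = 1 then - 1 else if k \<le> CARD('p) + 1 then \<theta> $ e (k - 1) else 1)"
proof -
  have "k \<in> {1..CARD('p + 2)}"
    using assms(2) by simp
  note * = tuple_nth[OF bij_betw_ext_enum[OF assms(1)] this]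
  show ?thesis
    unfolding vartheta_def by (simp only: vector_minus_component vector_scaleR_component * real_scaleR_def)
qed

lemma rho_est_vartheta:
  fixes e :: "nat \<Rightarrow> 'p::finite"
  assumes "bij_betw e {1..CARD('p)} UNIV"
  shows "rho_est e (vartheta e \<theta> \<rho>) = \<rho>"
  by (simp add: rho_est_def vartheta_nth[OF assms])

lemma theta_est_vartheta:
  fixes e :: "nat \<Rightarrow> 'p::finite"
  assumes e: "bij_betw e {1..CARD('p)} UNIV"
  shows "theta_est e (vartheta e \<theta> \<rho>) = \<theta>"
proof -
  define v where "v = vartheta e \<theta> \<rho>"
  have rho: "rho_est e v = \<rho>"
    by (simp add: v_def rho_est_vartheta[OF e])
  have sum: "(\<Sum>i=1..k. \<rho> ^ (k - i) * v $ ext_enum e i) = \<theta> $ e k + \<rho> ^ k"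
    if "1 \<le> k" "k \<le> CARD('p)" for k
    using that
  proof (induction k rule: dec_induct)
    case base
    thus ?case by (simp add: v_def vartheta_nth[OF e])
  next
    case (step k)
    have "(\<Sum>i=1..Suc k. \<rho> ^ (Suc k - i) * v $ ext_enum e i)
        = \<rho> * (\<Sum>i=1..k. \<rho> ^ (k - i) * v $ ext_enum e i) + v $ ext_enum e (Suc k)"
      using step.hyps by (simp add: sum_distrib_left Suc_diff_le mult.assoc)
    also have "\<dots> = \<theta> $ e (Suc k) + \<rho> ^ Suc k"
      using step by (simp add: v_def vartheta_nth[OF e] algebra_simps)
    finally show ?case .
  qed
  have last: "v $ ext_enum e (CARD('p) + 2) = - \<rho>"
    by (simp add: v_def vartheta_nth[OF e])
  have "theta_est e v $ e k = \<theta> $ e k" if k: "k \<in> {1..CARD('p)}" for k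
  proof -
    have "theta_est e v $ e k = \<theta> $ e k + \<rho> ^ k - \<rho> ^ (k - 1) * \<rho>"
      unfolding theta_est_def tuple_nth[OF e k] rho last using sum[of k] k by simp
    also have "\<rho> ^ (k - 1) * \<rho> = \<rho> ^ k"
      by (rule power_minus_mult) (use k in simp)
    finally show ?thesis
      by simp
  qed
  hence *: "theta_est e v $ i = \<theta> $ i" if "i \<in> e ` {1..CARD('p)}" for i
    using that by auto
  have "theta_est e v $ i = \<theta> $ i" for i
    by (rule *) (use e in \<open>simp add: bij_betw_def\<close>)
  thus ?thesis
    by (simp add: v_def vec_eq_iff)
qed

text \<open>
  Martingale differences $V_1, V_2, \dots$; nothing is required of \<open>V 0\<close>, which the model does not use.
\<close>

definition martingale_difference ::
  "'a measure \<Rightarrow> (nat \<Rightarrow> 'a measure) \<Rightarrow> (nat \<Rightarrow> 'a \<Rightarrow> real) \<Rightarrow> bool" where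
  "martingale_difference M F V \<longleftrightarrow>
    (\<forall>n. V (Suc n) \<in> borel_measurable (F (Suc n)) \<and> integrable M (V (Suc n)) \<and>
         (AE \<omega> in M. real_cond_exp M (F n) (V (Suc n)) \<omega> = 0))"

text \<open>
  The exponent \<open>a\<close> is deterministic; the supremum may be random.  Conditional moments are taken in
  \<open>ennreal\<close>, so no integrability of \<open>\<bar>V (Suc n)\<bar> powr a\<close> is presupposed.
\<close>

definition finite_conditional_moment_gt2 ::
  "'a measure \<Rightarrow> (nat \<Rightarrow> 'a measure) \<Rightarrow> (nat \<Rightarrow> 'a \<Rightarrow> real) \<Rightarrow> bool" where
  "finite_conditional_moment_gt2 M F V \<longleftrightarrow>
    (\<exists>a>2. AE \<omega> in M.
       (SUP n. nn_cond_exp M (F n) (\<lambda>\<omega>. ennreal (\<bar>V (Suc n) \<omega>\<bar> powr a)) \<omega>) < \<infinity>)"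

end

theory Submission
  imports Defs
begin

text \<open>
  Write $\delta_n = \widehat\vartheta_n - \vartheta$, $\pi_n = - \delta_n \cdot \Phi_n$,
  $f_n = \Phi_n \cdot S_n^{-1} \Phi_n$ and $s_n = 1 + \sum_{k \leq n} \|\Phi_k\|^2$.  Expanding the
  Lyapunov function $\delta_{n+1} \cdot S_n \delta_{n+1}$ and applying martingale limit theorems to
  the two noise terms gives
  $\delta_{n+1} \cdot S_n \delta_{n+1} + \sum_{k \leq n} (1 - f_k) \pi_k^2 = O(\log s_n)$; the
  moment of order greater than 2 is what makes $\sum f_k V_{k+1}^2$ of the order of
  $\sum f_k \leq \log \det S_n$.
  It then suffices that $\log s_n = O(\log n)$ and that $S_n$ dominates a multiple of $n I$.

  With $H_n$ an exponentially weighted sum of the past $X_k^2$ and $V_k^2$, the closed loop satisfies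
  $H_{k+1} \leq (\lambda + c \alpha_k d_k) H_k + \xi_k$ where $\lambda < 1$,
  $\alpha_k = (1 - f_k) \pi_k^2$ and $d_k = \mathrm{tr}(S_{k-1}^{-1} - S_k^{-1}) \to 0$.  Hence $s_n$
  grows at most polynomially.  A pointwise bound on $H$ is not available, as $x_k^2$ may be nearly as
  large as $k$ at sparse times; but $\log(1 + H_k / \kappa)$ with $\kappa = n^\tau$, $\tau < 1$, shows
  that $H_k \geq \kappa$ for only $O(n^{1 - \tau})$ of the times $k \leq n$.  On the remaining ones
  $\sum \pi_k^2 = o(n)$, so $X_k$ is close to $V_k$ there; as $\rho \neq 0$, the filtered regressor
  $c \cdot \Phi_{k+1} - \rho\, c \cdot \Phi_k$ is then a moving average of $V$ whose coefficients depend
  injectively on $c$, and the law of large numbers for $V$ bounds $c \cdot S_n c$ below by a multiple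
  of $n \|c\|^2$.
\<close>

section \<open>Moment inequality and convergence of martingale transforms\<close>

text \<open>Martingale theory supplies countably many almost sure facts; the rest is deterministic
  along one trajectory. The obstacle is a circle: least squares bounds the sum of (1 - f_k)
  \<pi>_k^2 by log s_n, while s_n depends on the \<pi>_k through the control, and the weights 1 -
  f_k have no positive lower bound. Rank-one algebra gives 1 / (1 - f_k) \<le> 2 + d_k |\<Phi>_k|^2,
  which bounds \<pi>_k^2 by a multiple of \<alpha>_k plus a multiple of \<alpha>_k d_k H_k: this is
  the origin of the perturbed recursion. Its factors multiply to at most exp (c \<Sum> \<alpha>_k
  d_k), and since d_k tends to 0 this is a constant times an arbitrarily small power of s_n, which
  closes the circle. The exponent \<tau> lies between a growth exponent of V_k^2 and 1: the times
  left out then carry o(n) of the energy of V, the times kept o(n) of the energy of \<pi>. The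
  filter 1 - \<rho> L is there because U_(n-1) brings \<epsilon>_n, hence the whole past of the
  noise, into the regressor.\<close>

lemma powr_add_le_add_powr:
  fixes x y s :: real
  assumes "0 \<le> x" "0 \<le> y" "0 < s" "s \<le> 1"
  shows "(x + y) powr s \<le> x powr s + y powr s"
proof (cases "x + y = 0")
  case True
  then show ?thesis using assms by auto
next
  case False
  then have pos: "0 < x + y" using assms by auto
  have *: "t \<le> t powr s" if "0 \<le> t" "t \<le> 1" for t :: real
    using powr_mono'[of s 1 t] that assms by simp
  have "1 = x / (x + y) + y / (x + y)"
    using pos by (simp add: add_divide_distrib[symmetric])
  also have "\<dots> \<le> (x / (x + y)) powr s + (y / (x + y)) powr s"
    using assms pos by (intro add_mono *) auto
  also have "\<dots> = (x powr s + y powr s) / (x + y) powr s"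
    using assms pos by (simp add: powr_divide add_divide_distrib)
  finally show ?thesis using pos by (simp add: field_simps)
qed

text \<open>Signed power: \<open>b * spow (b - 1) z\<close> is the derivative of |z|^b.\<close>

definition spow :: "real \<Rightarrow> real \<Rightarrow> real" where
  "spow s z = sgn z * \<bar>z\<bar> powr s"

text \<open>For equal signs this is subadditivity of t^s. For opposite signs each of the two powers
  is at most |u - v|^s, whence the factor 2.\<close>

lemma spow_holder:
  assumes "0 < s" "s \<le> 1"
  shows "\<bar>spow s u - spow s v\<bar> \<le> 2 * \<bar>u - v\<bar> powr s"
proof -
  have *: "\<bar>a powr s - b powr s\<bar> \<le> 2 * \<bar>a - b\<bar> powr s" if "0 \<le> a" "0 \<le> b" for a b :: real
  proof -
    have "\<bar>a powr s - b powr s\<bar> \<le> \<bar>a - b\<bar> powr s"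
      using powr_add_le_add_powr[of a "b - a" s] powr_add_le_add_powr[of b "a - b" s]
        powr_mono2[of s a b] powr_mono2[of s b a] that assms
      by (cases "a \<le> b") (auto simp: abs_if)
    then show ?thesis using powr_ge_zero[of "\<bar>a - b\<bar>" s] by linarith
  qed
  have **: "a powr s + b powr s \<le> 2 * (a + b) powr s" if "0 \<le> a" "0 \<le> b" for a b :: real
    using powr_mono2[of s a "a + b"] powr_mono2[of s b "a + b"] that assms by auto
  have nonneg: "spow s z = z powr s" if "0 \<le> z" for z
    using that by (auto simp: spow_def sgn_if)
  have nonpos: "spow s z = - ((- z) powr s)" if "z \<le> 0" for z
    using that by (auto simp: spow_def sgn_if)
  consider "0 \<le> u" "0 \<le> v" | "u \<le> 0" "v \<le> 0" | "0 \<le> u" "v \<le> 0" | "u \<le> 0" "0 \<le> v"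
    by linarith
  then show ?thesis
  proof cases
    case 1
    then show ?thesis using *[of u v] by (simp add: nonneg)
  next
    case 2
    then show ?thesis using *[of "-u" "-v"] by (simp add: nonpos abs_minus_commute)
  next
    case 3
    then show ?thesis using **[of u "-v"] powr_ge_zero[of u s] powr_ge_zero[of "-v" s]
      by (simp add: nonneg nonpos)
  next
    case 4
    have "\<bar>u - v\<bar> = - u + v" using 4 by simp
    show ?thesis
      unfolding nonpos[OF 4(1)] nonneg[OF 4(2)] \<open>\<bar>u - v\<bar> = - u + v\<close>
      using **[of "-u" v] powr_ge_zero[of "-u" s] powr_ge_zero[of v s] 4 by linarith
  qed
qed

text \<open>Concavity of \<open>ln\<close>: \<open>t\<close> is the combination of 1 and 1 + b (t -
  1) with weights 1 - 1/b and 1/b. If the second point is not positive, there is nothing to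
  prove.\<close>

lemma bernoulli_powr:
  fixes t b :: real
  assumes "0 \<le> t" "1 \<le> b"
  shows "1 + b * (t - 1) \<le> t powr b"
proof (cases "t = 0")
  case False
  then have t: "0 < t" using assms by simp
  have "1 + b * (t - 1) \<le> t powr b"
  proof (cases "1 + b * (t - 1) \<le> 0")
    case True
    then show ?thesis using powr_ge_zero[of t b] by linarith
  next
    case False
    define z where "z = 1 + b * (t - 1)"
    have z: "0 < z" using False by (simp add: z_def)
    have "(1 - 1 / b) * ln 1 + (1 / b) * ln z \<le> ln ((1 - 1 / b) * 1 + (1 / b) * z)"
      using concave_onD[OF ln_concave, of "1 / b" 1 z] assms z by simp
    also have "(1 - 1 / b) * 1 + (1 / b) * z = t"
      using assms by (simp add: z_def field_simps)
    finally have "ln z \<le> b * ln t" using assms by (simp add: field_simps)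
    then have "exp (ln z) \<le> exp (b * ln t)" by simp
    moreover have "exp (ln z) = z" using z by simp
    moreover have "t powr b = exp (b * ln t)" using t by (simp add: powr_def)
    ultimately show ?thesis by (simp only: z_def)
  qed
  then show ?thesis .
qed (use assms in auto)

text \<open>Tangent-line inequality for $|z|^b$ at $x + y$, followed by Hoelder continuity of the derivative.\<close>

lemma abs_powr_add_le:
  fixes x y b :: real
  assumes "1 < b" "b \<le> 2"
  shows "\<bar>x + y\<bar> powr b \<le> \<bar>x\<bar> powr b + b * spow (b - 1) x * y + 4 * \<bar>y\<bar> powr b"
proof -
  \<comment> \<open>The tangent at w > 0. For x \<ge> 0 this is Bernoulli at x / w, scaled by w^b;
    for x < 0 the left-hand side is at most 0.\<close>
  have pos: "\<bar>w\<bar> powr b + b * spow (b - 1) w * (x - w) \<le> \<bar>x\<bar> powr b" if "0 < w" for w x :: real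
  proof (cases "0 \<le> x")
    case True
    have "w powr b * (1 + b * (x / w - 1)) \<le> w powr b * (x / w) powr b"
      using bernoulli_powr[of "x / w" b] True that assms by (intro mult_left_mono) auto
    moreover have "w powr b * (1 + b * (x / w - 1)) = w powr b + b * w powr (b - 1) * (x - w)"
      using that by (simp add: powr_diff field_simps)
    moreover have "w powr b * (x / w) powr b = x powr b"
      using that True by (simp add: powr_divide)
    ultimately show ?thesis
      using True that by (simp add: spow_def)
  next
    case False
    have "w powr b = w powr (b - 1) * w" 
      using that by (simp add: powr_diff)
    then have "\<bar>w\<bar> powr b + b * spow (b - 1) w * (x - w) = w powr (b - 1) * (w * (1 - b) + b * x)"
      using that by (simp add: spow_def algebra_simps)
    also have "\<dots> \<le> 0"
      using False that assms by (intro mult_nonneg_nonpos add_nonpos_nonpos mult_nonneg_nonpos) auto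
    finally show ?thesis using powr_ge_zero[of "\<bar>x\<bar>" b] by linarith
  qed
  have tangent: "\<bar>w\<bar> powr b + b * spow (b - 1) w * (x - w) \<le> \<bar>x\<bar> powr b" for w x :: real
    using pos[of w x] pos[of "-w" "-x"] assms
    by (cases w "0 :: real" rule: linorder_cases) (auto simp: spow_def algebra_simps)
  have "\<bar>x + y\<bar> powr b \<le> \<bar>x\<bar> powr b + b * spow (b - 1) (x + y) * y"
    using tangent[of "x + y" x] by (simp add: algebra_simps)
  also have "\<dots> = \<bar>x\<bar> powr b + b * spow (b - 1) x * y + b * ((spow (b - 1) (x + y) - spow (b - 1) x) * y)"
    by (simp add: algebra_simps)
  also have "b * ((spow (b - 1) (x + y) - spow (b - 1) x) * y) \<le> b * (2 * \<bar>y\<bar> powr (b - 1) * \<bar>y\<bar>)"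
  proof (rule mult_left_mono)
    have "(spow (b - 1) (x + y) - spow (b - 1) x) * y
        \<le> \<bar>spow (b - 1) (x + y) - spow (b - 1) x\<bar> * \<bar>y\<bar>"
      by (metis abs_ge_self abs_mult)
    also have "\<dots> \<le> (2 * \<bar>x + y - x\<bar> powr (b - 1)) * \<bar>y\<bar>"
      using assms by (intro mult_right_mono spow_holder) auto
    finally show "(spow (b - 1) (x + y) - spow (b - 1) x) * y \<le> 2 * \<bar>y\<bar> powr (b - 1) * \<bar>y\<bar>"
      by simp
  qed (use assms in auto)
  \<comment> \<open>The bound b \<le> 2 and the Hoelder constant 2 make up the 4.\<close>
  also have "b * (2 * \<bar>y\<bar> powr (b - 1) * \<bar>y\<bar>) \<le> 2 * (2 * \<bar>y\<bar> powr (b - 1) * \<bar>y\<bar>)"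
    using assms by (intro mult_right_mono) auto
  also have "2 * (2 * \<bar>y\<bar> powr (b - 1) * \<bar>y\<bar>) = 4 * \<bar>y\<bar> powr b"
    by (cases "y = 0") (auto simp: powr_diff)
  finally show ?thesis by simp
qed

section \<open>Moments, maxima and convergence of orthogonal sequences\<close>

locale filtered_prob_space = prob_space M for M :: "'a measure" +
  fixes F :: "nat \<Rightarrow> 'a measure"
  assumes filtr: "filtration (space M) F"
    and subalg: "\<And>n. subalgebra M (F n)"
begin

lemma sigma_finite_subalgebra_F: "sigma_finite_subalgebra M (F n)"
  using subalg
  by (intro finite_measure_subalgebra_is_sigma_finite
      finite_measure_subalgebra.intro finite_measure_subalgebra_axioms.intro)
    (auto intro: finite_measure_axioms)

lemma measurable_F_mono: "f \<in> measurable (F m) N \<Longrightarrow> m \<le> n \<Longrightarrow> f \<in> measurable (F n) N"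
  using filtration.space_F[OF filtr] filtration.sets_F_mono[OF filtr, of m n]
  by (intro measurable_from_subalg[of "F n" "F m" f]) (auto simp: subalgebra_def)

lemma measurable_F_M: "f \<in> measurable (F m) N \<Longrightarrow> f \<in> measurable M N"
  by (rule measurable_from_subalg[OF subalg])

text \<open>
  The martingale difference property, tested against \<open>Z\<close>: this form is stable under multiplication
  by predictable factors, without integrability of the product.
\<close>

definition orthogonal :: "(nat \<Rightarrow> 'a \<Rightarrow> real) \<Rightarrow> bool" where
  "orthogonal d \<longleftrightarrow> (\<forall>n. d n \<in> borel_measurable (F (Suc n)) \<and>
    (\<forall>Z \<in> borel_measurable (F n). integrable M (\<lambda>\<omega>. Z \<omega> * d n \<omega>) \<longrightarrow> (\<integral>\<omega>. Z \<omega> * d n \<omega> \<partial>M) = 0))"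

lemma orthogonal_measurable: "orthogonal d \<Longrightarrow> d n \<in> borel_measurable (F (Suc n))"
  by (simp add: orthogonal_def)

lemma orthogonal_mult:
  assumes d: "orthogonal d" and g: "\<And>n. g n \<in> borel_measurable (F n)"
  shows "orthogonal (\<lambda>n \<omega>. g n \<omega> * d n \<omega>)"
  unfolding orthogonal_def
proof (intro allI conjI ballI impI)
  fix n
  have [measurable]: "g n \<in> borel_measurable (F (Suc n))"
    using g by (rule measurable_F_mono) simp
  have [measurable]: "d n \<in> borel_measurable (F (Suc n))"
    using d by (rule orthogonal_measurable)
  show "(\<lambda>\<omega>. g n \<omega> * d n \<omega>) \<in> borel_measurable (F (Suc n))"
    by measurable
  fix Z :: "'a \<Rightarrow> real" assume Z: "Z \<in> borel_measurable (F n)"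
    and "integrable M (\<lambda>\<omega>. Z \<omega> * (g n \<omega> * d n \<omega>))"
  moreover have "(\<lambda>\<omega>. Z \<omega> * g n \<omega>) \<in> borel_measurable (F n)"
    using Z g[of n] by measurable
  moreover from calculation have "integrable M (\<lambda>\<omega>. (Z \<omega> * g n \<omega>) * d n \<omega>)"
    by (simp add: mult.assoc)
  ultimately have "(\<integral>\<omega>. (Z \<omega> * g n \<omega>) * d n \<omega> \<partial>M) = 0"
    using d[unfolded orthogonal_def, THEN spec, of n, THEN conjunct2, THEN bspec] by simp
  then show "(\<integral>\<omega>. Z \<omega> * (g n \<omega> * d n \<omega>) \<partial>M) = 0"
    by (simp add: mult.assoc)
qed

lemma orthogonal_martingale_difference:
  assumes "martingale_difference M F D"
  shows "orthogonal (\<lambda>n. D (Suc n))"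
  unfolding orthogonal_def
proof (intro allI conjI ballI impI)
  fix n
  show D: "D (Suc n) \<in> borel_measurable (F (Suc n))"
    using assms by (simp add: martingale_difference_def)
  fix Z :: "'a \<Rightarrow> real" assume Z: "Z \<in> borel_measurable (F n)"
    and i: "integrable M (\<lambda>\<omega>. Z \<omega> * D (Suc n) \<omega>)"
  interpret sigma_finite_subalgebra M "F n" by (rule sigma_finite_subalgebra_F)
  have "(\<integral>\<omega>. Z \<omega> * D (Suc n) \<omega> \<partial>M) = (\<integral>\<omega>. Z \<omega> * real_cond_exp M (F n) (D (Suc n)) \<omega> \<partial>M)"
    by (rule real_cond_exp_intg(2)[OF i Z, symmetric]) (rule measurable_F_M[OF D])
  also have "\<dots> = (\<integral>\<omega>. 0 \<partial>M)"
    using assms Z measurable_F_M[OF Z] by (intro integral_cong_AE) (auto simp: martingale_difference_def)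
  finally show "(\<integral>\<omega>. Z \<omega> * D (Suc n) \<omega> \<partial>M) = 0"
    by simp
qed

text \<open>The von Bahr-Esseen inequality. Adding \<open>d n\<close> to the partial sum S changes
  |S|^b by a term linear in \<open>d n\<close>, which has mean zero because its factor depends on
  the past only, plus at most 4 |\<open>d n\<close>|^b.\<close>

lemma orthogonal_moment_le:
  assumes d: "orthogonal d" and b: "1 < b" "b \<le> 2"
    and int: "\<And>n. integrable M (\<lambda>\<omega>. \<bar>d n \<omega>\<bar> powr b)"
  shows "integrable M (\<lambda>\<omega>. \<bar>\<Sum>k<n. d k \<omega>\<bar> powr b) \<and>
    (\<integral>\<omega>. \<bar>\<Sum>k<n. d k \<omega>\<bar> powr b \<partial>M) \<le> 4 * (\<Sum>k<n. \<integral>\<omega>. \<bar>d k \<omega>\<bar> powr b \<partial>M)"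
proof (induction n)
  case 0
  then show ?case using b by simp
next
  case (Suc n)
  define S where "S \<omega> = (\<Sum>k<n. d k \<omega>)" for \<omega>
  have S: "S \<in> borel_measurable (F n)"
    unfolding S_def using d
    by (intro borel_measurable_sum measurable_F_mono[OF orthogonal_measurable]) auto
  have [measurable]: "S \<in> borel_measurable M" "d n \<in> borel_measurable M"
    using measurable_F_M[OF S] measurable_F_M[OF orthogonal_measurable[OF d]] by auto
  have IH: "integrable M (\<lambda>\<omega>. \<bar>S \<omega>\<bar> powr b)"
    "(\<integral>\<omega>. \<bar>S \<omega>\<bar> powr b \<partial>M) \<le> 4 * (\<Sum>k<n. \<integral>\<omega>. \<bar>d k \<omega>\<bar> powr b \<partial>M)"
    using Suc by (auto simp: S_def)
  \<comment> \<open>Orthogonality applies to integrable products only; this bound makes the cross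
    term integrable.\<close>
  have young: "\<bar>spow (b - 1) x * y\<bar> \<le> \<bar>x\<bar> powr b + \<bar>y\<bar> powr b" for x y :: real
  proof -
    have *: "\<bar>z\<bar> powr (b - 1) * \<bar>z\<bar> = \<bar>z\<bar> powr b" for z :: real
      by (cases "z = 0") (auto simp: powr_diff)
    have "\<bar>spow (b - 1) x * y\<bar> \<le> \<bar>x\<bar> powr (b - 1) * \<bar>y\<bar>"
      by (auto simp: spow_def abs_mult sgn_if)
    also have "\<dots> \<le> (max \<bar>x\<bar> \<bar>y\<bar>) powr (b - 1) * max \<bar>x\<bar> \<bar>y\<bar>"
      using b by (intro mult_mono powr_mono2) auto
    also have "\<dots> \<le> \<bar>x\<bar> powr b + \<bar>y\<bar> powr b"
      by (simp add: max_def *)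
    finally show ?thesis .
  qed
  have meas_spow: "(\<lambda>\<omega>. spow (b - 1) (S \<omega>)) \<in> borel_measurable (F n)"
    unfolding spow_def using S by measurable
  have [measurable]: "(\<lambda>\<omega>. spow (b - 1) (S \<omega>)) \<in> borel_measurable M"
    by (rule measurable_F_M[OF meas_spow])
  have cross: "integrable M (\<lambda>\<omega>. spow (b - 1) (S \<omega>) * d n \<omega>)"
    by (rule Bochner_Integration.integrable_bound[OF Bochner_Integration.integrable_add[OF IH(1) int[of n]]])
      (use young in \<open>auto\<close>)
  then have zero: "(\<integral>\<omega>. spow (b - 1) (S \<omega>) * d n \<omega> \<partial>M) = 0"
    using d meas_spow unfolding orthogonal_def by auto
  define R where "R \<omega> = \<bar>S \<omega>\<bar> powr b + b * (spow (b - 1) (S \<omega>) * d n \<omega>) + 4 * \<bar>d n \<omega>\<bar> powr b" for \<omega>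
  have R: "integrable M R"
    unfolding R_def using IH(1) cross int[of n] by auto
  have le: "\<bar>S \<omega> + d n \<omega>\<bar> powr b \<le> R \<omega>" for \<omega>
    using abs_powr_add_le[OF b, of "S \<omega>" "d n \<omega>"] by (simp add: R_def mult.assoc)
  have i: "integrable M (\<lambda>\<omega>. \<bar>S \<omega> + d n \<omega>\<bar> powr b)"
    by (rule Bochner_Integration.integrable_bound[OF R])
      (use le in \<open>auto intro: order_trans[OF _ abs_ge_self]\<close>)
  have "(\<integral>\<omega>. \<bar>S \<omega> + d n \<omega>\<bar> powr b \<partial>M) \<le> (\<integral>\<omega>. R \<omega> \<partial>M)"
    by (rule integral_mono[OF i R le])
  also have "\<dots> = (\<integral>\<omega>. \<bar>S \<omega>\<bar> powr b \<partial>M) + b * (\<integral>\<omega>. spow (b - 1) (S \<omega>) * d n \<omega> \<partial>M)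
      + 4 * (\<integral>\<omega>. \<bar>d n \<omega>\<bar> powr b \<partial>M)"
    unfolding R_def using IH(1) cross int[of n] by simp
  finally show ?case
    using IH(2) i zero by (simp add: S_def)
qed

text \<open>Stopping at the first passage over \<epsilon> is multiplication by a predictable
  indicator, so the stopped sequence is again orthogonal. Markov's inequality for its final sum
  controls the maximum of the original sums.\<close>

lemma orthogonal_maximal:
  assumes d: "orthogonal d" and b: "1 < b" "b \<le> 2"
    and int: "\<And>n. integrable M (\<lambda>\<omega>. \<bar>d n \<omega>\<bar> powr b)"
    and "0 < \<epsilon>"
  shows "prob {\<omega>\<in>space M. \<exists>j\<in>{m..n}. \<epsilon> \<le> \<bar>\<Sum>k=m..<j. d k \<omega>\<bar>} * \<epsilon> powr b
    \<le> 4 * (\<Sum>k=m..<n. \<integral>\<omega>. \<bar>d k \<omega>\<bar> powr b \<partial>M)"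
proof -
  have dM[measurable]: "d k \<in> borel_measurable M" for k
    using measurable_F_M[OF orthogonal_measurable[OF d]] .
  \<comment> \<open>Equal to 1 until the first passage; it involves \<open>d i\<close> for i < k
    only and is therefore measurable for \<open>F k\<close>.\<close>
  define g where "g k \<omega> = (if m \<le> k \<and> (\<forall>j\<in>{m..k}. \<bar>\<Sum>i=m..<j. d i \<omega>\<bar> < \<epsilon>) then 1 else 0 :: real)" for k \<omega>
  have g: "g k \<in> borel_measurable (F k)" for k
  proof -
    have [measurable]: "(\<lambda>\<omega>. \<Sum>i=m..<j. d i \<omega>) \<in> borel_measurable (F k)" if "j \<in> {m..k}" for j
      using that
      by (intro borel_measurable_sum measurable_F_mono[OF orthogonal_measurable[OF d]]) auto
    show ?thesis unfolding g_def by measurable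
  qed
  define h where "h k \<omega> = g k \<omega> * d k \<omega>" for k \<omega>
  have h: "orthogonal h"
    using orthogonal_mult[OF d g] by (simp add: h_def[abs_def])
  have hM[measurable]: "h k \<in> borel_measurable M" for k
    using measurable_F_M[OF orthogonal_measurable[OF h]] .
  have h_le: "\<bar>h k \<omega>\<bar> powr b \<le> (if m \<le> k then \<bar>d k \<omega>\<bar> powr b else 0)" for k \<omega>
    by (auto simp: h_def g_def)
  have h_le': "\<bar>h k \<omega>\<bar> powr b \<le> \<bar>d k \<omega>\<bar> powr b" for k \<omega>
    by (auto simp: h_def g_def)
  have h_int: "integrable M (\<lambda>\<omega>. \<bar>h k \<omega>\<bar> powr b)" for k
    by (rule Bochner_Integration.integrable_bound[OF int[of k]]) (use h_le' in auto)
  note mom = orthogonal_moment_le[OF h b h_int, of n]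
  define E where "E = {\<omega>\<in>space M. \<exists>j\<in>{m..n}. \<epsilon> \<le> \<bar>\<Sum>k=m..<j. d k \<omega>\<bar>}"
  have [measurable]: "E \<in> sets M"
    unfolding E_def by measurable
  have stop: "\<epsilon> \<le> \<bar>\<Sum>k<n. h k \<omega>\<bar>" if "\<omega> \<in> E" for \<omega>
  proof -
    define P where "P j \<longleftrightarrow> j \<in> {m..n} \<and> \<epsilon> \<le> \<bar>\<Sum>k=m..<j. d k \<omega>\<bar>" for j
    obtain j0 where "P j0" using \<open>\<omega> \<in> E\<close> unfolding E_def P_def by blast
    define j where "j = (LEAST j. P j)"
    have j: "P j" unfolding j_def by (rule LeastI) fact
    have least: "\<not> P i" if "i < j" for i using that unfolding j_def by (rule not_less_Least)
    have gk: "g k \<omega> = (if k \<in> {m..<j} then 1 else 0)" if "k < n" for k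
    proof -
      have "(\<forall>i\<in>{m..k}. \<bar>\<Sum>i=m..<i. d i \<omega>\<bar> < \<epsilon>) \<longleftrightarrow> k < j" if "m \<le> k"
      proof
        assume *: "\<forall>i\<in>{m..k}. \<bar>\<Sum>i=m..<i. d i \<omega>\<bar> < \<epsilon>"
        show "k < j"
        proof (rule ccontr)
          assume "\<not> k < j"
          then have "j \<in> {m..k}" using j by (auto simp: P_def)
          with * have "\<bar>\<Sum>i=m..<j. d i \<omega>\<bar> < \<epsilon>" by (rule bspec)
          with j show False by (auto simp: P_def)
        qed
      next
        assume "k < j"
        show "\<forall>i\<in>{m..k}. \<bar>\<Sum>i=m..<i. d i \<omega>\<bar> < \<epsilon>"
        proof
          fix i assume "i \<in> {m..k}"
          then show "\<bar>\<Sum>i=m..<i. d i \<omega>\<bar> < \<epsilon>"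
            using least[of i] \<open>k < j\<close> \<open>k < n\<close> by (auto simp: P_def not_le)
        qed
      qed
      then show ?thesis by (auto simp: g_def)
    qed
    have "(\<Sum>k<n. h k \<omega>) = (\<Sum>k<n. if k \<in> {m..<j} then d k \<omega> else 0)"
      by (intro sum.cong) (auto simp: h_def gk)
    also have "\<dots> = (\<Sum>k\<in>{..<n} \<inter> {m..<j}. d k \<omega>)"
      by (simp add: sum.inter_restrict)
    also have "{..<n} \<inter> {m..<j} = {m..<j}"
      using j by (auto simp: P_def)
    finally show ?thesis using j by (simp add: P_def)
  qed
  have "prob E * \<epsilon> powr b = (\<integral>\<omega>. indicator E \<omega> * \<epsilon> powr b \<partial>M)"
    by simp
  also have "\<dots> \<le> (\<integral>\<omega>. \<bar>\<Sum>k<n. h k \<omega>\<bar> powr b \<partial>M)"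
  proof (rule integral_mono)
    show "integrable M (\<lambda>\<omega>. indicator E \<omega> * \<epsilon> powr b)"
      by (intro integrable_mult_left integrable_real_indicator) (auto simp: less_top[symmetric])
    show "indicator E \<omega> * \<epsilon> powr b \<le> \<bar>\<Sum>k<n. h k \<omega>\<bar> powr b" for \<omega>
      using b \<open>0 < \<epsilon>\<close> by (auto simp: indicator_def intro!: powr_mono2 stop)
  qed (use mom in simp)
  also have "\<dots> \<le> 4 * (\<Sum>k<n. \<integral>\<omega>. \<bar>h k \<omega>\<bar> powr b \<partial>M)"
    using mom by simp
  also have "(\<Sum>k<n. \<integral>\<omega>. \<bar>h k \<omega>\<bar> powr b \<partial>M) \<le> (\<Sum>k<n. if k \<in> {m..<n} then \<integral>\<omega>. \<bar>d k \<omega>\<bar> powr b \<partial>M else 0)"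
  proof (rule sum_mono)
    fix k assume "k \<in> {..<n}"
    then show "(\<integral>\<omega>. \<bar>h k \<omega>\<bar> powr b \<partial>M) \<le> (if k \<in> {m..<n} then \<integral>\<omega>. \<bar>d k \<omega>\<bar> powr b \<partial>M else 0)"
      using integral_mono[OF h_int[of k] int[of k] h_le'] by (auto simp: h_def g_def)
  qed
  also have "\<dots> = (\<Sum>k=m..<n. \<integral>\<omega>. \<bar>d k \<omega>\<bar> powr b \<partial>M)"
  proof -
    have "{..<n} \<inter> {m..<n} = {m..<n}" by auto
    then show ?thesis by (simp add: sum.inter_restrict[symmetric] del: atLeastLessThan_iff)
  qed
  finally show ?thesis by (simp add: E_def)
qed

text \<open>By the maximal inequality, the probability that the sums ever move by \<epsilon> after
  index m is at most a constant times the tail of the series of moments; hence the partial sums are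
  almost surely Cauchy.\<close>

lemma orthogonal_summable:
  assumes d: "orthogonal d" and b: "1 < b" "b \<le> 2"
    and int: "\<And>n. integrable M (\<lambda>\<omega>. \<bar>d n \<omega>\<bar> powr b)"
    and summ: "summable (\<lambda>n. \<integral>\<omega>. \<bar>d n \<omega>\<bar> powr b \<partial>M)"
  shows "AE \<omega> in M. summable (\<lambda>n. d n \<omega>)"
proof -
  have dM[measurable]: "d k \<in> borel_measurable M" for k
    using measurable_F_M[OF orthogonal_measurable[OF d]] .
  let ?a = "\<lambda>n. \<integral>\<omega>. \<bar>d n \<omega>\<bar> powr b \<partial>M"
  define E where "E \<epsilon> m = {\<omega>\<in>space M. \<exists>j\<ge>m. \<epsilon> \<le> \<bar>\<Sum>k=m..<j. d k \<omega>\<bar>}" for \<epsilon> :: real and m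
  have [measurable]: "E \<epsilon> m \<in> sets M" for \<epsilon> m
    unfolding E_def by measurable
  have bound: "prob (E \<epsilon> m) * \<epsilon> powr b \<le> 4 * (\<Sum>k. ?a (k + m))" if "0 < \<epsilon>" for \<epsilon> m
  proof -
    define A where "A n = {\<omega>\<in>space M. \<exists>j\<in>{m..n}. \<epsilon> \<le> \<bar>\<Sum>k=m..<j. d k \<omega>\<bar>}" for n
    have [measurable]: "A n \<in> sets M" for n
      unfolding A_def by measurable
    have "incseq A" by (rule incseq_SucI) (auto simp: A_def)
    then have "(\<lambda>n. prob (A n)) \<longlonglongrightarrow> prob (\<Union>n. A n)"
      by (intro finite_Lim_measure_incseq) auto
    also have "(\<Union>n. A n) = E \<epsilon> m"
      unfolding A_def E_def by (auto 0 3)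
    finally have "(\<lambda>n. prob (A n) * \<epsilon> powr b) \<longlonglongrightarrow> prob (E \<epsilon> m) * \<epsilon> powr b"
      by (intro tendsto_intros)
    moreover have "prob (A n) * \<epsilon> powr b \<le> 4 * (\<Sum>k. ?a (k + m))" for n
    proof -
      have "prob (A n) * \<epsilon> powr b \<le> 4 * (\<Sum>k=m..<n. ?a k)"
        unfolding A_def by (rule orthogonal_maximal[OF d b int that])
      also have "(\<Sum>k=m..<n. ?a k) = (\<Sum>k<n - m. ?a (k + m))"
        by (cases "m \<le> n")
          (auto intro!: sum.reindex_bij_witness[of _ "\<lambda>k. k + m" "\<lambda>k. k - m"])
      also have "\<dots> \<le> (\<Sum>k. ?a (k + m))"
        by (intro sum_le_suminf summable_ignore_initial_segment[OF summ]) auto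
      finally show ?thesis by simp
    qed
    ultimately show ?thesis by (intro LIMSEQ_le_const2) auto
  qed
  have tail: "(\<lambda>m. \<Sum>k. ?a (k + m)) \<longlonglongrightarrow> 0"
    using suminf_exist_split2[OF summ] .
  have null: "AE \<omega> in M. \<exists>m. \<omega> \<notin> E \<epsilon> m" if "0 < \<epsilon>" for \<epsilon>
  proof -
    have "prob (\<Inter>m. E \<epsilon> m) * \<epsilon> powr b \<le> 4 * (\<Sum>k. ?a (k + m))" for m
    proof -
      have "prob (\<Inter>m. E \<epsilon> m) \<le> prob (E \<epsilon> m)"
        by (intro finite_measure_mono) auto
      then show ?thesis
        using bound[OF that, of m] by (meson mult_right_mono order_trans powr_ge_zero)
    qed
    then have "prob (\<Inter>m. E \<epsilon> m) * \<epsilon> powr b \<le> 4 * 0"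
      by (intro LIMSEQ_le_const[OF tendsto_mult_left[OF tail]]) auto
    then have "prob (\<Inter>m. E \<epsilon> m) \<le> 0"
      using that by (simp add: mult_le_0_iff)
    then have "prob (\<Inter>m. E \<epsilon> m) = 0"
      using measure_nonneg[of M "\<Inter>m. E \<epsilon> m"] by linarith
    then have "AE \<omega> in M. \<omega> \<notin> (\<Inter>m. E \<epsilon> m)"
      by (subst prob_eq_0[symmetric]) auto
    then show ?thesis by auto
  qed
  have "AE \<omega> in M. \<forall>r::nat. \<exists>m. \<omega> \<notin> E (1 / Suc r) m"
    by (subst AE_all_countable) (intro allI null, simp)
  with AE_space show ?thesis
  proof eventually_elim
    case (elim \<omega>)
    have small: "\<exists>m. \<forall>j\<ge>m. \<bar>\<Sum>k=m..<j. d k \<omega>\<bar> < e" if "0 < e" for e :: real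
    proof -
      obtain r where r: "1 / Suc r < e"
        using reals_Archimedean[OF \<open>0 < e\<close>] by (auto simp: inverse_eq_divide)
      obtain m where m: "\<omega> \<notin> E (1 / Suc r) m" using elim by blast
      have "\<bar>\<Sum>k=m..<j. d k \<omega>\<bar> < 1 / Suc r" if "m \<le> j" for j
      proof (rule ccontr)
        assume "\<not> ?thesis"
        then have "\<omega> \<in> E (1 / Suc r) m" using elim that unfolding E_def not_less by blast
        with m show False ..
      qed
      then show ?thesis using r by (meson order.strict_trans)
    qed
    show ?case
    proof (rule summable_Cauchy[THEN iffD2], intro allI impI)
      fix e :: real assume "0 < e"
      then obtain m where m: "\<And>j. j \<ge> m \<Longrightarrow> \<bar>\<Sum>k=m..<j. d k \<omega>\<bar> < e / 2"
        using small[of "e / 2"] by auto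
      have "norm (sum (\<lambda>n. d n \<omega>) {i..<j}) < e" if "i \<ge> m" for i j
      proof (cases "i \<le> j")
        case True
        have "(\<Sum>k=m..<j. d k \<omega>) = (\<Sum>k=m..<i. d k \<omega>) + (\<Sum>k=i..<j. d k \<omega>)"
          using that True by (simp add: sum.atLeastLessThan_concat)
        then show ?thesis using m[of i] m[of j] that True by (auto simp: abs_if split: if_splits)
      qed (use \<open>0 < e\<close> in auto)
      then show "\<exists>N. \<forall>m\<ge>N. \<forall>n. norm (sum (\<lambda>n. d n \<omega>) {m..<n}) < e" by blast
    qed
  qed
qed

end

section \<open>Martingale transforms, by localization\<close>

context filtered_prob_space
begin

text \<open>A local convergence theorem: neither weights nor products need be integrable. The
  weights are cut off once the accumulated conditional moments exceed N, which makes the moments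
  summable; for almost every outcome some N produces no cut at all.\<close>

theorem martingale_transform_summable:
  assumes D: "martingale_difference M F D" and b: "1 < b" "b \<le> 2"
    and w: "\<And>n. w n \<in> borel_measurable (F n)"
    and fin: "AE \<omega> in M. (\<Sum>n. ennreal (\<bar>w n \<omega>\<bar> powr b) *
        nn_cond_exp M (F n) (\<lambda>\<omega>. ennreal (\<bar>D (Suc n) \<omega>\<bar> powr b)) \<omega>) < \<infinity>"
  shows "AE \<omega> in M. summable (\<lambda>n. w n \<omega> * D (Suc n) \<omega>)"
proof -
  have DM[measurable]: "D (Suc n) \<in> borel_measurable M" for n
    using D measurable_F_M by (auto simp: martingale_difference_def)
  have wM[measurable]: "w n \<in> borel_measurable M" for n
    by (rule measurable_F_M[OF w])
  define a where "a n \<omega> = ennreal (\<bar>w n \<omega>\<bar> powr b) *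
        nn_cond_exp M (F n) (\<lambda>\<omega>. ennreal (\<bar>D (Suc n) \<omega>\<bar> powr b)) \<omega>" for n \<omega>
  have a: "a n \<in> borel_measurable (F n)" for n
    unfolding a_def using w[of n] by measurable
  have aM[measurable]: "a n \<in> borel_measurable M" for n
    by (rule measurable_F_M[OF a])
  \<comment> \<open>The sum includes index n, which is predictable because \<open>a n\<close> is
    measurable for \<open>F n\<close>; the terms kept therefore never add up to more than N.\<close>
  define g where "g N n \<omega> = (if (\<Sum>k\<le>n. a k \<omega>) \<le> of_nat N then 1 else 0 :: real)" for N n \<omega>
  have g: "g N n \<in> borel_measurable (F n)" for N n
  proof -
    have [measurable]: "(\<lambda>\<omega>. \<Sum>k\<le>n. a k \<omega>) \<in> borel_measurable (F n)"
      by (intro borel_measurable_sum measurable_F_mono[OF a]) auto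
    show ?thesis unfolding g_def by measurable
  qed
  have gM[measurable]: "g N n \<in> borel_measurable M" for N n
    by (rule measurable_F_M[OF g])
  have stopped: "(\<Sum>k<m. ennreal (g N k \<omega>) * a k \<omega>) \<le> of_nat N" for m N \<omega>
  proof (induction m)
    case (Suc m)
    show ?case
    proof (cases "(\<Sum>k\<le>m. a k \<omega>) \<le> of_nat N")
      case True
      have "(\<Sum>k<Suc m. ennreal (g N k \<omega>) * a k \<omega>) \<le> (\<Sum>k<Suc m. 1 * a k \<omega>)"
        by (intro sum_mono mult_right_mono) (auto simp: g_def)
      then show ?thesis using True by (simp add: lessThan_Suc_atMost)
    next
      case False
      then show ?thesis using Suc by (simp add: g_def)
    qed
  qed simp
  define d where "d N n \<omega> = (g N n \<omega> * w n \<omega>) * D (Suc n) \<omega>" for N n \<omega>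
  have d: "orthogonal (d N)" for N
    unfolding d_def[abs_def]
    by (rule orthogonal_mult[OF orthogonal_martingale_difference[OF D]])
      (use g w in \<open>auto intro!: borel_measurable_times\<close>)
  have dM[measurable]: "d N n \<in> borel_measurable M" for N n
    unfolding d_def by measurable
  have nn: "(\<integral>\<^sup>+\<omega>. ennreal (\<bar>d N n \<omega>\<bar> powr b) \<partial>M) = (\<integral>\<^sup>+\<omega>. ennreal (g N n \<omega>) * a n \<omega> \<partial>M)" for N n
  proof -
    interpret sigma_finite_subalgebra M "F n" by (rule sigma_finite_subalgebra_F)
    note [measurable] = g[of N n] w[of n]
    have "(\<integral>\<^sup>+\<omega>. ennreal (\<bar>d N n \<omega>\<bar> powr b) \<partial>M)
        = (\<integral>\<^sup>+\<omega>. (ennreal (g N n \<omega>) * ennreal (\<bar>w n \<omega>\<bar> powr b)) * ennreal (\<bar>D (Suc n) \<omega>\<bar> powr b) \<partial>M)"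
      by (intro nn_integral_cong)
        (auto simp: d_def g_def abs_mult powr_mult ennreal_mult)
    also have "\<dots> = (\<integral>\<^sup>+\<omega>. (ennreal (g N n \<omega>) * ennreal (\<bar>w n \<omega>\<bar> powr b)) *
        nn_cond_exp M (F n) (\<lambda>\<omega>. ennreal (\<bar>D (Suc n) \<omega>\<bar> powr b)) \<omega> \<partial>M)"
      by (rule nn_cond_exp_intg[symmetric]; measurable)
    finally show ?thesis by (simp add: a_def mult.assoc)
  qed
  have sum_nn: "(\<Sum>k<m. \<integral>\<^sup>+\<omega>. ennreal (\<bar>d N k \<omega>\<bar> powr b) \<partial>M) \<le> of_nat N" for N m
  proof -
    have "(\<Sum>k<m. \<integral>\<^sup>+\<omega>. ennreal (\<bar>d N k \<omega>\<bar> powr b) \<partial>M)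
        = (\<integral>\<^sup>+\<omega>. (\<Sum>k<m. ennreal (g N k \<omega>) * a k \<omega>) \<partial>M)"
      unfolding nn by (rule nn_integral_sum[symmetric]) measurable
    also have "\<dots> \<le> (\<integral>\<^sup>+\<omega>. of_nat N \<partial>M)"
      by (intro nn_integral_mono stopped)
    finally show ?thesis by (simp add: emeasure_space_1)
  qed
  have int: "integrable M (\<lambda>\<omega>. \<bar>d N n \<omega>\<bar> powr b)" for N n
  proof (rule integrableI_nonneg)
    have "(\<integral>\<^sup>+\<omega>. ennreal (\<bar>d N n \<omega>\<bar> powr b) \<partial>M) \<le> (\<Sum>k<Suc n. \<integral>\<^sup>+\<omega>. ennreal (\<bar>d N k \<omega>\<bar> powr b) \<partial>M)"
      by simp
    also note sum_nn
    finally show "(\<integral>\<^sup>+\<omega>. ennreal (\<bar>d N n \<omega>\<bar> powr b) \<partial>M) < \<infinity>"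
      by (simp add: le_less_trans of_nat_less_top)
  qed auto
  have "summable (\<lambda>n. \<integral>\<omega>. \<bar>d N n \<omega>\<bar> powr b \<partial>M)" for N
  proof (rule summableI_nonneg_bounded)
    fix m
    have "ennreal (\<Sum>k<m. \<integral>\<omega>. \<bar>d N k \<omega>\<bar> powr b \<partial>M) = (\<Sum>k<m. \<integral>\<^sup>+\<omega>. ennreal (\<bar>d N k \<omega>\<bar> powr b) \<partial>M)"
      by (subst sum_ennreal[symmetric]) (auto simp: nn_integral_eq_integral[OF int])
    also note sum_nn
    finally show "(\<Sum>k<m. \<integral>\<omega>. \<bar>d N k \<omega>\<bar> powr b \<partial>M) \<le> real N"
      by (simp add: ennreal_of_nat_eq_real_of_nat)
  qed simp
  then have "AE \<omega> in M. summable (\<lambda>n. d N n \<omega>)" for N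
    by (intro orthogonal_summable[OF d b int])
  then have "AE \<omega> in M. \<forall>N. summable (\<lambda>n. d N n \<omega>)"
    by (simp add: AE_all_countable)
  with fin show ?thesis
  proof eventually_elim
    case (elim \<omega>)
    then have fin': "(\<Sum>n. a n \<omega>) < \<infinity>" by (simp add: a_def)
    obtain N where N: "(\<Sum>n. a n \<omega>) \<le> of_nat N"
    proof -
      obtain r where r: "(\<Sum>n. a n \<omega>) = ennreal r" "0 \<le> r"
        using fin' by (cases "\<Sum>n. a n \<omega>") auto
      obtain N where "r \<le> real N" using real_arch_simple by blast
      then have "(\<Sum>n. a n \<omega>) \<le> of_nat N"
        using r by (simp add: ennreal_of_nat_eq_real_of_nat)
      then show ?thesis by (rule that)
    qed
    have "(\<Sum>k\<le>n. a k \<omega>) \<le> (\<Sum>n. a n \<omega>)" for n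
      by (intro sum_le_suminf) auto
    then have "g N n \<omega> = 1" for n
      using N order_trans by (auto simp: g_def)
    moreover have "summable (\<lambda>n. d N n \<omega>)" using elim by simp
    ultimately show ?case by (simp add: d_def)
  qed
qed

end

section \<open>Transforms of the driving noise and of its centred squares\<close>

locale white_noise = filtered_prob_space M F for M :: "'a measure" and F +
  fixes V :: "nat \<Rightarrow> 'a \<Rightarrow> real" and \<sigma> :: real
  assumes V_mds: "martingale_difference M F V"
    and \<sigma>_pos: "\<sigma>\<^sup>2 > 0"
    and cond_var: "\<And>n. AE \<omega> in M. real_cond_exp M (F n) (\<lambda>\<omega>. (V (Suc n) \<omega>)\<^sup>2) \<omega> = \<sigma>\<^sup>2"
    and moment: "finite_conditional_moment_gt2 M F V"
begin

lemma V_measurable: "V (Suc n) \<in> borel_measurable (F (Suc n))"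
  using V_mds by (simp add: martingale_difference_def)

lemma V_measurable_M [measurable]: "V (Suc n) \<in> borel_measurable M"
  by (rule measurable_F_M[OF V_measurable])

lemma nn_cond_var:
  "AE \<omega> in M. nn_cond_exp M (F n) (\<lambda>\<omega>. ennreal ((V (Suc n) \<omega>)\<^sup>2)) \<omega> = ennreal (\<sigma>\<^sup>2)"
proof -
  interpret sigma_finite_subalgebra M "F n" by (rule sigma_finite_subalgebra_F)
  have "AE \<omega> in M. 0 = nn_cond_exp M (F n) (\<lambda>\<omega>. 0) \<omega>"
    by (rule nn_cond_exp_F_meas) simp
  with cond_var[of n] show ?thesis
  proof eventually_elim
    case (elim \<omega>)
    then have "enn2real (nn_cond_exp M (F n) (\<lambda>\<omega>. ennreal ((V (Suc n) \<omega>)\<^sup>2)) \<omega>) = \<sigma>\<^sup>2"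
      by (simp add: real_cond_exp_def ennreal_neg)
    \<comment> \<open>An infinite conditional expectation would be sent to 0 by
      \<open>enn2real\<close>, contrary to \<sigma>^2 > 0.\<close>
    then show ?case
      using \<sigma>_pos by (metis enn2real_top ennreal_enn2real less_irrefl top.not_eq_extremum)
  qed
qed

lemma nn_integral_V2:
  assumes "h \<in> borel_measurable (F n)"
  shows "(\<integral>\<^sup>+\<omega>. h \<omega> * ennreal ((V (Suc n) \<omega>)\<^sup>2) \<partial>M) = (\<integral>\<^sup>+\<omega>. h \<omega> * ennreal (\<sigma>\<^sup>2) \<partial>M)"
proof -
  interpret sigma_finite_subalgebra M "F n" by (rule sigma_finite_subalgebra_F)
  have "(\<integral>\<^sup>+\<omega>. h \<omega> * ennreal ((V (Suc n) \<omega>)\<^sup>2) \<partial>M)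
      = (\<integral>\<^sup>+\<omega>. h \<omega> * nn_cond_exp M (F n) (\<lambda>\<omega>. ennreal ((V (Suc n) \<omega>)\<^sup>2)) \<omega> \<partial>M)"
    by (rule nn_cond_exp_intg[OF assms, symmetric]) measurable
  also have "\<dots> = (\<integral>\<^sup>+\<omega>. h \<omega> * ennreal (\<sigma>\<^sup>2) \<partial>M)"
    using nn_cond_var[of n] by (intro nn_integral_cong_AE) auto
  finally show ?thesis .
qed

lemma integrable_V2: "integrable M (\<lambda>\<omega>. (V (Suc n) \<omega>)\<^sup>2)"
  using nn_integral_V2[of "\<lambda>_. 1" n]
  by (intro integrableI_nonneg) (auto simp: emeasure_space_1)

theorem V_transform_summable:
  assumes w: "\<And>n. w n \<in> borel_measurable (F n)"
    and fin: "AE \<omega> in M. summable (\<lambda>n. (w n \<omega>)\<^sup>2)"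
  shows "AE \<omega> in M. summable (\<lambda>n. w n \<omega> * V (Suc n) \<omega>)"
proof (rule martingale_transform_summable[OF V_mds, of 2])
  have "AE \<omega> in M. \<forall>n. nn_cond_exp M (F n) (\<lambda>\<omega>. ennreal ((V (Suc n) \<omega>)\<^sup>2)) \<omega> = ennreal (\<sigma>\<^sup>2)"
    using nn_cond_var by (simp add: AE_all_countable)
  with fin show "AE \<omega> in M. (\<Sum>n. ennreal (\<bar>w n \<omega>\<bar> powr 2) *
        nn_cond_exp M (F n) (\<lambda>\<omega>. ennreal (\<bar>V (Suc n) \<omega>\<bar> powr 2)) \<omega>) < \<infinity>"
  proof eventually_elim
    case (elim \<omega>)
    have *: "\<bar>z\<bar> powr 2 = z\<^sup>2" for z :: real
      by (cases "z = 0") (auto simp: powr_numeral)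
    have "(\<Sum>n. ennreal ((w n \<omega>)\<^sup>2) * ennreal (\<sigma>\<^sup>2)) = (\<Sum>n. ennreal ((w n \<omega>)\<^sup>2)) * ennreal (\<sigma>\<^sup>2)"
      by (rule ennreal_suminf_multc)
    also have "\<dots> < \<infinity>"
      using elim(1) by (subst suminf_ennreal2) (auto simp: ennreal_mult_less_top)
    finally show ?case using elim(2) unfolding * by simp
  qed
qed (use w in auto)

text \<open>A moment exponent for V^2 - \<sigma>^2: half of some admissible exponent of V, hence
  above 1, and cut at 2 because the transform theorem covers 1 < b \<le> 2.\<close>

definition mexp :: real where
  "mexp = min 2 ((SOME a. a > 2 \<and> (AE \<omega> in M.
       (SUP n. nn_cond_exp M (F n) (\<lambda>\<omega>. ennreal (\<bar>V (Suc n) \<omega>\<bar> powr a)) \<omega>) < \<infinity>)) / 2)"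

lemma mexp: "1 < mexp" "mexp \<le> 2"
  and mexp_moment: "AE \<omega> in M. \<exists>C\<ge>0. \<forall>n.
    nn_cond_exp M (F n) (\<lambda>\<omega>. ennreal (\<bar>(V (Suc n) \<omega>)\<^sup>2 - \<sigma>\<^sup>2\<bar> powr mexp)) \<omega> \<le> ennreal C"
proof -
  define P where "P a \<longleftrightarrow> a > 2 \<and> (AE \<omega> in M.
       (SUP n. nn_cond_exp M (F n) (\<lambda>\<omega>. ennreal (\<bar>V (Suc n) \<omega>\<bar> powr a)) \<omega>) < \<infinity>)" for a
  define a where "a = (SOME a. P a)"
  have "\<exists>a. P a" using moment by (auto simp: finite_conditional_moment_gt2_def P_def)
  then have a: "P a" unfolding a_def by (rule someI_ex)
  have mexp_eq: "mexp = min 2 (a / 2)"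
    by (simp add: mexp_def a_def P_def)
  show m: "1 < mexp" "mexp \<le> 2" using a by (auto simp: mexp_eq P_def)
  let ?c = "1 + (\<sigma>\<^sup>2) powr mexp"
  have le: "\<bar>v\<^sup>2 - \<sigma>\<^sup>2\<bar> powr mexp \<le> ?c + \<bar>v\<bar> powr a" for v
  proof -
    have "\<bar>v\<^sup>2 - \<sigma>\<^sup>2\<bar> \<le> max (v\<^sup>2) (\<sigma>\<^sup>2)"
      using \<sigma>_pos by (auto simp: max_def abs_if)
    then have "\<bar>v\<^sup>2 - \<sigma>\<^sup>2\<bar> powr mexp \<le> (max (v\<^sup>2) (\<sigma>\<^sup>2)) powr mexp"
      using m by (intro powr_mono2) auto
    also have "\<dots> \<le> (v\<^sup>2) powr mexp + (\<sigma>\<^sup>2) powr mexp"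
      by (auto simp: max_def)
    also have "(v\<^sup>2) powr mexp = \<bar>v\<bar> powr (2 * mexp)"
      by (cases "v = 0") (auto simp: powr_powr[symmetric] powr_numeral)
    also have "\<dots> \<le> 1 + \<bar>v\<bar> powr a"
    proof (cases "\<bar>v\<bar> \<le> 1")
      case True
      then have "\<bar>v\<bar> powr (2 * mexp) \<le> 1 powr (2 * mexp)" using m by (intro powr_mono2) auto
      then show ?thesis by (simp add: add_increasing2)
    next
      case False
      then have "\<bar>v\<bar> powr (2 * mexp) \<le> \<bar>v\<bar> powr a"
        using a by (intro powr_mono) (auto simp: mexp_eq P_def)
      then show ?thesis by simp
    qed
    finally show ?thesis by simp
  qed
  let ?U = "\<lambda>n \<omega>. nn_cond_exp M (F n) (\<lambda>\<omega>. ennreal (\<bar>V (Suc n) \<omega>\<bar> powr a)) \<omega>"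
  have "AE \<omega> in M. nn_cond_exp M (F n) (\<lambda>\<omega>. ennreal (\<bar>(V (Suc n) \<omega>)\<^sup>2 - \<sigma>\<^sup>2\<bar> powr mexp)) \<omega>
      \<le> ennreal ?c + ?U n \<omega>" for n
  proof -
    interpret sigma_finite_subalgebra M "F n" by (rule sigma_finite_subalgebra_F)
    have "AE \<omega> in M. nn_cond_exp M (F n) (\<lambda>\<omega>. ennreal (\<bar>(V (Suc n) \<omega>)\<^sup>2 - \<sigma>\<^sup>2\<bar> powr mexp)) \<omega>
        \<le> nn_cond_exp M (F n) (\<lambda>\<omega>. ennreal ?c + ennreal (\<bar>V (Suc n) \<omega>\<bar> powr a)) \<omega>"
    proof (rule nn_cond_exp_mono)
      show "AE \<omega> in M. ennreal (\<bar>(V (Suc n) \<omega>)\<^sup>2 - \<sigma>\<^sup>2\<bar> powr mexp)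
          \<le> ennreal ?c + ennreal (\<bar>V (Suc n) \<omega>\<bar> powr a)"
        using le by (auto simp: ennreal_plus[symmetric] simp del: ennreal_plus)
    qed measurable
    moreover have "AE \<omega> in M. nn_cond_exp M (F n) (\<lambda>\<omega>. ennreal ?c) \<omega> + ?U n \<omega>
        = nn_cond_exp M (F n) (\<lambda>\<omega>. ennreal ?c + ennreal (\<bar>V (Suc n) \<omega>\<bar> powr a)) \<omega>"
      by (rule nn_cond_exp_sum) measurable
    moreover have "AE \<omega> in M. ennreal ?c = nn_cond_exp M (F n) (\<lambda>\<omega>. ennreal ?c) \<omega>"
      by (rule nn_cond_exp_F_meas) measurable
    ultimately show ?thesis by eventually_elim simp
  qed
  then have "AE \<omega> in M. \<forall>n. nn_cond_exp M (F n) (\<lambda>\<omega>. ennreal (\<bar>(V (Suc n) \<omega>)\<^sup>2 - \<sigma>\<^sup>2\<bar> powr mexp)) \<omega>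
      \<le> ennreal ?c + ?U n \<omega>"
    by (simp add: AE_all_countable)
  moreover have "AE \<omega> in M. (SUP n. ?U n \<omega>) < \<infinity>"
    using a by (simp add: P_def)
  ultimately show "AE \<omega> in M. \<exists>C\<ge>0. \<forall>n.
    nn_cond_exp M (F n) (\<lambda>\<omega>. ennreal (\<bar>(V (Suc n) \<omega>)\<^sup>2 - \<sigma>\<^sup>2\<bar> powr mexp)) \<omega> \<le> ennreal C"
  proof eventually_elim
    case (elim \<omega>)
    obtain r where r: "(SUP n. ?U n \<omega>) = ennreal r" "0 \<le> r"
      using elim(2) by (cases "SUP n. ?U n \<omega>") auto
    have "nn_cond_exp M (F n) (\<lambda>\<omega>. ennreal (\<bar>(V (Suc n) \<omega>)\<^sup>2 - \<sigma>\<^sup>2\<bar> powr mexp)) \<omega> \<le> ennreal (?c + r)" for n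
    proof -
      have "?U n \<omega> \<le> ennreal r" unfolding r(1)[symmetric] by (rule SUP_upper) simp
      then show ?thesis using elim(1) r(2)
        by (subst ennreal_plus) (auto intro: order_trans[OF _ add_left_mono])
    qed
    then show ?case using r by (intro exI[of _ "?c + r"]) auto
  qed
qed

theorem V2_transform_summable:
  assumes w: "\<And>n. w n \<in> borel_measurable (F n)"
    and fin: "AE \<omega> in M. summable (\<lambda>n. \<bar>w n \<omega>\<bar> powr mexp)"
  shows "AE \<omega> in M. summable (\<lambda>n. w n \<omega> * ((V (Suc n) \<omega>)\<^sup>2 - \<sigma>\<^sup>2))"
proof -
  define D where "D n \<omega> = (V n \<omega>)\<^sup>2 - \<sigma>\<^sup>2" for n \<omega>
  have D: "martingale_difference M F D"
    unfolding martingale_difference_def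
  proof (intro allI conjI)
    fix n
    interpret sigma_finite_subalgebra M "F n" by (rule sigma_finite_subalgebra_F)
    show "D (Suc n) \<in> borel_measurable (F (Suc n))"
      unfolding D_def using V_measurable[of n] by measurable
    show "integrable M (D (Suc n))"
      unfolding D_def using integrable_V2 by auto
    have "AE \<omega> in M. real_cond_exp M (F n) (\<lambda>\<omega>. (V (Suc n) \<omega>)\<^sup>2 - \<sigma>\<^sup>2) \<omega>
        = real_cond_exp M (F n) (\<lambda>\<omega>. (V (Suc n) \<omega>)\<^sup>2) \<omega> - real_cond_exp M (F n) (\<lambda>\<omega>. \<sigma>\<^sup>2) \<omega>"
      by (rule real_cond_exp_diff) (auto intro: integrable_V2)
    moreover have "AE \<omega> in M. real_cond_exp M (F n) (\<lambda>\<omega>. \<sigma>\<^sup>2) \<omega> = \<sigma>\<^sup>2"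
      by (rule real_cond_exp_F_meas) auto
    ultimately show "AE \<omega> in M. real_cond_exp M (F n) (D (Suc n)) \<omega> = 0"
      unfolding D_def using cond_var[of n] by eventually_elim simp
  qed
  have "AE \<omega> in M. summable (\<lambda>n. w n \<omega> * D (Suc n) \<omega>)"
  proof (rule martingale_transform_summable[OF D mexp w])
    from mexp_moment fin show "AE \<omega> in M. (\<Sum>n. ennreal (\<bar>w n \<omega>\<bar> powr mexp) *
        nn_cond_exp M (F n) (\<lambda>\<omega>. ennreal (\<bar>D (Suc n) \<omega>\<bar> powr mexp)) \<omega>) < \<infinity>"
    proof eventually_elim
      case (elim \<omega>)
      then obtain C where C: "0 \<le> C" "\<And>n. nn_cond_exp M (F n)
          (\<lambda>\<omega>. ennreal (\<bar>D (Suc n) \<omega>\<bar> powr mexp)) \<omega> \<le> ennreal C"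
        by (auto simp: D_def)
      have "(\<Sum>n. ennreal (\<bar>w n \<omega>\<bar> powr mexp) *
          nn_cond_exp M (F n) (\<lambda>\<omega>. ennreal (\<bar>D (Suc n) \<omega>\<bar> powr mexp)) \<omega>)
          \<le> (\<Sum>n. ennreal (\<bar>w n \<omega>\<bar> powr mexp) * ennreal C)"
        by (intro suminf_le mult_left_mono C) auto
      also have "\<dots> = (\<Sum>n. ennreal (\<bar>w n \<omega>\<bar> powr mexp)) * ennreal C"
        by (rule ennreal_suminf_multc)
      also have "\<dots> < \<infinity>"
        using elim(2) by (subst suminf_ennreal2) (auto simp: ennreal_mult_less_top)
      finally show ?case .
    qed
  qed
  then show ?thesis by (simp add: D_def)
qed

end

text \<open>Kronecker's lemma in quantitative form: Abel summation against blocks of the convergent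
  series, which from m on are at most \<epsilon> / 2. The constant C collects the terms before m, so
  the bound is meaningful even if \<open>B\<close> stays bounded.\<close>

lemma kronecker_bound:
  fixes B t :: "nat \<Rightarrow> real"
  assumes "mono B" "\<And>n. 0 \<le> B n" "summable t" "0 < \<epsilon>"
  shows "\<exists>C. \<forall>n. \<bar>\<Sum>k\<le>n. B k * t k\<bar> \<le> C + \<epsilon> * B n"
proof -
  obtain m where m: "\<And>i j. i \<ge> m \<Longrightarrow> norm (sum t {i..<j}) < \<epsilon> / 2"
    using \<open>summable t\<close>[unfolded summable_Cauchy] \<open>0 < \<epsilon>\<close> by (metis half_gt_zero)
  define R where "R j = (\<Sum>k=m..<j. t k)" for j
  have R: "\<bar>R j\<bar> \<le> \<epsilon> / 2" for j
    using m[of m j] by (simp add: R_def)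
  have abel: "(\<Sum>k=m..n. B k * t k) = B n * R (Suc n) - (\<Sum>k=m..<n. (B (Suc k) - B k) * R (Suc k))"
    if "m \<le> n" for n
    using that
  proof (induction n rule: dec_induct)
    case base
    show ?case by (simp add: R_def)
  next
    case (step n)
    have "R (Suc (Suc n)) = R (Suc n) + t (Suc n)"
      using step by (simp add: R_def)
    then show ?case using step by (simp add: algebra_simps)
  qed
  have tail: "\<bar>\<Sum>k=m..n. B k * t k\<bar> \<le> \<epsilon> * B n" if "m \<le> n" for n
  proof -
    have "\<bar>\<Sum>k=m..<n. (B (Suc k) - B k) * R (Suc k)\<bar> \<le> (\<Sum>k=m..<n. (B (Suc k) - B k) * (\<epsilon> / 2))"
    proof (intro order_trans[OF sum_abs] sum_mono)
      fix k
      have "0 \<le> B (Suc k) - B k" using assms(1) by (simp add: monoD)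
      then show "\<bar>(B (Suc k) - B k) * R (Suc k)\<bar> \<le> (B (Suc k) - B k) * (\<epsilon> / 2)"
        using mult_left_mono[OF R, of "B (Suc k) - B k" "Suc k"] by (simp add: abs_mult)
    qed
    also have "\<dots> = (B n - B m) * (\<epsilon> / 2)"
      using that by (simp only: sum_distrib_right[symmetric] sum_Suc_diff')
    also have "\<dots> \<le> B n * (\<epsilon> / 2)"
      using assms by (intro mult_right_mono) auto
    finally have "\<bar>\<Sum>k=m..<n. (B (Suc k) - B k) * R (Suc k)\<bar> \<le> B n * (\<epsilon> / 2)" .
    moreover have "\<bar>B n * R (Suc n)\<bar> \<le> B n * (\<epsilon> / 2)"
      using mult_left_mono[OF R, of "B n" "Suc n"] assms(2) by (simp add: abs_mult)
    ultimately show ?thesis unfolding abel[OF that] by (simp add: algebra_simps)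
  qed
  show ?thesis
  proof (intro exI allI)
    fix n
    have C: "\<bar>\<Sum>k\<in>A. B k * t k\<bar> \<le> (\<Sum>k<m. \<bar>B k * t k\<bar>)" if "A \<subseteq> {..<m}" for A
      using that by (intro order_trans[OF sum_abs] sum_mono2) auto
    show "\<bar>\<Sum>k\<le>n. B k * t k\<bar> \<le> (\<Sum>k<m. \<bar>B k * t k\<bar>) + \<epsilon> * B n"
    proof (cases "m \<le> n")
      case True
      have "{..n} = {..<m} \<union> {m..n}" using True by auto
      then have "(\<Sum>k\<le>n. B k * t k) = (\<Sum>k<m. B k * t k) + (\<Sum>k=m..n. B k * t k)"
        by (simp add: sum.union_disjoint ivl_disj_int)
      then show ?thesis using C[OF order_refl] tail[OF True] by linarith
    next
      case False
      then have "{..n} \<subseteq> {..<m}" by auto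
      then show ?thesis using C[of "{..n}"] assms by (simp add: add_increasing2)
    qed
  qed
qed

lemma mean_tendsto_0_of_summable:
  fixes a :: "nat \<Rightarrow> real"
  assumes "summable (\<lambda>n. a n / real (Suc n))"
  shows "(\<lambda>n. (\<Sum>k<n. a k) / real n) \<longlonglongrightarrow> 0"
proof (rule LIMSEQ_I)
  fix r :: real assume "0 < r"
  have mono: "mono (\<lambda>n. real (Suc n))" by (auto intro: monoI)
  obtain C where C: "\<And>n. \<bar>\<Sum>k\<le>n. real (Suc k) * (a k / real (Suc k))\<bar> \<le> C + r / 2 * real (Suc n)"
    using kronecker_bound[OF mono _ assms, of "r / 2"] \<open>0 < r\<close> by auto
  have *: "\<bar>\<Sum>k<Suc n. a k\<bar> \<le> C + r / 2 * real (Suc n)" for n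
    using C[of n] by (simp add: lessThan_Suc_atMost del: of_nat_Suc)
  obtain N where N: "2 * C / r < real N" using reals_Archimedean2 by blast
  show "\<exists>no. \<forall>n\<ge>no. norm ((\<Sum>k<n. a k) / real n - 0) < r"
  proof (intro exI allI impI)
    fix n assume "n \<ge> Suc N"
    then obtain m where m: "n = Suc m" "N \<le> m" by (cases n) auto
    have "2 * C / r < real n" using N m by simp
    then have "C < r / 2 * real n" using \<open>0 < r\<close> by (simp add: field_simps)
    then have "\<bar>\<Sum>k<n. a k\<bar> < r * real n" using *[of m] m(1) by simp
    then show "norm ((\<Sum>k<n. a k) / real n - 0) < r"
      using m by (simp add: abs_divide divide_less_eq)
  qed
qed

text \<open>The Abel-Dini theorem. With s = b - 1, each term is at most 1/s times the decrease of
  B^(-s), and these decreases telescope.\<close>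

lemma summable_div_partial_sums_powr:
  fixes a :: "nat \<Rightarrow> real"
  assumes a: "\<And>n. 0 \<le> a n" and "1 < b"
  shows "summable (\<lambda>n. a n / (1 + (\<Sum>k\<le>n. a k)) powr b)"
proof -
  define s where "s = b - 1"
  have s: "0 < s" using assms by (simp add: s_def)
  define B where "B n = 1 + (\<Sum>k<n. a k)" for n
  have B: "1 \<le> B n" for n unfolding B_def using a by (simp add: sum_nonneg)
  have BSuc: "B (Suc n) = B n + a n" for n by (simp add: B_def)
  have step: "s * (a n / B (Suc n) powr b) \<le> B n powr (-s) - B (Suc n) powr (-s)" for n
  proof -
    define y where "y = B (Suc n)"
    define t where "t = B n / y"
    have y: "1 \<le> y" using B by (simp add: y_def)
    have t: "0 < t" using B[of n] y by (simp add: t_def)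
    \<comment> \<open>The tangent of t^(-s) at t = 1, obtained from exp u \<ge> 1 + u and ln t \<le>
      t - 1.\<close>
    have "1 - s * (t - 1) \<le> 1 + (- s) * ln t"
      using ln_le_minus_one[OF t] s by simp
    also have "\<dots> \<le> t powr (- s)"
      using exp_ge_add_one_self[of "(- s) * ln t"] t by (simp add: powr_def)
    finally have "y powr (-s) * (1 - s * (t - 1)) \<le> y powr (-s) * t powr (-s)"
      by (intro mult_left_mono) auto
    also have "y powr (-s) * t powr (-s) = B n powr (-s)"
      using y B[of n] by (simp add: t_def powr_divide)
    finally have "y powr (-s) * (s * (1 - t)) \<le> B n powr (-s) - y powr (-s)"
      by (simp add: algebra_simps)
    moreover have "1 - t = a n / y"
      using y BSuc[of n] by (simp add: t_def y_def field_simps)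
    moreover have "y powr (-s) * (s * (a n / y)) = s * (a n / y powr b)"
      using y by (simp add: s_def powr_diff powr_minus field_simps)
    ultimately show ?thesis by (simp add: y_def)
  qed
  have "summable (\<lambda>n. s * (a n / B (Suc n) powr b))"
  proof (rule summableI_nonneg_bounded)
    fix n
    have "(\<Sum>k<n. s * (a k / B (Suc k) powr b)) \<le> (\<Sum>k<n. B k powr (-s) - B (Suc k) powr (-s))"
      by (intro sum_mono step)
    also have "\<dots> = B 0 powr (-s) - B n powr (-s)"
      by (rule sum_lessThan_telescope')
    also have "\<dots> \<le> 1" by (simp add: B_def)
    finally show "(\<Sum>k<n. s * (a k / B (Suc k) powr b)) \<le> 1" .
  qed (use s a in auto)
  then have "summable (\<lambda>n. a n / B (Suc n) powr b)"
    using s by (subst (asm) summable_cmult_iff) auto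
  then show ?thesis by (simp add: B_def lessThan_Suc_atMost)
qed

section \<open>Self-normalised bounds and strong laws for the noise\<close>

context white_noise
begin

text \<open>Dividing \<open>h n\<close> by \<open>B n\<close> makes the squares summable by
  Abel-Dini, whatever the growth of \<open>h\<close>, so the normalised transform converges; the
  Kronecker bound then multiplies \<open>B\<close> back.\<close>

lemma V_sum_bound:
  assumes h: "\<And>n. h n \<in> borel_measurable (F n)" and "0 < \<epsilon>"
  shows "AE \<omega> in M. \<exists>C. \<forall>n. \<bar>\<Sum>k\<le>n. h k \<omega> * V (Suc k) \<omega>\<bar> \<le> C + \<epsilon> * (\<Sum>k\<le>n. (h k \<omega>)\<^sup>2)"
proof -
  define B where "B n \<omega> = 1 + (\<Sum>k\<le>n. (h k \<omega>)\<^sup>2)" for n \<omega>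
  have B: "1 \<le> B n \<omega>" for n \<omega>
    unfolding B_def by (simp add: sum_nonneg)
  have mono: "mono (\<lambda>n. B n \<omega>)" for \<omega>
    unfolding B_def by (intro monoI add_left_mono sum_mono2) auto
  have meas: "(\<lambda>\<omega>. h n \<omega> / B n \<omega>) \<in> borel_measurable (F n)" for n
  proof -
    have [measurable]: "k \<le> n \<Longrightarrow> h k \<in> borel_measurable (F n)" for k
      using h by (rule measurable_F_mono)
    show ?thesis unfolding B_def by measurable
  qed
  have "AE \<omega> in M. summable (\<lambda>n. h n \<omega> / B n \<omega> * V (Suc n) \<omega>)"
  proof (rule V_transform_summable[OF meas], rule AE_I2)
    fix \<omega>
    have "(h n \<omega> / B n \<omega>)\<^sup>2 = (h n \<omega>)\<^sup>2 / B n \<omega> powr 2" for n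
      using B[of n \<omega>] by (simp add: power_divide powr_numeral)
    then show "summable (\<lambda>n. (h n \<omega> / B n \<omega>)\<^sup>2)"
      using summable_div_partial_sums_powr[of "\<lambda>n. (h n \<omega>)\<^sup>2" 2] by (simp add: B_def)
  qed
  then show ?thesis
  proof eventually_elim
    case (elim \<omega>)
    obtain C where C: "\<And>n. \<bar>\<Sum>k\<le>n. B k \<omega> * (h k \<omega> / B k \<omega> * V (Suc k) \<omega>)\<bar> \<le> C + \<epsilon> * B n \<omega>"
      using kronecker_bound[OF mono order_trans[OF zero_le_one B] elim \<open>0 < \<epsilon>\<close>] by blast
    have "B k \<omega> * (h k \<omega> / B k \<omega> * V (Suc k) \<omega>) = h k \<omega> * V (Suc k) \<omega>" for k
      using B[of k \<omega>] by simp
    then have "\<bar>\<Sum>k\<le>n. h k \<omega> * V (Suc k) \<omega>\<bar> \<le> (C + \<epsilon>) + \<epsilon> * (\<Sum>k\<le>n. (h k \<omega>)\<^sup>2)" for n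
      using C[of n] by (simp add: B_def algebra_simps)
    then show ?case by blast
  qed
qed

text \<open>Meant for the gains. Since 0 \<le> h \<le> 1, the power \<open>mexp\<close> of h is at
  most h, so the sum of h itself serves as normaliser. Centring contributes \<sigma>^2 to the
  factor, the Kronecker bound with \<epsilon> = 1 the summand 1.\<close>

lemma V2_sum_bound:
  assumes h: "\<And>n. h n \<in> borel_measurable (F n)" and h01: "AE \<omega> in M. \<forall>n. 0 \<le> h n \<omega> \<and> h n \<omega> \<le> 1"
  shows "AE \<omega> in M. \<exists>C. \<forall>n. (\<Sum>k\<le>n. h k \<omega> * (V (Suc k) \<omega>)\<^sup>2) \<le> C + (\<sigma>\<^sup>2 + 1) * (\<Sum>k\<le>n. h k \<omega>)"
proof -
  define B where "B n \<omega> = 1 + (\<Sum>k\<le>n. h k \<omega>)" for n \<omega>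
  have meas: "(\<lambda>\<omega>. h n \<omega> / B n \<omega>) \<in> borel_measurable (F n)" for n
  proof -
    have [measurable]: "k \<le> n \<Longrightarrow> h k \<in> borel_measurable (F n)" for k
      using h by (rule measurable_F_mono)
    show ?thesis unfolding B_def by measurable
  qed
  have B: "1 \<le> B n \<omega>" if "\<forall>n. 0 \<le> h n \<omega> \<and> h n \<omega> \<le> 1" for n \<omega>
    unfolding B_def using that by (simp add: sum_nonneg)
  have "AE \<omega> in M. summable (\<lambda>n. h n \<omega> / B n \<omega> * ((V (Suc n) \<omega>)\<^sup>2 - \<sigma>\<^sup>2))"
  proof (rule V2_transform_summable[OF meas])
    from h01 show "AE \<omega> in M. summable (\<lambda>n. \<bar>h n \<omega> / B n \<omega>\<bar> powr mexp)"
    proof eventually_elim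
      case (elim \<omega>)
      show ?case
      proof (rule summable_comparison_test)
        show "summable (\<lambda>n. h n \<omega> / B n \<omega> powr mexp)"
          unfolding B_def using elim mexp by (intro summable_div_partial_sums_powr) auto
        have "norm (\<bar>h n \<omega> / B n \<omega>\<bar> powr mexp) \<le> h n \<omega> / B n \<omega> powr mexp" for n
        proof -
          have "\<bar>h n \<omega> / B n \<omega>\<bar> powr mexp = h n \<omega> powr mexp / B n \<omega> powr mexp"
            using elim B[OF elim, of n] by (simp add: powr_divide)
          also have "\<dots> \<le> h n \<omega> powr 1 / B n \<omega> powr mexp"
            using elim mexp by (intro divide_right_mono powr_mono') auto
          finally show ?thesis using elim by simp
        qed
        then show "\<exists>N. \<forall>n\<ge>N. norm (\<bar>h n \<omega> / B n \<omega>\<bar> powr mexp) \<le> h n \<omega> / B n \<omega> powr mexp"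
          by blast
      qed
    qed
  qed
  with h01 show ?thesis
  proof eventually_elim
    case (elim \<omega>)
    note B' = B[OF elim(1)]
    have mono: "mono (\<lambda>n. B n \<omega>)"
      unfolding B_def using elim(1) by (intro monoI add_left_mono sum_mono2) auto
    obtain C where C: "\<And>n. \<bar>\<Sum>k\<le>n. B k \<omega> * (h k \<omega> / B k \<omega> * ((V (Suc k) \<omega>)\<^sup>2 - \<sigma>\<^sup>2))\<bar> \<le> C + 1 * B n \<omega>"
      using kronecker_bound[OF mono order_trans[OF zero_le_one B'] elim(2) zero_less_one] by blast
    have eq: "B k \<omega> * (h k \<omega> / B k \<omega> * ((V (Suc k) \<omega>)\<^sup>2 - \<sigma>\<^sup>2)) = h k \<omega> * (V (Suc k) \<omega>)\<^sup>2 - \<sigma>\<^sup>2 * h k \<omega>" for k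
      using B'[of k] by (simp add: algebra_simps)
    have "(\<Sum>k\<le>n. h k \<omega> * (V (Suc k) \<omega>)\<^sup>2) \<le> (C + 1) + (\<sigma>\<^sup>2 + 1) * (\<Sum>k\<le>n. h k \<omega>)" for n
      using C[of n] unfolding eq sum_subtractf sum_distrib_left[symmetric] by (simp add: B_def algebra_simps)
    then show ?case by blast
  qed
qed

lemma V2_mean: "AE \<omega> in M. (\<lambda>n. (\<Sum>k<n. (V (Suc k) \<omega>)\<^sup>2) / real n) \<longlonglongrightarrow> \<sigma>\<^sup>2"
proof -
  have "AE \<omega> in M. summable (\<lambda>n. 1 / real (Suc n) * ((V (Suc n) \<omega>)\<^sup>2 - \<sigma>\<^sup>2))"
  proof (rule V2_transform_summable)
    have "summable (\<lambda>n. real (Suc n) powr (- mexp))"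
      using mexp by (subst summable_Suc_iff) (simp add: summable_real_powr_iff)
    then show "AE \<omega> in M. summable (\<lambda>n. \<bar>1 / real (Suc n)\<bar> powr mexp)"
      by (simp add: powr_divide powr_minus field_simps)
  qed auto
  then show ?thesis
  proof eventually_elim
    case (elim \<omega>)
    have "(\<lambda>n. (\<Sum>k<n. (V (Suc k) \<omega>)\<^sup>2 - \<sigma>\<^sup>2) / real n + \<sigma>\<^sup>2) \<longlonglongrightarrow> 0 + \<sigma>\<^sup>2"
      using elim by (intro tendsto_add mean_tendsto_0_of_summable tendsto_const) simp
    moreover have "eventually (\<lambda>n. (\<Sum>k<n. (V (Suc k) \<omega>)\<^sup>2 - \<sigma>\<^sup>2) / real n + \<sigma>\<^sup>2
        = (\<Sum>k<n. (V (Suc k) \<omega>)\<^sup>2) / real n) sequentially"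
      using eventually_gt_at_top[of 0] by eventually_elim (simp add: sum_subtractf field_simps)
    ultimately show ?case by (simp add: tendsto_cong)
  qed
qed

text \<open>The midpoint of 1 / \<open>mexp\<close> and 1: large enough for n^(-\<open>vexp\<close>)
  to be an admissible weight for the centred squares, and below 1 so that a threshold exponent
  \<tau> fits above it.\<close>

definition vexp :: real where "vexp = (1 + 1 / mexp) / 2"

lemma vexp: "0 < vexp" "vexp < 1"
  using mexp by (auto simp: vexp_def add_pos_nonneg)

lemma V2_growth: "AE \<omega> in M. \<exists>C. \<forall>n. (V (Suc n) \<omega>)\<^sup>2 \<le> C * real (Suc n) powr vexp"
proof -
  have m: "1 < vexp * mexp" using mexp by (simp add: vexp_def field_simps)
  have "AE \<omega> in M. summable (\<lambda>n. 1 / real (Suc n) powr vexp * ((V (Suc n) \<omega>)\<^sup>2 - \<sigma>\<^sup>2))"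
  proof (rule V2_transform_summable)
    have "summable (\<lambda>n. real (Suc n) powr (- (vexp * mexp)))"
      using m by (subst summable_Suc_iff) (simp add: summable_real_powr_iff)
    then show "AE \<omega> in M. summable (\<lambda>n. \<bar>1 / real (Suc n) powr vexp\<bar> powr mexp)"
      by (simp add: powr_divide powr_minus powr_powr field_simps)
  qed auto
  then show ?thesis
  proof eventually_elim
    case (elim \<omega>)
    have "Bseq (\<lambda>n. 1 / real (Suc n) powr vexp * ((V (Suc n) \<omega>)\<^sup>2 - \<sigma>\<^sup>2))"
      using summable_LIMSEQ_zero[OF elim] by (intro convergent_imp_Bseq) (auto simp: convergent_def)
    then obtain K where K: "\<And>n. \<bar>1 / real (Suc n) powr vexp * ((V (Suc n) \<omega>)\<^sup>2 - \<sigma>\<^sup>2)\<bar> \<le> K"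
      by (auto simp: Bseq_def)
    have "(V (Suc n) \<omega>)\<^sup>2 \<le> (K + \<sigma>\<^sup>2) * real (Suc n) powr vexp" for n
    proof -
      have p: "1 \<le> real (Suc n) powr vexp" using vexp by (intro ge_one_powr_ge_zero) auto
      have "1 / real (Suc n) powr vexp * ((V (Suc n) \<omega>)\<^sup>2 - \<sigma>\<^sup>2) \<le> K" using K[of n] by linarith
      then have "(V (Suc n) \<omega>)\<^sup>2 - \<sigma>\<^sup>2 \<le> K * real (Suc n) powr vexp"
        using p by (simp add: field_simps)
      moreover have "\<sigma>\<^sup>2 * 1 \<le> \<sigma>\<^sup>2 * real (Suc n) powr vexp" by (intro mult_left_mono p) auto
      ultimately show ?thesis by (simp add: algebra_simps)
    qed
    then show ?case by blast
  qed
qed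

text \<open>The earlier factor is predictable for the later one, so the products form a transform of
  V. The weights V_k / k are square summable because the expectations of their squares are; only
  second moments enter.\<close>

lemma V_autocorrelation:
  assumes "1 \<le> i"
  shows "AE \<omega> in M. (\<lambda>n. (\<Sum>k<n. V (Suc k) \<omega> * V (Suc k + i) \<omega>) / real n) \<longlonglongrightarrow> 0"
proof -
  have "AE \<omega> in M. (\<Sum>n. ennreal ((1 / real (Suc n))\<^sup>2) * ennreal ((V (Suc n) \<omega>)\<^sup>2)) \<noteq> \<infinity>"
  proof (rule nn_integral_noteq_infinite)
    have "(\<integral>\<^sup>+\<omega>. (\<Sum>n. ennreal ((1 / real (Suc n))\<^sup>2) * ennreal ((V (Suc n) \<omega>)\<^sup>2)) \<partial>M)
        = (\<Sum>n. \<integral>\<^sup>+\<omega>. ennreal ((1 / real (Suc n))\<^sup>2) * ennreal ((V (Suc n) \<omega>)\<^sup>2) \<partial>M)"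
      by (rule nn_integral_suminf) measurable
    also have "\<dots> = (\<Sum>n. ennreal ((1 / real (Suc n))\<^sup>2) * ennreal (\<sigma>\<^sup>2))"
      by (subst nn_integral_V2) (auto simp: emeasure_space_1)
    also have "\<dots> = (\<Sum>n. ennreal ((1 / real (Suc n))\<^sup>2)) * ennreal (\<sigma>\<^sup>2)"
      by (rule ennreal_suminf_multc)
    also have "\<dots> < \<infinity>"
    proof -
      have "summable (\<lambda>n. (1 / real (Suc n))\<^sup>2)"
        using summable_ignore_initial_segment[OF inverse_power_summable[of 2, where 'a=real], of 1]
        by (simp add: inverse_eq_divide power_divide)
      then show ?thesis by (subst suminf_ennreal2) (auto simp: ennreal_mult_less_top)
    qed
    finally show "(\<integral>\<^sup>+\<omega>. (\<Sum>n. ennreal ((1 / real (Suc n))\<^sup>2) * ennreal ((V (Suc n) \<omega>)\<^sup>2)) \<partial>M) \<noteq> \<infinity>"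
      by simp
  qed measurable
  then have sq: "AE \<omega> in M. summable (\<lambda>n. (V (Suc n) \<omega> / real (Suc n))\<^sup>2)"
  proof eventually_elim
    case (elim \<omega>)
    then have "(\<Sum>n. ennreal ((V (Suc n) \<omega> / real (Suc n))\<^sup>2)) \<noteq> \<infinity>"
      by (simp add: ennreal_mult[symmetric] power_divide)
    then show ?case by (intro summable_suminf_not_top) auto
  qed
  \<comment> \<open>Indexed by the later noise variable: i \<ge> 1 makes V (Suc (n - i)) measurable
    for \<open>F n\<close>. The value 0 for n < i avoids truncated subtraction.\<close>
  define w where "w n \<omega> = (if i \<le> n then V (Suc (n - i)) \<omega> / real (Suc (n - i)) else 0)" for n \<omega>
  have w: "w n \<in> borel_measurable (F n)" for n
  proof (cases "i \<le> n")
    case True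
    have "V (Suc (n - i)) \<in> borel_measurable (F n)"
      by (rule measurable_F_mono[OF V_measurable]) (use True assms in auto)
    then show ?thesis using True by (simp add: w_def[abs_def])
  qed (simp add: w_def[abs_def])
  have "AE \<omega> in M. summable (\<lambda>n. w n \<omega> * V (Suc n) \<omega>)"
  proof (rule V_transform_summable[OF w])
    from sq show "AE \<omega> in M. summable (\<lambda>n. (w n \<omega>)\<^sup>2)"
    proof eventually_elim
      case (elim \<omega>)
      then have "summable (\<lambda>n. (w (n + i) \<omega>)\<^sup>2)" by (simp add: w_def)
      then show ?case by (subst (asm) summable_iff_shift)
    qed
  qed
  then show ?thesis
  proof eventually_elim
    case (elim \<omega>)
    have "summable (\<lambda>n. w (n + i) \<omega> * V (Suc (n + i)) \<omega>)"
      using elim by (subst summable_iff_shift)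
    then show ?case
      by (intro mean_tendsto_0_of_summable) (simp add: w_def)
  qed
qed

end

section \<open>Least squares: rank-one updates of the Gram matrix\<close>

lemma outer_product_vector_mult:
  fixes x y :: "real ^ 'n"
  shows "((columnvector x :: real ^ 1 ^ 'n) ** rowvector x) *v y = (x \<bullet> y) *\<^sub>R x"
  by (simp add: vec_eq_iff matrix_vector_mult_def matrix_matrix_mult_def columnvector_def
      rowvector_def inner_vec_def sum_distrib_left sum_distrib_right mult_ac)

lemma sum_matrix_vector_mult:
  fixes A :: "'b \<Rightarrow> real ^ 'n ^ 'n"
  shows "(\<Sum>k\<in>K. A k) *v v = (\<Sum>k\<in>K. A k *v v)"
  by (induction K rule: infinite_finite_induct) (auto simp: matrix_vector_mult_add_rdistrib)

lemma rank_one_vector_mult: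
  fixes u v x :: "real ^ 'n"
  shows "(\<chi> i j. (if i = j then 1 else 0) + u $ i * v $ j) *v x = x + (v \<bullet> x) *\<^sub>R u"
  unfolding vec_eq_iff
proof
  fix i
  have "((\<chi> i j. (if i = j then 1 else 0) + u $ i * v $ j) *v x) $ i
      = (\<Sum>j\<in>UNIV. (if i = j then x $ j else 0) + u $ i * (v $ j * x $ j))"
    unfolding matrix_vector_mult_def by (simp, intro sum.cong) (auto simp: algebra_simps)
  also have "\<dots> = x $ i + u $ i * (v \<bullet> x)"
    by (simp add: sum.distrib sum_distrib_left[symmetric] inner_vec_def)
  finally show "((\<chi> i j. (if i = j then 1 else 0) + u $ i * v $ j) *v x) $ i = (x + (v \<bullet> x) *\<^sub>R u) $ i"
    by simp
qed

text \<open>A rotation taking v to a multiple of a coordinate vector turns the matrix into the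
  identity with one column replaced; Cramer's lemma reads off the determinant.\<close>

lemma det_rank_one:
  fixes u v :: "real ^ 'm"
  shows "det ((\<chi> i j. (if i = j then 1 else 0) + u $ i * v $ j) :: real ^ 'm ^ 'm) = 1 + u \<bullet> v"
proof (cases "v = 0")
  case True
  have "(\<chi> i j. (if i = j then 1 else 0) + u $ i * v $ j) = (mat 1 :: real ^ 'm ^ 'm)"
    using True by (simp add: vec_eq_iff mat_def)
  then show ?thesis using True by simp
next
  case False
  define E where "E = ((\<chi> i j. (if i = j then 1 else 0) + u $ i * v $ j) :: real ^ 'm ^ 'm)"
  have E: "E *v x = x + (v \<bullet> x) *\<^sub>R u" for x
    by (simp add: E_def rank_one_vector_mult)
  \<comment> \<open>Any coordinate serves.\<close>
  define k where "k = (undefined :: 'm)"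
  obtain P where P: "orthogonal_matrix P" "P *v axis k 1 = (1 / norm v) *\<^sub>R v"
    using orthogonal_matrix_exists_basis[of "(1 / norm v) *\<^sub>R v" k] False by auto
  define Q where "Q = transpose P"
  have QP: "Q ** P = mat 1" "P ** Q = mat 1"
    using P(1) by (simp_all add: orthogonal_matrix_def Q_def)
  have PT: "Q *v (P *v x) = x" "P *v (Q *v x) = x" for x
    by (simp_all add: matrix_vector_mul_assoc QP)
  define w where "w = axis k 1 + norm v *\<^sub>R (Q *v u)"
  have vP: "v \<bullet> (P *v x) = norm v * x $ k" for x
  proof -
    have "v = norm v *\<^sub>R (P *v axis k 1)" using False P(2) by simp
    then have "v \<bullet> (P *v x) = norm v * ((P *v axis k 1) \<bullet> (P *v x))" by (metis inner_scaleR_left)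
    also have "(P *v axis k 1) \<bullet> (P *v x) = axis k 1 \<bullet> x"
      using dot_lmul_matrix[of "P *v axis k 1" P x] PT(1)[of "axis k 1"]
      by (simp add: Q_def transpose_matrix_vector)
    finally show ?thesis by (simp add: inner_axis')
  qed
  have "Q ** E ** P = (\<chi> i j. if j = k then (mat 1 *v w) $ i else mat 1 $ i $ j)"
    unfolding matrix_eq
  proof
    fix x
    have "(Q ** E ** P) *v x = x + (norm v * x $ k) *\<^sub>R (Q *v u)"
      by (simp add: matrix_vector_mul_assoc[symmetric] E vP matrix_vector_right_distrib
          matrix_vector_mult_scaleR PT)
    also have "\<dots> = (\<chi> i j. if j = k then (mat 1 *v w) $ i else mat 1 $ i $ j) *v x"
      unfolding vec_eq_iff
    proof
      fix i
      have "((\<chi> i j. if j = k then (mat 1 *v w) $ i else mat 1 $ i $ j) *v x) $ i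
          = (\<Sum>j\<in>UNIV. (if j = k then w $ i else if i = j then 1 else 0) * x $ j)"
        unfolding matrix_vector_mul_lid by (simp add: matrix_vector_mult_def mat_def cong: if_cong)
      also have "\<dots> = (\<Sum>j\<in>UNIV. (if i = j then x $ j else 0) + (if k = j then (norm v * (Q *v u) $ i) * x $ j else 0))"
        by (intro sum.cong) (auto simp: w_def axis_def algebra_simps)
      also have "\<dots> = x $ i + norm v * (Q *v u) $ i * x $ k"
        by (simp add: sum.distrib)
      finally show "(x + (norm v * x $ k) *\<^sub>R (Q *v u)) $ i
          = ((\<chi> i j. if j = k then (mat 1 *v w) $ i else mat 1 $ i $ j) *v x) $ i"
        by simp
    qed
    finally show "(Q ** E ** P) *v x = (\<chi> i j. if j = k then (mat 1 *v w) $ i else mat 1 $ i $ j) *v x" .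
  qed
  then have "det (Q ** E ** P) = w $ k"
    using cramer_lemma[of k "mat 1" w] by simp
  moreover have "det (Q ** E ** P) = det E"
  proof -
    have "det (Q ** E ** P) = det E * det (Q ** P)" by (simp add: det_mul)
    then show ?thesis by (simp add: QP)
  qed
  moreover have "w $ k = 1 + u \<bullet> v"
  proof -
    have "norm v * (Q *v u) $ k = v \<bullet> (P *v (Q *v u))" by (simp add: vP)
    then show ?thesis by (simp add: w_def PT inner_commute)
  qed
  ultimately show ?thesis by (simp add: E_def)
qed

section \<open>The Gram matrix, its inverse and the gain\<close>

lemma matrix_inv_inverse:
  fixes A :: "real ^ 'n ^ 'n"
  assumes "invertible A"
  shows "A ** matrix_inv A = mat 1" "matrix_inv A ** A = mat 1"
  using someI_ex[OF assms[unfolded invertible_def]] by (auto simp: matrix_inv_def)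

lemma gram_vector_mult:
  "gram \<Phi> n \<omega> *v v = v + (\<Sum>k\<le>n. (\<Phi> k \<omega> \<bullet> v) *\<^sub>R \<Phi> k \<omega>)"
  by (simp add: gram_def matrix_vector_mult_add_rdistrib sum_matrix_vector_mult
      outer_product_vector_mult)

lemma gram_Suc_vector_mult:
  "gram \<Phi> (Suc n) \<omega> *v v = gram \<Phi> n \<omega> *v v + (\<Phi> (Suc n) \<omega> \<bullet> v) *\<^sub>R \<Phi> (Suc n) \<omega>"
  by (simp add: gram_vector_mult)

lemma gram_inner: "u \<bullet> (gram \<Phi> n \<omega> *v v) = u \<bullet> v + (\<Sum>k\<le>n. (\<Phi> k \<omega> \<bullet> u) * (\<Phi> k \<omega> \<bullet> v))"
  by (simp add: gram_vector_mult inner_add_right inner_sum_right inner_commute mult.commute)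

lemma gram_sym: "u \<bullet> (gram \<Phi> n \<omega> *v v) = (gram \<Phi> n \<omega> *v u) \<bullet> v"
  by (subst (2) inner_commute) (simp add: gram_inner inner_commute mult.commute)

lemma gram_ge: "v \<bullet> v + (\<Phi> n \<omega> \<bullet> v)\<^sup>2 \<le> v \<bullet> (gram \<Phi> n \<omega> *v v)"
  unfolding gram_inner
  by (intro add_left_mono order_trans[OF _ member_le_sum[of n]]) (auto simp: power2_eq_square)

lemma gram_pos: "v \<bullet> v \<le> v \<bullet> (gram \<Phi> n \<omega> *v v)"
  using gram_ge[of v \<Phi> n \<omega>] by (smt (verit) zero_le_power2)

lemma invertible_gram: "invertible (gram \<Phi> n \<omega>)"
proof -
  have "v = 0" if "gram \<Phi> n \<omega> *v v = 0" for v
    using gram_pos[of v \<Phi> n \<omega>] that by (metis inner_eq_zero_iff inner_ge_zero inner_zero_right order_antisym)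
  then show ?thesis
    by (simp add: invertible_left_inverse matrix_left_invertible_ker)
qed

definition ginv :: "(nat \<Rightarrow> 'a \<Rightarrow> real ^ 'n) \<Rightarrow> nat \<Rightarrow> 'a \<Rightarrow> real ^ 'n ^ 'n::finite" where
  "ginv \<Phi> n \<omega> = matrix_inv (gram \<Phi> n \<omega>)"

lemma gram_ginv: "gram \<Phi> n \<omega> *v (ginv \<Phi> n \<omega> *v v) = v"
  unfolding ginv_def
  by (metis invertible_gram matrix_inv_inverse(1) matrix_vector_mul_assoc matrix_vector_mul_lid)

lemma ginv_gram: "ginv \<Phi> n \<omega> *v (gram \<Phi> n \<omega> *v v) = v"
  unfolding ginv_def
  by (metis invertible_gram matrix_inv_inverse(2) matrix_vector_mul_assoc matrix_vector_mul_lid)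

lemma ginv_eqI: "gram \<Phi> n \<omega> *v u = v \<Longrightarrow> ginv \<Phi> n \<omega> *v v = u"
  using ginv_gram by metis

lemma ginv_sym: "u \<bullet> (ginv \<Phi> n \<omega> *v v) = (ginv \<Phi> n \<omega> *v u) \<bullet> v"
  by (metis gram_ginv gram_sym)

lemma ginv_nonneg: "0 \<le> u \<bullet> (ginv \<Phi> n \<omega> *v u)"
  using order_trans[OF inner_ge_zero gram_pos, of "ginv \<Phi> n \<omega> *v u" \<Phi> n \<omega>]
  by (simp add: gram_ginv inner_commute)

definition gain :: "(nat \<Rightarrow> 'a \<Rightarrow> real ^ 'n::finite) \<Rightarrow> nat \<Rightarrow> 'a \<Rightarrow> real" where
  "gain \<Phi> n \<omega> = \<Phi> n \<omega> \<bullet> (ginv \<Phi> n \<omega> *v \<Phi> n \<omega>)"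

text \<open>The matrix S_n already contains \<Phi>_n. Testing it on z = S_n^(-1) \<Phi>_n gives
  |z|^2 + f^2 \<le> f, so f \<le> 1, and f = 1 would force z = 0.\<close>

lemma gain_bounds: "0 \<le> gain \<Phi> n \<omega>" "gain \<Phi> n \<omega> < 1"
proof -
  show nonneg: "0 \<le> gain \<Phi> n \<omega>" by (simp add: gain_def ginv_nonneg)
  define z where "z = ginv \<Phi> n \<omega> *v \<Phi> n \<omega>"
  have f: "gain \<Phi> n \<omega> = \<Phi> n \<omega> \<bullet> z" by (simp add: gain_def z_def)
  have "z \<bullet> z + (\<Phi> n \<omega> \<bullet> z)\<^sup>2 \<le> \<Phi> n \<omega> \<bullet> z"
    using gram_ge[of z \<Phi> n \<omega>] by (simp add: z_def gram_ginv inner_commute)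
  then have *: "z \<bullet> z + (gain \<Phi> n \<omega>)\<^sup>2 \<le> gain \<Phi> n \<omega>" by (simp add: f)
  have "gain \<Phi> n \<omega> \<noteq> 1"
  proof
    assume "gain \<Phi> n \<omega> = 1"
    with * have "z = 0" by (metis add_le_same_cancel2 inner_gt_zero_iff linorder_not_less power_one)
    with f \<open>gain \<Phi> n \<omega> = 1\<close> show False by simp
  qed
  moreover have "gain \<Phi> n \<omega> \<le> 1"
  proof (rule ccontr)
    assume "\<not> ?thesis"
    then have "gain \<Phi> n \<omega> * 1 < gain \<Phi> n \<omega> * gain \<Phi> n \<omega>" by (intro mult_strict_left_mono) auto
    with * inner_ge_zero[of z] show False unfolding power2_eq_square by linarith
  qed
  ultimately show "gain \<Phi> n \<omega> < 1" by simp
qed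

text \<open>Sherman--Morrison, with $y = S_n^{-1} \Phi_{n+1}$ and $g = \Phi_{n+1} \cdot y$.\<close>

context
  fixes \<Phi> :: "nat \<Rightarrow> 'a \<Rightarrow> real ^ 'n::finite" and \<omega> :: 'a and n :: nat
    and y :: "real ^ 'n" and g :: real
  defines "y \<equiv> ginv \<Phi> n \<omega> *v \<Phi> (Suc n) \<omega>" and "g \<equiv> \<Phi> (Suc n) \<omega> \<bullet> y"
begin

lemma rank_one_gain_nonneg: "0 \<le> g"
  unfolding g_def y_def by (rule ginv_nonneg)

lemma ginv_Suc: "ginv \<Phi> (Suc n) \<omega> *v v = ginv \<Phi> n \<omega> *v v - ((y \<bullet> v) / (1 + g)) *\<^sub>R y"
proof (rule ginv_eqI)
  have y: "gram \<Phi> n \<omega> *v y = \<Phi> (Suc n) \<omega>" by (simp add: y_def gram_ginv)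
  have yv: "\<Phi> (Suc n) \<omega> \<bullet> (ginv \<Phi> n \<omega> *v v) = y \<bullet> v" by (simp add: y_def ginv_sym)
  show "gram \<Phi> (Suc n) \<omega> *v (ginv \<Phi> n \<omega> *v v - ((y \<bullet> v) / (1 + g)) *\<^sub>R y) = v"
    using rank_one_gain_nonneg
    by (simp add: gram_Suc_vector_mult matrix_vector_mult_diff_distrib matrix_vector_mult_scaleR
        gram_ginv y yv inner_diff_right g_def[symmetric] algebra_simps add_divide_distrib[symmetric]
        flip: scaleR_add_left) (simp add: field_simps)
qed

lemma ginv_Suc_regressor: "ginv \<Phi> (Suc n) \<omega> *v \<Phi> (Suc n) \<omega> = (1 / (1 + g)) *\<^sub>R y"
proof -
  have "ginv \<Phi> (Suc n) \<omega> *v \<Phi> (Suc n) \<omega> = (1 - g / (1 + g)) *\<^sub>R y"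
    by (simp add: ginv_Suc y_def[symmetric] g_def inner_commute scaleR_diff_left)
  then show ?thesis using rank_one_gain_nonneg by (simp add: field_simps)
qed

lemma gain_Suc: "gain \<Phi> (Suc n) \<omega> = g / (1 + g)"
  by (simp add: gain_def ginv_Suc_regressor g_def)

lemma trace_ginv_diff:
  "(\<Sum>i\<in>Basis. i \<bullet> (ginv \<Phi> n \<omega> *v i)) - (\<Sum>i\<in>Basis. i \<bullet> (ginv \<Phi> (Suc n) \<omega> *v i)) = (y \<bullet> y) / (1 + g)"
proof -
  have "(\<Sum>i\<in>Basis. i \<bullet> (ginv \<Phi> n \<omega> *v i)) - (\<Sum>i\<in>Basis. i \<bullet> (ginv \<Phi> (Suc n) \<omega> *v i))
      = (\<Sum>i\<in>Basis. (y \<bullet> i) * (y \<bullet> i)) / (1 + g)"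
    by (simp add: ginv_Suc inner_diff_right sum_subtractf sum_divide_distrib inner_commute)
  also have "(\<Sum>i\<in>Basis. (y \<bullet> i) * (y \<bullet> i)) = y \<bullet> y"
    by (rule euclidean_inner[symmetric])
  finally show ?thesis .
qed

text \<open>An upper bound for 1 / (1 - f) = 1 + g. By Cauchy-Schwarz g^2 \<le> |y|^2 |\<Phi>|^2,
  and |y|^2 / (1 + g) is exactly the drop of the trace of the inverse. These drops are summable,
  which is what makes the bound useful for large regressors.\<close>

lemma one_le_gain_mult:
  "1 \<le> (1 - gain \<Phi> (Suc n) \<omega>) * (2 + ((\<Sum>i\<in>Basis. i \<bullet> (ginv \<Phi> n \<omega> *v i))
      - (\<Sum>i\<in>Basis. i \<bullet> (ginv \<Phi> (Suc n) \<omega> *v i))) * (norm (\<Phi> (Suc n) \<omega>))\<^sup>2)"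
proof -
  have "g\<^sup>2 \<le> (\<Phi> (Suc n) \<omega> \<bullet> \<Phi> (Suc n) \<omega>) * (y \<bullet> y)"
    unfolding g_def by (rule Cauchy_Schwarz_ineq)
  then have "(1 + g) * (1 + g) \<le> 2 * (1 + g) + (y \<bullet> y) * (norm (\<Phi> (Suc n) \<omega>))\<^sup>2"
    unfolding power2_norm_eq_inner by (simp add: power2_eq_square algebra_simps)
  then have "1 + g \<le> 2 + (y \<bullet> y) / (1 + g) * (norm (\<Phi> (Suc n) \<omega>))\<^sup>2"
    using rank_one_gain_nonneg by (simp add: field_simps)
  then have "1 / (1 + g) * (1 + g) \<le> 1 / (1 + g) * (2 + (y \<bullet> y) / (1 + g) * (norm (\<Phi> (Suc n) \<omega>))\<^sup>2)"
    using rank_one_gain_nonneg by (intro mult_left_mono) auto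
  moreover have "1 - gain \<Phi> (Suc n) \<omega> = 1 / (1 + g)"
    using rank_one_gain_nonneg by (simp add: gain_Suc field_simps)
  ultimately show ?thesis
    using rank_one_gain_nonneg unfolding trace_ginv_diff by simp
qed

lemma det_gram_Suc: "det (gram \<Phi> (Suc n) \<omega>) = det (gram \<Phi> n \<omega>) * (1 + g)"
proof -
  let ?E = "(\<chi> i j. (if i = j then 1 else 0) + y $ i * \<Phi> (Suc n) \<omega> $ j) :: real ^ 'n ^ 'n"
  have E: "?E *v x = x + (\<Phi> (Suc n) \<omega> \<bullet> x) *\<^sub>R y" for x
    by (rule rank_one_vector_mult)
  have "gram \<Phi> (Suc n) \<omega> = gram \<Phi> n \<omega> ** ?E"
    unfolding matrix_eq
    by (simp add: matrix_vector_mul_assoc[symmetric] E gram_Suc_vector_mult matrix_vector_right_distrib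
        matrix_vector_mult_scaleR) (simp add: y_def gram_ginv)
  then show ?thesis by (simp add: det_mul det_rank_one g_def inner_commute)
qed

lemma gain_Suc_le_ln: "gain \<Phi> (Suc n) \<omega> \<le> ln (1 + g)"
proof -
  have "ln (1 / (1 + g)) \<le> 1 / (1 + g) - 1"
    using rank_one_gain_nonneg by (intro ln_le_minus_one) auto
  then show ?thesis using rank_one_gain_nonneg by (simp add: gain_Suc ln_div field_simps)
qed

end

lemma det_gram_0: "det (gram \<Phi> 0 \<omega>) = 1 + \<Phi> 0 \<omega> \<bullet> \<Phi> 0 \<omega>"
proof -
  have "gram \<Phi> 0 \<omega> = (\<chi> i j. (if i = j then 1 else 0) + \<Phi> 0 \<omega> $ i * \<Phi> 0 \<omega> $ j)"
    by (simp add: gram_def vec_eq_iff mat_def matrix_matrix_mult_def columnvector_def rowvector_def)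
  then show ?thesis by (simp add: det_rank_one)
qed

lemma det_gram_ge_1: "1 \<le> det (gram \<Phi> n \<omega>)"
proof (induction n)
  case (Suc n)
  have "1 * 1 \<le> det (gram \<Phi> n \<omega>) * (1 + \<Phi> (Suc n) \<omega> \<bullet> (ginv \<Phi> n \<omega> *v \<Phi> (Suc n) \<omega>))"
    using Suc rank_one_gain_nonneg[of \<Phi> n \<omega>] by (intro mult_mono) auto
  then show ?case by (simp add: det_gram_Suc)
qed (simp add: det_gram_0)

lemma sum_gain_le_ln_det: "(\<Sum>k\<le>n. gain \<Phi> k \<omega>) \<le> 1 + ln (det (gram \<Phi> n \<omega>))"
proof (induction n)
  case 0
  show ?case using gain_bounds(2)[of \<Phi> 0 \<omega>] ln_ge_zero[OF det_gram_ge_1[of \<Phi> 0 \<omega>]] by simp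
next
  case (Suc n)
  have "0 < det (gram \<Phi> n \<omega>)" using det_gram_ge_1[of \<Phi> n \<omega>] by simp
  then show ?case
    using Suc gain_Suc_le_ln[of \<Phi> n \<omega>] rank_one_gain_nonneg[of \<Phi> n \<omega>]
    by (simp add: det_gram_Suc ln_mult)
qed

section \<open>Sums of gains and the Lyapunov function\<close>

definition sqsum :: "(nat \<Rightarrow> 'a \<Rightarrow> 'b::real_normed_vector) \<Rightarrow> nat \<Rightarrow> 'a \<Rightarrow> real" where
  "sqsum \<Phi> n \<omega> = 1 + (\<Sum>k\<le>n. (norm (\<Phi> k \<omega>))\<^sup>2)"

lemma sqsum_ge_1: "1 \<le> sqsum \<Phi> n \<omega>"
  by (simp add: sqsum_def sum_nonneg)

text \<open>Leibniz expansion with every entry bounded by the total energy: crude, but only the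
  logarithm is used.\<close>

lemma det_gram_le:
  fixes \<Phi> :: "nat \<Rightarrow> 'a \<Rightarrow> real ^ 'n::finite"
  shows "det (gram \<Phi> n \<omega>) \<le> fact CARD('n) * sqsum \<Phi> n \<omega> ^ CARD('n)"
proof -
  have entry: "\<bar>gram \<Phi> n \<omega> $ i $ j\<bar> \<le> sqsum \<Phi> n \<omega>" for i j
  proof -
    have "gram \<Phi> n \<omega> $ i $ j = axis i 1 \<bullet> (gram \<Phi> n \<omega> *v axis j 1)"
      by (simp add: matrix_vector_mult_basis inner_axis' column_def)
    also have "\<dots> = axis i 1 \<bullet> axis j (1::real) + (\<Sum>k\<le>n. \<Phi> k \<omega> $ i * \<Phi> k \<omega> $ j)"
      by (simp add: gram_inner inner_axis)
    also have "\<bar>\<dots>\<bar> \<le> 1 + (\<Sum>k\<le>n. (norm (\<Phi> k \<omega>))\<^sup>2)"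
    proof (intro order_trans[OF abs_triangle_ineq] add_mono order_trans[OF sum_abs] sum_mono)
      show "\<bar>axis i 1 \<bullet> axis j (1::real)\<bar> \<le> 1"
        by (simp add: inner_axis_axis)
      show "\<bar>\<Phi> k \<omega> $ i * \<Phi> k \<omega> $ j\<bar> \<le> (norm (\<Phi> k \<omega>))\<^sup>2" for k
        unfolding abs_mult power2_eq_square by (intro mult_mono component_le_norm_cart) auto
    qed
    finally show ?thesis by (simp add: sqsum_def)
  qed
  have "det (gram \<Phi> n \<omega>) \<le> (\<Sum>p\<in>{p. p permutes (UNIV :: 'n set)}. sqsum \<Phi> n \<omega> ^ CARD('n))"
    unfolding det_def
  proof (rule sum_mono)
    fix p assume "p \<in> {p. p permutes (UNIV :: 'n set)}"
    have "of_int (sign p) * (\<Prod>i\<in>UNIV. gram \<Phi> n \<omega> $ i $ p i) \<le> \<bar>of_int (sign p) * (\<Prod>i\<in>UNIV. gram \<Phi> n \<omega> $ i $ p i)\<bar>"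
      by (rule abs_ge_self)
    also have "\<dots> = (\<Prod>i\<in>UNIV. \<bar>gram \<Phi> n \<omega> $ i $ p i\<bar>)"
      by (simp add: abs_mult abs_prod sign_def)
    also have "\<dots> \<le> (\<Prod>i\<in>(UNIV :: 'n set). sqsum \<Phi> n \<omega>)"
      by (intro prod_mono) (use entry in auto)
    finally show "of_int (sign p) * (\<Prod>i\<in>UNIV. gram \<Phi> n \<omega> $ i $ p i) \<le> sqsum \<Phi> n \<omega> ^ CARD('n)"
      by simp
  qed
  also have "\<dots> = fact CARD('n) * sqsum \<Phi> n \<omega> ^ CARD('n)"
    using card_permutations[of "UNIV :: 'n set"] by simp
  finally show ?thesis .
qed

lemma sum_gain_le:
  fixes \<Phi> :: "nat \<Rightarrow> 'a \<Rightarrow> real ^ 'n::finite"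
  shows "(\<Sum>k\<le>n. gain \<Phi> k \<omega>) \<le> 1 + ln (fact CARD('n)) + real CARD('n) * ln (sqsum \<Phi> n \<omega>)"
proof -
  have s: "0 < sqsum \<Phi> n \<omega>" using sqsum_ge_1[of \<Phi> n \<omega>] by simp
  have "ln (det (gram \<Phi> n \<omega>)) \<le> ln (fact CARD('n) * sqsum \<Phi> n \<omega> ^ CARD('n))"
    using det_gram_ge_1[of \<Phi> n \<omega>] det_gram_le[of \<Phi> n \<omega>] by (intro ln_mono) auto
  also have "\<dots> = ln (fact CARD('n)) + real CARD('n) * ln (sqsum \<Phi> n \<omega>)"
    using s by (simp add: ln_mult ln_realpow)
  finally show ?thesis using sum_gain_le_ln_det[of \<Phi> \<omega> n] by linarith
qed

text \<open>The vectors \<open>d\<close> and \<open>d'\<close> are the errors before and after the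
  update with \<Phi>_(n+1). The Gram matrix sends the update direction to \<Phi>_(n+1), so every
  mixed term reduces to \<pi> or to the gain.\<close>

lemma lyapunov_step:
  fixes \<Phi> :: "nat \<Rightarrow> 'a \<Rightarrow> real ^ 'n::finite" and d d' :: "real ^ 'n"
  assumes d': "d' = d + (v + \<pi>) *\<^sub>R (ginv \<Phi> (Suc n) \<omega> *v \<Phi> (Suc n) \<omega>)"
    and \<pi>: "\<pi> = - (\<Phi> (Suc n) \<omega> \<bullet> d)"
  shows "d' \<bullet> (gram \<Phi> (Suc n) \<omega> *v d') = d \<bullet> (gram \<Phi> n \<omega> *v d) - (1 - gain \<Phi> (Suc n) \<omega>) * \<pi>\<^sup>2
    - 2 * ((1 - gain \<Phi> (Suc n) \<omega>) * \<pi> * v) + gain \<Phi> (Suc n) \<omega> * v\<^sup>2"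
proof -
  define z where "z = ginv \<Phi> (Suc n) \<omega> *v \<Phi> (Suc n) \<omega>"
  define S where "S = gram \<Phi> (Suc n) \<omega>"
  have Sz: "S *v z = \<Phi> (Suc n) \<omega>" by (simp add: S_def z_def gram_ginv)
  have f: "z \<bullet> \<Phi> (Suc n) \<omega> = gain \<Phi> (Suc n) \<omega>" by (simp add: gain_def z_def inner_commute)
  have dS: "d \<bullet> (S *v d) = d \<bullet> (gram \<Phi> n \<omega> *v d) + \<pi>\<^sup>2"
    by (simp add: S_def gram_inner \<pi> power2_eq_square)
  have zS: "z \<bullet> (S *v d) = - \<pi>" 
    using gram_sym[of z \<Phi> "Suc n" \<omega> d] Sz by (simp add: S_def \<pi>)
  have dP: "d \<bullet> \<Phi> (Suc n) \<omega> = - \<pi>" by (simp add: \<pi> inner_commute)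
  have "d' \<bullet> (S *v d') = d \<bullet> (S *v d) + (v + \<pi>) * (d \<bullet> (S *v z)) + (v + \<pi>) * (z \<bullet> (S *v d))
      + (v + \<pi>)\<^sup>2 * (z \<bullet> (S *v z))"
    by (simp add: d' z_def[symmetric] matrix_vector_right_distrib matrix_vector_mult_scaleR
        inner_add_left inner_add_right algebra_simps power2_eq_square)
  also have "\<dots> = d \<bullet> (gram \<Phi> n \<omega> *v d) + \<pi>\<^sup>2 - 2 * ((v + \<pi>) * \<pi>) + (v + \<pi>)\<^sup>2 * gain \<Phi> (Suc n) \<omega>"
    by (simp add: Sz f dS zS dP)
  finally show ?thesis by (simp add: S_def algebra_simps power2_eq_square)
qed

text \<open>Summing the Lyapunov steps leaves two noise sums. The cross sum enters with factor 2, so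
  by \<open>h1\<close> it costs half of the weighted prediction errors, which is absorbed on the
  left; by \<open>h2\<close> the quadratic sum costs a multiple of the sum of the gains.\<close>

lemma least_squares_error_bound:
  fixes \<Phi> :: "nat \<Rightarrow> 'a \<Rightarrow> real ^ 'n::finite" and d :: "nat \<Rightarrow> real ^ 'n" and v \<pi> :: "nat \<Rightarrow> real"
  assumes d: "\<And>n. d (Suc (Suc n)) = d (Suc n) + (v (Suc n) + \<pi> (Suc n)) *\<^sub>R (ginv \<Phi> (Suc n) \<omega> *v \<Phi> (Suc n) \<omega>)"
    and \<pi>: "\<And>n. \<pi> n = - (\<Phi> n \<omega> \<bullet> d n)"
    and h1: "\<And>n. \<bar>\<Sum>k\<le>n. (1 - gain \<Phi> k \<omega>) * \<pi> k * v k\<bar> \<le> C1 + 1/4 * (\<Sum>k\<le>n. ((1 - gain \<Phi> k \<omega>) * \<pi> k)\<^sup>2)"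
    and h2: "\<And>n. (\<Sum>k\<le>n. gain \<Phi> k \<omega> * (v k)\<^sup>2) \<le> C2 + c * (\<Sum>k\<le>n. gain \<Phi> k \<omega>)" and "0 \<le> c"
  obtains C where "0 \<le> C"
    "\<And>n. d (Suc n) \<bullet> (gram \<Phi> n \<omega> *v d (Suc n)) \<le> C * (1 + ln (sqsum \<Phi> n \<omega>))"
    "\<And>n. (\<Sum>k\<le>n. (1 - gain \<Phi> k \<omega>) * (\<pi> k)\<^sup>2) \<le> C * (1 + ln (sqsum \<Phi> n \<omega>))"
proof -
  define W where "W n = d (Suc n) \<bullet> (gram \<Phi> n \<omega> *v d (Suc n))" for n
  define \<alpha> where "\<alpha> k = (1 - gain \<Phi> k \<omega>) * (\<pi> k)\<^sup>2" for k
  \<comment> \<open>The error recursion is available from index 1 on, so everything at index 0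
    becomes a constant.\<close>
  define C0 where "C0 = W 0 + \<alpha> 0 + 2 * ((1 - gain \<Phi> 0 \<omega>) * \<pi> 0 * v 0) - gain \<Phi> 0 \<omega> * (v 0)\<^sup>2"
  have \<alpha>: "0 \<le> \<alpha> k" for k
    unfolding \<alpha>_def using gain_bounds[of \<Phi> k \<omega>] by simp
  have W: "0 \<le> W n" for n
    unfolding W_def by (rule order_trans[OF inner_ge_zero gram_pos])
  have eq: "W n + (\<Sum>k\<le>n. \<alpha> k) = C0 - 2 * (\<Sum>k\<le>n. (1 - gain \<Phi> k \<omega>) * \<pi> k * v k)
      + (\<Sum>k\<le>n. gain \<Phi> k \<omega> * (v k)\<^sup>2)" for n
  proof (induction n)
    case (Suc n)
    show ?case
      using Suc lyapunov_step[OF d \<pi>, of n] by (simp add: W_def \<alpha>_def algebra_simps)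
  qed (simp add: C0_def)
  have sq: "(\<Sum>k\<le>n. ((1 - gain \<Phi> k \<omega>) * \<pi> k)\<^sup>2) \<le> (\<Sum>k\<le>n. \<alpha> k)" for n
  proof (rule sum_mono)
    fix k
    have "(1 - gain \<Phi> k \<omega>)\<^sup>2 \<le> 1 - gain \<Phi> k \<omega>"
      using gain_bounds[of \<Phi> k \<omega>] by (simp add: power2_eq_square mult_left_le)
    then show "((1 - gain \<Phi> k \<omega>) * \<pi> k)\<^sup>2 \<le> \<alpha> k"
      unfolding \<alpha>_def power_mult_distrib by (rule mult_right_mono) simp
  qed
  define D where "D = \<bar>C0\<bar> + 2 * \<bar>C1\<bar> + \<bar>C2\<bar> + c * (1 + ln (fact CARD('n))) + c * real CARD('n)"
  have lf: "0 \<le> ln (fact CARD('n) :: real)" by (simp add: fact_ge_1)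
  have main: "W n + 1/2 * (\<Sum>k\<le>n. \<alpha> k) \<le> D * (1 + ln (sqsum \<Phi> n \<omega>))" for n
  proof -
    define L where "L = ln (sqsum \<Phi> n \<omega>)"
    have L: "0 \<le> L" using sqsum_ge_1[of \<Phi> n \<omega>] by (simp add: L_def)
    have "W n + 1/2 * (\<Sum>k\<le>n. \<alpha> k) \<le> C0 + 2 * C1 + C2 + c * (\<Sum>k\<le>n. gain \<Phi> k \<omega>)"
      using eq[of n] h1[of n] h2[of n] sq[of n] by linarith
    also have "\<dots> \<le> C0 + 2 * C1 + C2 + c * (1 + ln (fact CARD('n)) + real CARD('n) * L)"
      using sum_gain_le[of \<Phi> \<omega> n] \<open>0 \<le> c\<close> by (intro add_left_mono mult_left_mono) (auto simp: L_def)
    also have "\<dots> = (C0 + 2 * C1 + C2 + c * (1 + ln (fact CARD('n)))) * 1 + (c * real CARD('n)) * L"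
      by (simp add: algebra_simps)
    also have "\<dots> \<le> D * 1 + D * L"
    proof (intro add_mono mult_right_mono)
      have "0 \<le> c * (1 + ln (fact CARD('n)))" "0 \<le> c * real CARD('n)"
        using \<open>0 \<le> c\<close> lf by (intro mult_nonneg_nonneg; simp)+
      then show "C0 + 2 * C1 + C2 + c * (1 + ln (fact CARD('n))) \<le> D" "c * real CARD('n) \<le> D"
        unfolding D_def by linarith+
    qed (use L in auto)
    finally show ?thesis by (simp add: L_def algebra_simps)
  qed
  have "0 \<le> D" using \<open>0 \<le> c\<close> lf by (simp add: D_def)
  show thesis
  proof (rule that[of "2 * D"])
    fix n
    have L: "0 \<le> D * (1 + ln (sqsum \<Phi> n \<omega>))"
      using \<open>0 \<le> D\<close> sqsum_ge_1[of \<Phi> n \<omega>] by simp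
    show "d (Suc n) \<bullet> (gram \<Phi> n \<omega> *v d (Suc n)) \<le> 2 * D * (1 + ln (sqsum \<Phi> n \<omega>))"
      using main[of n] L sum_nonneg[of "{..n}" \<alpha>] \<alpha> by (simp add: W_def)
    show "(\<Sum>k\<le>n. (1 - gain \<Phi> k \<omega>) * (\<pi> k)\<^sup>2) \<le> 2 * D * (1 + ln (sqsum \<Phi> n \<omega>))"
      using main[of n] W[of n] by (simp add: \<alpha>_def)
  qed (use \<open>0 \<le> D\<close> in simp)
qed

section \<open>Perturbed linear recursions and persistence of excitation\<close>

text \<open>Unrolling gives H_n \<le> exp (P_n) (H_0 + \<Sum> \<xi>_k). The exponential costs
  s^(1/4), and ln s inside the sum of \<xi> another s^(1/4); hence s is at most a constant times n^2
  s^(1/2), which can be solved for s.\<close>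

lemma perturbed_recursion_ln_growth:
  fixes H \<alpha> d \<xi> s :: "nat \<Rightarrow> real"
  assumes rec: "\<And>k. H (Suc k) \<le> (\<mu> + c * (\<alpha> k * d k)) * H k + \<xi> k"
    and nonneg: "\<And>k. 0 \<le> H k" "\<And>k. 0 \<le> \<alpha> k" "\<And>k. 0 \<le> d k" "\<And>k. 0 \<le> \<xi> k"
    and "\<mu> \<le> 1" "0 \<le> c" "1 \<le> K"
    and sum_\<alpha>: "\<And>n. (\<Sum>k\<le>n. \<alpha> k) \<le> K * (1 + ln (s n))"
    and d: "d \<longlonglongrightarrow> 0"
    and sum_\<xi>: "\<And>n. (\<Sum>k\<le>n. \<xi> k) \<le> K * (1 + real n + ln (s n))"
    and s: "\<And>n. 1 \<le> s n" "mono s" "\<And>n. s n \<le> K * (1 + (\<Sum>k\<le>n. H k))"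
  shows "\<exists>C\<ge>0. \<forall>n. ln (s n) \<le> C * (1 + ln (1 + real n))"
proof -
  define P where "P n = c * (\<Sum>k<n. \<alpha> k * d k)" for n
  have H_le: "H n \<le> exp (P n) * (H 0 + (\<Sum>k<n. \<xi> k))" for n
  proof (induction n)
    case (Suc n)
    have "H (Suc n) \<le> (1 + c * (\<alpha> n * d n)) * H n + \<xi> n"
      using rec[of n] mult_right_mono[OF \<open>\<mu> \<le> 1\<close> nonneg(1)[of n]] by (simp add: algebra_simps)
    also have "\<dots> \<le> exp (c * (\<alpha> n * d n)) * H n + \<xi> n"
      by (intro add_right_mono mult_right_mono nonneg exp_ge_add_one_self)
    also have "\<dots> \<le> exp (c * (\<alpha> n * d n)) * (exp (P n) * (H 0 + (\<Sum>k<n. \<xi> k))) + exp (P (Suc n)) * \<xi> n"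
    proof -
      have "0 \<le> P (Suc n)" unfolding P_def using nonneg \<open>0 \<le> c\<close> by (intro mult_nonneg_nonneg sum_nonneg) auto
      then have "1 * \<xi> n \<le> exp (P (Suc n)) * \<xi> n"
        using nonneg by (intro mult_right_mono) auto
      moreover have "exp (c * (\<alpha> n * d n)) * H n \<le> exp (c * (\<alpha> n * d n)) * (exp (P n) * (H 0 + (\<Sum>k<n. \<xi> k)))"
        by (intro mult_left_mono Suc) auto
      ultimately show ?thesis by linarith
    qed
    also have "\<dots> = exp (P (Suc n)) * (H 0 + (\<Sum>k<Suc n. \<xi> k))"
      by (simp add: P_def algebra_simps exp_add)
    finally show ?case .
  qed (simp add: P_def)
  \<comment> \<open>From \<open>j0\<close> on, c \<alpha>_k d_k \<le> \<alpha>_k / (4 K), so the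
    bound on the sum of \<alpha> contributes a quarter of ln s only.\<close>
  obtain j0 where j0: "\<And>k. k \<ge> j0 \<Longrightarrow> c * K * d k \<le> 1/4"
  proof -
    have "(\<lambda>k. c * K * d k) \<longlonglongrightarrow> c * K * 0" by (intro tendsto_intros d)
    then have "eventually (\<lambda>k. c * K * d k < 1/4) sequentially" by (rule order_tendstoD) simp
    then show ?thesis using that by (auto simp: eventually_sequentially intro: less_imp_le)
  qed
  define C0 where "C0 = c * (\<Sum>k<j0. \<alpha> k * d k)"
  have P_le: "P n \<le> C0 + 1/4 * (1 + ln (s n))" for n
  proof -
    have "P n \<le> (\<Sum>k<n. (if k < j0 then c * (\<alpha> k * d k) else 0) + \<alpha> k / (4 * K))"
      unfolding P_def sum_distrib_left
    proof (rule sum_mono)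
      fix k
      have "c * (\<alpha> k * d k) \<le> \<alpha> k / (4 * K)" if "k \<ge> j0"
        using mult_right_mono[OF j0[OF that] nonneg(2)[of k]] \<open>1 \<le> K\<close> by (simp add: field_simps)
      then show "c * (\<alpha> k * d k) \<le> (if k < j0 then c * (\<alpha> k * d k) else 0) + \<alpha> k / (4 * K)"
        using nonneg(2)[of k] \<open>1 \<le> K\<close> by auto
    qed
    also have "\<dots> = (\<Sum>k<n. if k \<in> {..<j0} then c * (\<alpha> k * d k) else 0) + (\<Sum>k<n. \<alpha> k) / (4 * K)"
      by (simp add: sum.distrib sum_divide_distrib)
    also have "\<dots> \<le> C0 + (K * (1 + ln (s n))) / (4 * K)"
    proof (intro add_mono divide_right_mono)
      have "(\<Sum>k<n. if k \<in> {..<j0} then c * (\<alpha> k * d k) else 0) = (\<Sum>k\<in>{..<n} \<inter> {..<j0}. c * (\<alpha> k * d k))"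
        by (rule sum.inter_restrict[symmetric]) simp
      also have "\<dots> \<le> (\<Sum>k<j0. c * (\<alpha> k * d k))"
        using nonneg \<open>0 \<le> c\<close> by (intro sum_mono2) auto
      finally show "(\<Sum>k<n. if k \<in> {..<j0} then c * (\<alpha> k * d k) else 0) \<le> C0"
        by (simp add: C0_def sum_distrib_left)
      have "(\<Sum>k<n. \<alpha> k) \<le> (\<Sum>k\<le>n. \<alpha> k)" using nonneg by (intro sum_mono2) auto
      then show "(\<Sum>k<n. \<alpha> k) \<le> K * (1 + ln (s n))" using sum_\<alpha>[of n] by linarith
    qed (use \<open>1 \<le> K\<close> in auto)
    finally show ?thesis using \<open>1 \<le> K\<close> by simp
  qed
  define C1 where "C1 = exp (C0 + 1/4) * (H 0 + 5 * K)"
  define C2 where "C2 = K * (1 + C1)"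
  have C1: "0 \<le> C1" unfolding C1_def using nonneg(1)[of 0] \<open>1 \<le> K\<close> by simp
  have C2: "1 \<le> C2" unfolding C2_def using C1 \<open>1 \<le> K\<close> mult_mono[of 1 K 1 "1 + C1"] by simp
  have main: "ln (s n) \<le> 2 * ln C2 + 4 * ln (1 + real n)" for n
  proof -
    define t where "t = s n powr (1/4)"
    have t: "1 \<le> t" unfolding t_def using s(1)[of n] by (intro ge_one_powr_ge_zero) auto
    have t4: "s n = t ^ 4"
      using s(1)[of n] t by (simp add: t_def powr_powr flip: powr_realpow)
    have ln_s: "ln (s n) = 4 * ln t" using t by (simp add: t4 ln_realpow)
    have H_n: "H k \<le> C1 * (1 + real n) * t\<^sup>2" if "k \<le> n" for k
    proof -
      have sk: "ln (s k) \<le> ln (s n)"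
        using s(1)[of k] monoD[OF s(2) that] by (intro ln_mono) auto
      have "H k \<le> exp (P k) * (H 0 + (\<Sum>j<k. \<xi> j))" by (rule H_le)
      also have "\<dots> \<le> exp (C0 + 1/4 + ln t) * (H 0 + K * (1 + real n + ln (s n)))"
      proof (intro mult_mono)
        show "exp (P k) \<le> exp (C0 + 1/4 + ln t)" unfolding exp_le_cancel_iff
          using P_le[of k] sk ln_s by argo
        have "(\<Sum>j<k. \<xi> j) \<le> (\<Sum>j\<le>k. \<xi> j)" using nonneg by (intro sum_mono2) auto
        also have "\<dots> \<le> K * (1 + real k + ln (s k))" by (rule sum_\<xi>)
        also have "\<dots> \<le> K * (1 + real n + ln (s n))"
          using sk that \<open>1 \<le> K\<close> by (intro mult_left_mono) auto
        finally show "H 0 + (\<Sum>j<k. \<xi> j) \<le> H 0 + K * (1 + real n + ln (s n))" by simp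
      qed (use nonneg in \<open>auto intro!: add_nonneg_nonneg sum_nonneg\<close>)
      also have "\<dots> = exp (C0 + 1/4) * t * (H 0 + K * (1 + real n + 4 * ln t))"
        using t by (simp add: exp_add ln_s)
      also have "\<dots> \<le> exp (C0 + 1/4) * t * ((H 0 + 5 * K) * (1 + real n) * t)"
      proof (intro mult_left_mono)
        have "ln t \<le> t" using ln_le_minus_one[of t] t by simp
        have nt: "1 + real n \<le> (1 + real n) * t" "t \<le> (1 + real n) * t" "1 \<le> (1 + real n) * t"
          using t mult_left_mono[of 1 t "1 + real n"] mult_right_mono[of 1 "1 + real n" t] order_trans[of 1 t "(1 + real n) * t"]
          by (auto simp: mult_right_mono)
        have "1 + real n + 4 * ln t \<le> 5 * ((1 + real n) * t)" using nt \<open>ln t \<le> t\<close> by linarith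
        then have "K * (1 + real n + 4 * ln t) \<le> K * (5 * ((1 + real n) * t))"
          using \<open>1 \<le> K\<close> by (intro mult_left_mono) auto
        moreover have "H 0 * 1 \<le> H 0 * ((1 + real n) * t)" by (intro mult_left_mono nt nonneg)
        ultimately show "H 0 + K * (1 + real n + 4 * ln t) \<le> (H 0 + 5 * K) * (1 + real n) * t"
          by (simp add: algebra_simps)
      qed (use t in auto)
      also have "\<dots> = C1 * (1 + real n) * t\<^sup>2" by (simp add: C1_def power2_eq_square)
      finally show ?thesis .
    qed
    have "t ^ 4 \<le> K * (1 + (\<Sum>k\<le>n. H k))" using s(3)[of n] t4 by simp
    also have "\<dots> \<le> K * (1 + (\<Sum>k\<le>n. C1 * (1 + real n) * t\<^sup>2))"
      using \<open>1 \<le> K\<close> H_n by (intro mult_left_mono add_left_mono sum_mono) auto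
    also have "\<dots> = K * (1 + C1 * ((1 + real n)\<^sup>2 * t\<^sup>2))"
      by (simp add: power2_eq_square)
    also have "\<dots> \<le> K * ((1 + C1) * ((1 + real n)\<^sup>2 * t\<^sup>2))"
    proof (intro mult_left_mono)
      have "1 \<le> (1 + real n)\<^sup>2 * t\<^sup>2"
        using mult_mono[of 1 "(1 + real n)\<^sup>2" 1 "t\<^sup>2"] t by (simp add: one_le_power)
      then show "1 + C1 * ((1 + real n)\<^sup>2 * t\<^sup>2) \<le> (1 + C1) * ((1 + real n)\<^sup>2 * t\<^sup>2)"
        by (simp add: algebra_simps)
    qed (use \<open>1 \<le> K\<close> in auto)
    also have "\<dots> = (C2 * (1 + real n)\<^sup>2) * t\<^sup>2" by (simp add: C2_def mult_ac)
    finally have "t\<^sup>2 * t\<^sup>2 \<le> (C2 * (1 + real n)\<^sup>2) * t\<^sup>2"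
      by (simp add: power2_eq_square power4_eq_xxxx mult_ac)
    then have "t\<^sup>2 \<le> C2 * (1 + real n)\<^sup>2"
      using t by (intro mult_right_le_imp_le[of "t\<^sup>2" "t\<^sup>2"]) auto
    then have "ln (t\<^sup>2) \<le> ln (C2 * (1 + real n)\<^sup>2)" using t by (intro ln_mono) auto
    then show ?thesis using t C2 by (simp add: ln_s ln_realpow ln_mult)
  qed
  show ?thesis
  proof (intro exI[of _ "2 * ln C2 + 4"] conjI allI)
    show "0 \<le> 2 * ln C2 + 4" using C2 by simp
    fix n
    have "2 * ln C2 * (1 + 0) \<le> 2 * ln C2 * (1 + ln (1 + real n))"
      using C2 by (intro mult_left_mono) auto
    then show "ln (s n) \<le> (2 * ln C2 + 4) * (1 + ln (1 + real n))"
      using main[of n] by (simp add: algebra_simps)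
  qed
qed

text \<open>$\ln (1 + H_k / \kappa)$ drops by at least $\ln (2 / (1 + \mu))$ whenever $H_k \geq \kappa$,
  up to the contribution of the perturbation and of the input.\<close>

lemma perturbed_recursion_count:
  fixes H p \<xi> :: "nat \<Rightarrow> real"
  assumes rec: "\<And>k. H (Suc k) \<le> (\<mu> + p k) * H k + \<xi> k"
    and nonneg: "\<And>k. 0 \<le> H k" "\<And>k. 0 \<le> p k" "\<And>k. 0 \<le> \<xi> k"
    and \<mu>: "0 < \<mu>" "\<mu> < 1" and \<kappa>: "0 < \<kappa>"
  shows "real (card {k. k < n \<and> \<kappa> \<le> H k}) * ln (2 / (1 + \<mu>))
    \<le> ln (1 + H 0 / \<kappa>) + (\<Sum>k<n. p k) / \<mu> + (\<Sum>k<n. \<xi> k) / \<kappa>"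
proof -
  define D where "D = ln (2 / (1 + \<mu>))"
  have step: "ln (1 + H (Suc k) / \<kappa>) + (if \<kappa> \<le> H k then D else 0)
      \<le> ln (1 + H k / \<kappa>) + p k / \<mu> + \<xi> k / \<kappa>" for k
  proof -
    define y where "y = H k / \<kappa>"
    have y: "0 \<le> y" using nonneg \<kappa> by (simp add: y_def)
    have "1 + H (Suc k) / \<kappa> \<le> 1 + ((\<mu> + p k) * H k + \<xi> k) / \<kappa>"
      using rec[of k] \<kappa> by (intro add_left_mono divide_right_mono) auto
    also have "\<dots> = 1 + (\<mu> + p k) * y + \<xi> k / \<kappa>"
      by (simp add: y_def add_divide_distrib)
    \<comment> \<open>Factorised so that the logarithm separates the contraction, the perturbation
      and the input.\<close>
    also have "\<dots> \<le> (1 + \<mu> * y) * (1 + p k / \<mu>) * (1 + \<xi> k / \<kappa>)"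
    proof -
      have 1: "1 + (\<mu> + p k) * y \<le> (1 + \<mu> * y) * (1 + p k / \<mu>)"
        using \<mu> nonneg(2)[of k] by (simp add: field_simps)
      have "1 \<le> 1 + (\<mu> + p k) * y" using \<mu> y nonneg(2)[of k] by simp
      then have "1 * (\<xi> k / \<kappa>) \<le> (1 + \<mu> * y) * (1 + p k / \<mu>) * (\<xi> k / \<kappa>)"
        using 1 nonneg(3)[of k] \<kappa> by (intro mult_right_mono) auto
      then show ?thesis using 1 by (simp add: algebra_simps)
    qed
    finally have le: "1 + H (Suc k) / \<kappa> \<le> (1 + \<mu> * y) * (1 + p k / \<mu>) * (1 + \<xi> k / \<kappa>)" .
    have pos: "0 < 1 + \<mu> * y" "0 < 1 + p k / \<mu>" "0 < 1 + \<xi> k / \<kappa>" "0 < 1 + H (Suc k) / \<kappa>"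
      using \<mu> y nonneg \<kappa> by (auto intro!: add_pos_nonneg)
    have "ln (1 + H (Suc k) / \<kappa>) \<le> ln ((1 + \<mu> * y) * (1 + p k / \<mu>) * (1 + \<xi> k / \<kappa>))"
      using le pos by (intro ln_mono) auto
    also have "\<dots> = ln (1 + \<mu> * y) + ln (1 + p k / \<mu>) + ln (1 + \<xi> k / \<kappa>)"
      using pos by (subst ln_mult_pos, simp, simp)+ simp
    also have "\<dots> \<le> ln (1 + \<mu> * y) + p k / \<mu> + \<xi> k / \<kappa>"
      using \<mu> \<kappa> nonneg by (intro add_mono ln_add_one_self_le_self) auto
    finally have "ln (1 + H (Suc k) / \<kappa>) \<le> ln (1 + \<mu> * y) + p k / \<mu> + \<xi> k / \<kappa>" .
    moreover have "ln (1 + \<mu> * y) + (if \<kappa> \<le> H k then D else 0) \<le> ln (1 + y)"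
    proof (cases "\<kappa> \<le> H k")
      case True
      then have "1 \<le> y" using \<kappa> by (simp add: y_def)
      \<comment> \<open>For \<mu> < 1 the inequality (1 + \<mu> y) 2 / (1 + \<mu>) \<le> 1 + y is
        equivalent to y \<ge> 1: this is where the drop comes from.\<close>
      then have "0 \<le> (1 - \<mu>) * (y - 1)" using \<mu> by (intro mult_nonneg_nonneg) auto
      then have "(1 + \<mu> * y) * (2 / (1 + \<mu>)) \<le> 1 + y"
        using \<mu> by (simp add: field_simps)
      then have "ln ((1 + \<mu> * y) * (2 / (1 + \<mu>))) \<le> ln (1 + y)"
        using \<mu> pos by (intro ln_mono) auto
      moreover have "ln ((1 + \<mu> * y) * (2 / (1 + \<mu>))) = ln (1 + \<mu> * y) + D"
        unfolding D_def using \<mu> pos by (intro ln_mult_pos) auto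
      ultimately show ?thesis using True by (simp only: if_True)
    next
      case False
      have "\<mu> * y \<le> 1 * y" using \<mu> y by (intro mult_right_mono) auto
      then show ?thesis using False pos by (auto intro!: ln_mono)
    qed
    ultimately show ?thesis by (simp add: y_def)
  qed
  have "ln (1 + H n / \<kappa>) + real (card {k. k < n \<and> \<kappa> \<le> H k}) * D
      \<le> ln (1 + H 0 / \<kappa>) + (\<Sum>k<n. p k) / \<mu> + (\<Sum>k<n. \<xi> k) / \<kappa>"
  proof (induction n)
    case (Suc n)
    have "{k. k < Suc n \<and> \<kappa> \<le> H k} = (if \<kappa> \<le> H n then insert n {k. k < n \<and> \<kappa> \<le> H k} else {k. k < n \<and> \<kappa> \<le> H k})"
      by (auto simp: less_Suc_eq)
    then have "real (card {k. k < Suc n \<and> \<kappa> \<le> H k}) * D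
        = real (card {k. k < n \<and> \<kappa> \<le> H k}) * D + (if \<kappa> \<le> H n then D else 0)"
      by (simp add: algebra_simps)
    then show ?case using Suc step[of n] by (simp add: add_divide_distrib)
  qed simp
  moreover have "0 \<le> ln (1 + H n / \<kappa>)" using nonneg \<kappa> by simp
  ultimately show ?thesis by (simp add: D_def)
qed

section \<open>Empirical correlations and persistence of excitation\<close>

lemma tendsto_shifted_mean:
  fixes A :: "nat \<Rightarrow> real"
  assumes "(\<lambda>n. A n / real n) \<longlonglongrightarrow> a"
  shows "(\<lambda>n. A (n - j) / real n) \<longlonglongrightarrow> a"
proof (rule LIMSEQ_offset[of _ j])
  have "(\<lambda>n. A n / real n * (real n / real (n + j))) \<longlonglongrightarrow> a * 1"
  proof (intro tendsto_mult assms)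
    have "(\<lambda>n. 1 - real j / real (n + j)) \<longlonglongrightarrow> 1 - 0"
      by (intro tendsto_intros LIMSEQ_ignore_initial_segment[OF lim_const_over_n])
    moreover have "eventually (\<lambda>n. 1 - real j / real (n + j) = real n / real (n + j)) sequentially"
      using eventually_gt_at_top[of 0] by eventually_elim (simp add: field_simps)
    ultimately show "(\<lambda>n. real n / real (n + j)) \<longlonglongrightarrow> 1"
      by (simp add: tendsto_cong)
  qed
  moreover have "eventually (\<lambda>n. A n / real n * (real n / real (n + j)) = A (n + j - j) / real (n + j)) sequentially"
    using eventually_gt_at_top[of 0] by eventually_elim simp
  ultimately show "(\<lambda>n. A (n + j - j) / real (n + j)) \<longlonglongrightarrow> a"
    by (simp only: mult_1_right) (rule Lim_transform_eventually)
qed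

lemma lagged_correlation:
  fixes v :: "nat \<Rightarrow> real"
  assumes mean: "(\<lambda>n. (\<Sum>k<n. (v k)\<^sup>2) / real n) \<longlonglongrightarrow> s"
    and corr: "\<And>i. 1 \<le> i \<Longrightarrow> (\<lambda>n. (\<Sum>k<n. v k * v (k + i)) / real n) \<longlonglongrightarrow> 0"
    and "i < J" "j < J"
  shows "(\<lambda>n. (\<Sum>k=J..<n. v (k - i) * v (k - j)) / real n) \<longlonglongrightarrow> (if i = j then s else 0)"
proof -
  have *: "(\<lambda>n. (\<Sum>k=J..<n. v (k - i) * v (k - j)) / real n) \<longlonglongrightarrow> (if i = j then s else 0)"
    if "i \<le> j" "j < J" for i j
  proof -
    define A where "A n = (\<Sum>k<n. v k * v (k + (j - i)))" for n
    have A: "(\<lambda>n. A n / real n) \<longlonglongrightarrow> (if i = j then s else 0)"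
      using mean corr[of "j - i"] that by (auto simp: A_def[abs_def] power2_eq_square)
    have eq: "(\<Sum>k=J..<n. v (k - i) * v (k - j)) = A (n - j) - A (J - j)" if n: "n \<ge> J" for n
    proof -
      have "(\<Sum>k=J..<n. v (k - i) * v (k - j)) = (\<Sum>k=J - j..<n - j. v k * v (k + (j - i)))"
        by (rule sum.reindex_bij_witness[of _ "\<lambda>k. k + j" "\<lambda>k. k - j"])
          (use \<open>i \<le> j\<close> \<open>j < J\<close> in \<open>auto simp: mult.commute\<close>)
      also have "\<dots> = A (n - j) - A (J - j)"
        unfolding A_def using sum_diff_nat_ivl[of 0 "J - j" "n - j" "\<lambda>k. v k * v (k + (j - i))"] n
        by (simp add: atLeast0LessThan)
      finally show ?thesis .
    qed
    have "(\<lambda>n. A (n - j) / real n - A (J - j) / real n) \<longlonglongrightarrow> (if i = j then s else 0) - 0"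
      by (rule tendsto_diff[OF tendsto_shifted_mean[OF A] lim_const_over_n])
    moreover have "eventually (\<lambda>n. A (n - j) / real n - A (J - j) / real n
        = (\<Sum>k=J..<n. v (k - i) * v (k - j)) / real n) sequentially"
      using eventually_ge_at_top[of J] by eventually_elim (simp add: eq diff_divide_distrib)
    ultimately show ?thesis by (simp add: tendsto_cong)
  qed
  show ?thesis
  proof (cases "i \<le> j")
    case True
    then show ?thesis using *[of i j] assms by simp
  next
    case False
    then show ?thesis using *[of j i] assms by (simp add: mult.commute eq_commute[of i j])
  qed
qed

text \<open>Uniform in \<beta> and \<gamma>, as it will be applied to coefficients varying with n.
  The empirical covariances of \<open>v\<close> approach s times the identity, so the moving average
  has energy about s n |\<beta>|^2. Leaving out the times outside \<open>G n\<close> removes o(n)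
  |\<beta>|^2, and (m + r)^2 \<ge> m^2 / 2 - r^2 separates off the \<open>g\<close> part, whose
  coefficients are bounded by those of \<open>v\<close>. The set \<open>G n\<close> depends on n
  because its threshold will.\<close>

lemma excitation:
  fixes v g :: "nat \<Rightarrow> real" and G :: "nat \<Rightarrow> nat set"
  assumes mean: "(\<lambda>n. (\<Sum>k<n. (v k)\<^sup>2) / real n) \<longlonglongrightarrow> s" and "0 < s"
    and corr: "\<And>i. 1 \<le> i \<Longrightarrow> (\<lambda>n. (\<Sum>k<n. v k * v (k + i)) / real n) \<longlonglongrightarrow> 0"
    and G: "\<And>n. G n \<subseteq> {J..<n}"
    and bad: "\<And>j. j < J \<Longrightarrow> (\<lambda>n. (\<Sum>k\<in>{J..<n} - G n. (v (k - j))\<^sup>2) / real n) \<longlonglongrightarrow> 0"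
    and small: "\<And>j. j < J \<Longrightarrow> (\<lambda>n. (\<Sum>k\<in>G n. (g (k - j))\<^sup>2) / real n) \<longlonglongrightarrow> 0"
    and L: "0 \<le> L"
  shows "\<exists>\<kappa>>0. eventually (\<lambda>n. \<forall>\<beta> \<gamma>. (\<Sum>j<J. (\<gamma> j)\<^sup>2) \<le> L * (\<Sum>j<J. (\<beta> j)\<^sup>2) \<longrightarrow>
     \<kappa> * real n * (\<Sum>j<J. (\<beta> j)\<^sup>2) \<le> (\<Sum>k\<in>G n. ((\<Sum>j<J. \<beta> j * v (k - j)) + (\<Sum>j<J. \<gamma> j * g (k - j)))\<^sup>2)) sequentially"
proof -
  define c where "c n i j = (\<Sum>k=J..<n. v (k - i) * v (k - j))" for n i j
  define z where "z n i j = \<bar>c n i j / real n - (if i = j then s else 0)\<bar>" for n i j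
  \<comment> \<open>In turn: deviation of the covariances from s times the identity, energy of
    \<open>v\<close> at omitted times, energy of \<open>g\<close> at kept times. None of them
    involves the coefficients, which gives uniformity.\<close>
  define e1 where "e1 n = (\<Sum>i<J. \<Sum>j<J. z n i j)" for n
  define e2 where "e2 n = (\<Sum>j<J. (\<Sum>k\<in>{J..<n} - G n. (v (k - j))\<^sup>2) / real n)" for n
  define e3 where "e3 n = (\<Sum>j<J. (\<Sum>k\<in>G n. (g (k - j))\<^sup>2) / real n)" for n
  have "e1 \<longlonglongrightarrow> (\<Sum>i<J. \<Sum>j<J. 0)"
    unfolding e1_def
  proof (intro tendsto_sum)
    fix i j assume "i \<in> {..<J}" "j \<in> {..<J}"
    then have "(\<lambda>n. z n i j) \<longlonglongrightarrow> \<bar>(if i = j then s else 0) - (if i = j then s else 0)\<bar>"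
      unfolding z_def c_def by (intro tendsto_rabs tendsto_diff tendsto_const lagged_correlation[OF mean corr]) auto
    then show "(\<lambda>n. z n i j) \<longlonglongrightarrow> 0" by simp
  qed
  then have e1: "e1 \<longlonglongrightarrow> 0" by simp
  have "e2 \<longlonglongrightarrow> (\<Sum>j<J. 0)" unfolding e2_def by (intro tendsto_sum bad) simp
  then have e2: "e2 \<longlonglongrightarrow> 0" by simp
  have "e3 \<longlonglongrightarrow> (\<Sum>j<J. 0)" unfolding e3_def by (intro tendsto_sum small) simp
  then have e3: "e3 \<longlonglongrightarrow> 0" by simp
  have lower: "real n * (1/2 * (s - e1 n - e2 n) - L * e3 n) * (\<Sum>j<J. (\<beta> j)\<^sup>2)
      \<le> (\<Sum>k\<in>G n. ((\<Sum>j<J. \<beta> j * v (k - j)) + (\<Sum>j<J. \<gamma> j * g (k - j)))\<^sup>2)"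
    if n: "0 < n" and \<gamma>: "(\<Sum>j<J. (\<gamma> j)\<^sup>2) \<le> L * (\<Sum>j<J. (\<beta> j)\<^sup>2)" for n and \<beta> \<gamma> :: "nat \<Rightarrow> real"
  proof -
    define b where "b = (\<Sum>j<J. (\<beta> j)\<^sup>2)"
    define m where "m k = (\<Sum>j<J. \<beta> j * v (k - j))" for k
    define r where "r k = (\<Sum>j<J. \<gamma> j * g (k - j))" for k
    have b: "0 \<le> b" by (simp add: b_def sum_nonneg)
    have finG: "finite (G n)" using G finite_subset by blast
    have \<beta>b: "(\<beta> i)\<^sup>2 \<le> b" if "i < J" for i
      unfolding b_def using that by (intro member_le_sum) auto
    have full: "real n * (s - e1 n) * b \<le> (\<Sum>k=J..<n. (m k)\<^sup>2)"
    proof -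
      have "(\<Sum>k=J..<n. (m k)\<^sup>2) = (\<Sum>k=J..<n. \<Sum>i<J. \<Sum>j<J. \<beta> i * \<beta> j * (v (k - i) * v (k - j)))"
        by (simp add: m_def power2_eq_square sum_product mult_ac)
      also have "\<dots> = (\<Sum>i<J. \<Sum>j<J. \<Sum>k=J..<n. \<beta> i * \<beta> j * (v (k - i) * v (k - j)))"
        by (subst sum.swap, subst (2) sum.swap) simp
      also have "\<dots> = (\<Sum>i<J. \<Sum>j<J. \<beta> i * \<beta> j * c n i j)"
        by (simp add: c_def sum_distrib_left)
      also have "\<dots> \<ge> (\<Sum>i<J. \<Sum>j<J. \<beta> i * \<beta> j * (if i = j then real n * s else 0)
          - b * (real n * z n i j))"
      proof (intro sum_mono)
        fix i j assume ij: "i \<in> {..<J}" "j \<in> {..<J}"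
        have "\<bar>\<beta> i * \<beta> j\<bar> \<le> b"
        proof -
          have "2 * \<bar>\<beta> i * \<beta> j\<bar> \<le> (\<beta> i)\<^sup>2 + (\<beta> j)\<^sup>2"
            using sum_squares_bound[of "\<bar>\<beta> i\<bar>" "\<bar>\<beta> j\<bar>"] by (simp add: abs_mult)
          then show ?thesis using \<beta>b[of i] \<beta>b[of j] ij by auto
        qed
        then have "\<bar>\<beta> i * \<beta> j\<bar> * (real n * z n i j)
            \<le> b * (real n * z n i j)"
          by (intro mult_right_mono) (auto simp: z_def)
        moreover have "\<bar>\<beta> i * \<beta> j\<bar> * (real n * z n i j)
            = \<bar>\<beta> i * \<beta> j * c n i j - \<beta> i * \<beta> j * (if i = j then real n * s else 0)\<bar>"
        proof -
          have "real n * (c n i j / real n - (if i = j then s else 0)) = c n i j - (if i = j then real n * s else 0)"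
            using n by (simp add: algebra_simps)
          moreover have "real n * z n i j
              = \<bar>real n * (c n i j / real n - (if i = j then s else 0))\<bar>"
            by (simp add: abs_mult z_def)
          ultimately have "\<bar>\<beta> i * \<beta> j\<bar> * (real n * z n i j)
              = \<bar>\<beta> i * \<beta> j * (c n i j - (if i = j then real n * s else 0))\<bar>"
            by (simp only: abs_mult)
          then show ?thesis by (simp add: algebra_simps)
        qed
        ultimately have le: "\<bar>\<beta> i * \<beta> j * c n i j - \<beta> i * \<beta> j * (if i = j then real n * s else 0)\<bar>
            \<le> b * (real n * z n i j)"
          by (simp only:)
        have gen: "\<bar>x - y\<bar> \<le> z \<Longrightarrow> y - z \<le> x" for x y z :: real by linarith
        show "\<beta> i * \<beta> j * (if i = j then real n * s else 0)
            - b * (real n * z n i j) \<le> \<beta> i * \<beta> j * c n i j"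
          by (rule gen[OF le])
      qed
      also have "(\<Sum>i<J. \<Sum>j<J. \<beta> i * \<beta> j * (if i = j then real n * s else 0)
          - b * (real n * z n i j))
          = b * (real n * s) - b * (real n * e1 n)"
        by (simp add: sum_subtractf e1_def sum_distrib_left b_def sum_distrib_right power2_eq_square
            if_distrib[of "\<lambda>z. _ * z"] cong: if_cong)
      finally show ?thesis by (simp add: algebra_simps)
    qed
    have badm: "(\<Sum>k\<in>{J..<n} - G n. (m k)\<^sup>2) \<le> real n * e2 n * b"
    proof -
      have "(\<Sum>k\<in>{J..<n} - G n. (m k)\<^sup>2) \<le> (\<Sum>k\<in>{J..<n} - G n. b * (\<Sum>j<J. (v (k - j))\<^sup>2))"
        unfolding m_def b_def by (intro sum_mono Cauchy_Schwarz_ineq_sum)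
      also have "\<dots> = b * (\<Sum>j<J. \<Sum>k\<in>{J..<n} - G n. (v (k - j))\<^sup>2)"
        by (simp add: sum_distrib_left[symmetric] sum.swap[of _ "{..<J}"])
      also have "\<dots> = real n * e2 n * b"
        using n by (simp add: e2_def sum_divide_distrib[symmetric])
      finally show ?thesis .
    qed
    have goodr: "(\<Sum>k\<in>G n. (r k)\<^sup>2) \<le> L * b * (real n * e3 n)"
    proof -
      have "(\<Sum>k\<in>G n. (r k)\<^sup>2) \<le> (\<Sum>k\<in>G n. (\<Sum>j<J. (\<gamma> j)\<^sup>2) * (\<Sum>j<J. (g (k - j))\<^sup>2))"
        unfolding r_def by (intro sum_mono Cauchy_Schwarz_ineq_sum)
      also have "\<dots> = (\<Sum>j<J. (\<gamma> j)\<^sup>2) * (\<Sum>j<J. \<Sum>k\<in>G n. (g (k - j))\<^sup>2)"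
        by (simp add: sum_distrib_left[symmetric] sum.swap[of _ "{..<J}"])
      also have "\<dots> \<le> (L * b) * (\<Sum>j<J. \<Sum>k\<in>G n. (g (k - j))\<^sup>2)"
        using \<gamma> by (intro mult_right_mono sum_nonneg) (auto simp: b_def)
      also have "\<dots> = L * b * (real n * e3 n)"
        using n by (simp add: e3_def sum_divide_distrib[symmetric])
      finally show ?thesis .
    qed
    have split: "(\<Sum>k=J..<n. (m k)\<^sup>2) = (\<Sum>k\<in>G n. (m k)\<^sup>2) + (\<Sum>k\<in>{J..<n} - G n. (m k)\<^sup>2)"
      using G[of n] by (subst sum.subset_diff[of "G n"]) auto
    have "1/2 * (\<Sum>k\<in>G n. (m k)\<^sup>2) - (\<Sum>k\<in>G n. (r k)\<^sup>2) \<le> (\<Sum>k\<in>G n. (m k + r k)\<^sup>2)"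
      unfolding sum_distrib_left sum_subtractf[symmetric]
    proof (rule sum_mono)
      fix k
      have "0 \<le> (m k + 2 * r k)\<^sup>2" by simp
      then show "1/2 * (m k)\<^sup>2 - (r k)\<^sup>2 \<le> (m k + r k)\<^sup>2"
        by (simp add: power2_eq_square algebra_simps)
    qed
    moreover have "1/2 * (real n * (s - e1 n) * b - real n * e2 n * b) - L * b * (real n * e3 n)
        \<le> (\<Sum>k\<in>G n. (m k + r k)\<^sup>2)" if "1/2 * (\<Sum>k\<in>G n. (m k)\<^sup>2) - (\<Sum>k\<in>G n. (r k)\<^sup>2) \<le> (\<Sum>k\<in>G n. (m k + r k)\<^sup>2)"
    proof -
      have gen: "1/2 * (a1 - a2) - a3 \<le> q" if "1/2 * g - r' \<le> q" "a1 \<le> f" "h \<le> a2" "r' \<le> a3" "f = g + h"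
        for a1 a2 a3 q g r' f h :: real
        using that by (simp add: field_simps)
      show ?thesis by (rule gen[OF _ full badm goodr split]) (rule that)
    qed
    moreover have "real n * (1/2 * (s - e1 n - e2 n) - L * e3 n) * b
        = 1/2 * (real n * (s - e1 n) * b - real n * e2 n * b) - L * b * (real n * e3 n)"
      by (simp add: field_simps)
    ultimately show ?thesis by (simp add: m_def r_def b_def)
  qed
  \<comment> \<open>The limit is s / 2; the constant s / 4 leaves room for the errors.\<close>
  have "(\<lambda>n. 1/2 * (s - e1 n - e2 n) - L * e3 n) \<longlonglongrightarrow> 1/2 * (s - 0 - 0) - L * 0"
    by (intro tendsto_intros e1 e2 e3)
  then have "eventually (\<lambda>n. s / 4 < 1/2 * (s - e1 n - e2 n) - L * e3 n) sequentially"
    by (rule order_tendstoD) (use \<open>0 < s\<close> in simp)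
  then have ev: "eventually (\<lambda>n. \<forall>\<beta> \<gamma>. (\<Sum>j<J. (\<gamma> j)\<^sup>2) \<le> L * (\<Sum>j<J. (\<beta> j)\<^sup>2) \<longrightarrow>
     s / 4 * real n * (\<Sum>j<J. (\<beta> j)\<^sup>2) \<le> (\<Sum>k\<in>G n. ((\<Sum>j<J. \<beta> j * v (k - j)) + (\<Sum>j<J. \<gamma> j * g (k - j)))\<^sup>2)) sequentially"
    using eventually_gt_at_top[of 0]
  proof eventually_elim
    case (elim n)
    show ?case
    proof (intro allI impI)
      fix \<beta> \<gamma> :: "nat \<Rightarrow> real" assume \<gamma>: "(\<Sum>j<J. (\<gamma> j)\<^sup>2) \<le> L * (\<Sum>j<J. (\<beta> j)\<^sup>2)"
      have "s / 4 * real n * (\<Sum>j<J. (\<beta> j)\<^sup>2)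
          \<le> real n * (1/2 * (s - e1 n - e2 n) - L * e3 n) * (\<Sum>j<J. (\<beta> j)\<^sup>2)"
        using elim by (intro mult_right_mono) (auto simp: mult.commute[of "s / 4"] sum_nonneg)
      also note lower[OF elim(2) \<gamma>]
      finally show "s / 4 * real n * (\<Sum>j<J. (\<beta> j)\<^sup>2)
          \<le> (\<Sum>k\<in>G n. ((\<Sum>j<J. \<beta> j * v (k - j)) + (\<Sum>j<J. \<gamma> j * g (k - j)))\<^sup>2)" .
    qed
  qed
  show ?thesis using ev \<open>0 < s\<close> by (intro exI[of _ "s / 4"]) auto
qed

section \<open>The closed loop along one trajectory\<close>

lemma powr_div_tendsto_0:
  assumes "a < 1"
  shows "(\<lambda>n. (1 + real n) powr a / real n) \<longlonglongrightarrow> 0"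
proof (rule real_tendsto_sandwich[of "\<lambda>_. 0"])
  show "eventually (\<lambda>n. (1 + real n) powr a / real n \<le> 2 * (1 + real n) powr (a - 1)) sequentially"
    using eventually_ge_at_top[of 1]
  proof eventually_elim
    case (elim n)
    have "(1 + real n) powr a = (1 + real n) powr (a - 1) * (1 + real n)"
      by (simp add: powr_diff)
    also have "\<dots> \<le> (1 + real n) powr (a - 1) * (2 * real n)"
      using elim by (intro mult_left_mono) auto
    finally show ?case using elim by (simp add: field_simps)
  qed
  have "filterlim (\<lambda>n. 1 + real n) at_top sequentially"
    by (rule filterlim_tendsto_add_at_top[OF tendsto_const filterlim_real_sequentially])
  then have "(\<lambda>n. (1 + real n) powr (a - 1)) \<longlonglongrightarrow> 0"
    using assms by (intro tendsto_neg_powr) auto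
  then show "(\<lambda>n. 2 * (1 + real n) powr (a - 1)) \<longlonglongrightarrow> 0"
    using tendsto_mult_right_zero by blast
qed auto

lemma square_add_le: "(a + b)\<^sup>2 \<le> 2 * a\<^sup>2 + 2 * b\<^sup>2" for a b :: real
  using sum_squares_bound[of a b] by (simp add: power2_sum)

lemma square_add3_le: "(a + b + c)\<^sup>2 \<le> 3 * (a\<^sup>2 + b\<^sup>2 + c\<^sup>2)" for a b c :: real
proof -
  have "0 \<le> (a - b)\<^sup>2 + (a - c)\<^sup>2 + (b - c)\<^sup>2" by simp
  then show ?thesis by (simp add: power2_eq_square algebra_simps)
qed

text \<open>The relations that hold at one fixed outcome; no probability occurs in this
  locale.\<close>

locale arx_path =
  fixes e :: "nat \<Rightarrow> 'p::finite" and \<theta> :: "real ^ 'p" and \<rho> :: real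
    and X U :: "int \<Rightarrow> 'a \<Rightarrow> real" and \<epsilon> V x :: "nat \<Rightarrow> 'a \<Rightarrow> real"
    and \<Phi> lse :: "nat \<Rightarrow> 'a \<Rightarrow> real ^ ('p + 2)" and \<omega> :: 'a
  assumes e: "bij_betw e {1..CARD('p)} UNIV"
    and \<rho>: "\<bar>\<rho>\<bar> < 1" "\<rho> \<noteq> 0"
    and model: "\<And>n. X (int n + 1) \<omega> =
        (\<Sum>k=1..CARD('p). \<theta> $ e k * X (int n - int k + 1) \<omega>) + U (int n) \<omega> + \<epsilon> (Suc n) \<omega>"
    and noise: "\<And>n. \<epsilon> (Suc n) \<omega> = \<rho> * \<epsilon> n \<omega> + V (Suc n) \<omega>"
    and \<Phi>_eq: "\<Phi> = regressor e X U"
    and lse: "\<And>n. lse (Suc n) \<omega> = lse n \<omega>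
        + (X (int n + 1) \<omega> - U (int n) \<omega> - lse n \<omega> \<bullet> \<Phi> n \<omega>) *\<^sub>R (ginv \<Phi> n \<omega> *v \<Phi> n \<omega>)"
    and control: "\<And>n. n \<ge> 1 \<Longrightarrow> U (int n) \<omega> = x (Suc n) \<omega> - lse n \<omega> \<bullet> \<Phi> n \<omega>"
begin

definition err :: "nat \<Rightarrow> real ^ ('p + 2)" where "err n = lse n \<omega> - vartheta e \<theta> \<rho>"
definition pe :: "nat \<Rightarrow> real" where "pe n = - (\<Phi> n \<omega> \<bullet> err n)"

lemma inner_ext_enum:
  fixes u w :: "real ^ ('p + 2)"
  shows "u \<bullet> w = (\<Sum>k=1..CARD('p)+2. u $ ext_enum e k * w $ ext_enum e k)"
proof -
  have "u \<bullet> w = (\<Sum>i\<in>UNIV. u $ i * w $ i)" by (simp add: inner_vec_def)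
  also have "\<dots> = (\<Sum>k\<in>{1..CARD('p + 2)}. u $ ext_enum e k * w $ ext_enum e k)"
    by (rule sum.reindex_bij_betw[OF bij_betw_ext_enum[OF e], symmetric])
  finally show ?thesis by simp
qed

lemma tuple_ext_enum: "k \<in> {1..CARD('p)+2} \<Longrightarrow> tuple (ext_enum e) f $ ext_enum e k = f k"
  by (rule tuple_nth[OF bij_betw_ext_enum[OF e]]) simp

lemma inner_regressor:
  "c \<bullet> \<Phi> n \<omega> = (\<Sum>j\<le>CARD('p). c $ ext_enum e (Suc j) * X (int n - int j) \<omega>) + c $ ext_enum e (CARD('p) + 2) * U (int n - 1) \<omega>"
proof -
  have "c \<bullet> \<Phi> n \<omega> = (\<Sum>k=1..CARD('p)+2. c $ ext_enum e k *
      (if k \<le> CARD('p) + 1 then X (int n - int k + 1) \<omega> else U (int n - 1) \<omega>))"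
    unfolding inner_ext_enum \<Phi>_eq regressor_def
    by (intro sum.cong refl) (simp only: tuple_ext_enum)
  also have "\<dots> = (\<Sum>k=1..CARD('p)+1. c $ ext_enum e k * X (int n - int k + 1) \<omega>) + c $ ext_enum e (CARD('p) + 2) * U (int n - 1) \<omega>"
    by simp
  also have "(\<Sum>k=1..CARD('p)+1. c $ ext_enum e k * X (int n - int k + 1) \<omega>)
      = (\<Sum>j\<le>CARD('p). c $ ext_enum e (Suc j) * X (int n - int j) \<omega>)"
    by (rule sum.reindex_bij_witness[of _ Suc "\<lambda>k. k - 1"]) (auto simp: of_nat_diff algebra_simps)
  finally show ?thesis .
qed

text \<open>The coefficients of $c \cdot \Phi_n$ once $U_{n-1}$ is eliminated by the model equation.\<close>

definition cf :: "real ^ ('p + 2) \<Rightarrow> nat \<Rightarrow> real" where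
  "cf c j = (if j \<le> CARD('p) then c $ ext_enum e (Suc j)
     + c $ ext_enum e (CARD('p) + 2) * (if j = 0 then 1 else - \<theta> $ e j) else 0)"

lemma U_eq: "1 \<le> n \<Longrightarrow> U (int n - 1) \<omega> = X (int n) \<omega> - (\<Sum>j=1..CARD('p). \<theta> $ e j * X (int n - int j) \<omega>) - \<epsilon> n \<omega>"
  using model[of "n - 1"] by (simp add: of_nat_diff algebra_simps)

lemma inner_regressor_cf:
  assumes "1 \<le> n"
  shows "c \<bullet> \<Phi> n \<omega> = (\<Sum>j\<le>CARD('p). cf c j * X (int n - int j) \<omega>) - c $ ext_enum e (CARD('p) + 2) * \<epsilon> n \<omega>"
proof -
  let ?u = "c $ ext_enum e (CARD('p) + 2)"
  have split: "(\<Sum>j\<le>CARD('p). f j) = f 0 + (\<Sum>j=1..CARD('p). f j)" for f :: "nat \<Rightarrow> real"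
    by (simp add: sum.atMost_shift sum.atLeast1_atMost_eq)
  have "(\<Sum>j\<le>CARD('p). cf c j * X (int n - int j) \<omega>)
      = (\<Sum>j\<le>CARD('p). c $ ext_enum e (Suc j) * X (int n - int j) \<omega>)
      + ?u * (\<Sum>j\<le>CARD('p). (if j = 0 then 1 else - \<theta> $ e j) * X (int n - int j) \<omega>)"
    by (simp add: cf_def sum.distrib[symmetric] sum_distrib_left algebra_simps)
  also have "(\<Sum>j\<le>CARD('p). (if j = 0 then 1 else - \<theta> $ e j) * X (int n - int j) \<omega>)
      = X (int n) \<omega> - (\<Sum>j=1..CARD('p). \<theta> $ e j * X (int n - int j) \<omega>)"
    unfolding split by (simp add: sum_negf)
  finally show ?thesis
    unfolding inner_regressor U_eq[OF assms] by (simp add: algebra_simps)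
qed

text \<open>For c = \<vartheta> the eliminated coefficients are \<theta>_(j+1) at lag j < p and 0 at
  lag p, and \<epsilon>_n gets the factor \<rho>. The elimination uses the model equation for X_n,
  which links U_(n-1) to the rest for n \<ge> 1; U_(-1) is arbitrary.\<close>

lemma prediction:
  assumes "1 \<le> n"
  shows "X (int n + 1) \<omega> = vartheta e \<theta> \<rho> \<bullet> \<Phi> n \<omega> + U (int n) \<omega> + V (Suc n) \<omega>"
proof -
  let ?c = "vartheta e \<theta> \<rho>"
  have u: "?c $ ext_enum e (CARD('p) + 2) = - \<rho>"
    by (simp add: vartheta_nth[OF e])
  have cf: "cf ?c j = (if j < CARD('p) then \<theta> $ e (Suc j) else 0)" if "j \<le> CARD('p)" for j
    using that by (auto simp: cf_def u vartheta_nth[OF e])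
  have "(\<Sum>j\<le>CARD('p). cf ?c j * X (int n - int j) \<omega>) = (\<Sum>j<CARD('p). \<theta> $ e (Suc j) * X (int n - int j) \<omega>)"
    by (rule sum.mono_neutral_cong_right) (auto simp: cf)
  also have "\<dots> = (\<Sum>k=1..CARD('p). \<theta> $ e k * X (int n - int k + 1) \<omega>)"
    by (rule sum.reindex_bij_witness[of _ "\<lambda>k. k - 1" Suc]) (auto simp: of_nat_diff algebra_simps)
  finally show ?thesis
    unfolding inner_regressor_cf[OF assms] u using model[of n] noise[of n] by simp
qed

lemma err_Suc: "err (Suc (Suc n)) = err (Suc n)
    + (V (Suc (Suc n)) \<omega> + pe (Suc n)) *\<^sub>R (ginv \<Phi> (Suc n) \<omega> *v \<Phi> (Suc n) \<omega>)"
  using prediction[of "Suc n"]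
  by (simp add: err_def lse[of "Suc n"] pe_def inner_diff_right inner_commute)

lemma tracking: "1 \<le> n \<Longrightarrow> X (int n + 1) \<omega> = x (Suc n) \<omega> + pe n + V (Suc n) \<omega>"
  using prediction[of n] control[of n] by (simp add: pe_def err_def inner_diff_right inner_commute)

text \<open>The contraction factor \<lambda> of H; it has to be at least |\<rho>| for
  \<open>Ee\<close> to dominate the squared noise.\<close>

definition rate :: real where "rate = max (1/2) \<bar>\<rho>\<bar>"

lemma rate: "0 < rate" "rate < 1" "\<bar>\<rho>\<bar> \<le> rate"
  using \<rho> by (auto simp: rate_def)

text \<open>Started from the initial values at times 0, ..., -p, so that it dominates, up to powers
  of \<open>rate\<close>, every X in the regressor, including those before time 1.\<close>

primrec Xe :: "nat \<Rightarrow> real" where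
  "Xe 0 = (\<Sum>j\<le>CARD('p). (X (- int j) \<omega>)\<^sup>2)"
| "Xe (Suc n) = rate * Xe n + (X (int n + 1) \<omega>)\<^sup>2"

primrec Ee :: "nat \<Rightarrow> real" where
  "Ee 0 = (\<epsilon> 0 \<omega>)\<^sup>2"
| "Ee (Suc n) = rate * Ee n + (V (Suc n) \<omega>)\<^sup>2 / (1 - \<bar>\<rho>\<bar>)"

definition He :: "nat \<Rightarrow> real" where "He n = Xe n + Ee n"

lemma Xe_nonneg: "0 \<le> Xe n"
  by (induction n) (use rate in \<open>auto intro!: sum_nonneg\<close>)

text \<open>Convexity of the square with weights |\<rho>| and 1 - |\<rho>|: (\<rho> a + v)^2 \<le>
  |\<rho>| a^2 + v^2 / (1 - |\<rho>|). This explains the factor in \<open>Ee\<close>.\<close>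

lemma Ee_ge: "(\<epsilon> n \<omega>)\<^sup>2 \<le> Ee n"
proof (induction n)
  case (Suc n)
  define r where "r = \<bar>\<rho>\<bar>"
  have r: "0 \<le> r" "r < 1" "r\<^sup>2 = \<rho>\<^sup>2" using \<rho> by (auto simp: r_def)
  define a v where "a = \<epsilon> n \<omega>" and "v = V (Suc n) \<omega>"
  have "(\<rho> * a + v)\<^sup>2 \<le> r * a\<^sup>2 + v\<^sup>2 / (1 - r)"
  proof -
    have "(\<bar>\<rho> * a\<bar> + \<bar>v\<bar>)\<^sup>2 \<le> r * a\<^sup>2 + v\<^sup>2 / (1 - r)"
    proof -
      define A B where "A = \<bar>a\<bar>" and "B = \<bar>v\<bar>"
      have "0 \<le> r * ((1 - r) * A - B)\<^sup>2" using r by simp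
      then have "(r * A + B)\<^sup>2 * (1 - r) \<le> r * A\<^sup>2 * (1 - r) + B\<^sup>2"
        by (simp add: power2_eq_square algebra_simps)
      then have "(r * A + B)\<^sup>2 \<le> r * A\<^sup>2 + B\<^sup>2 / (1 - r)"
        using r by (simp add: field_simps)
      then show ?thesis by (simp add: A_def B_def r_def abs_mult)
    qed
    moreover have "(\<rho> * a + v)\<^sup>2 \<le> (\<bar>\<rho> * a\<bar> + \<bar>v\<bar>)\<^sup>2"
      by (rule power2_le_iff_abs_le[THEN iffD2]) auto
    ultimately show ?thesis by linarith
  qed
  also have "r * a\<^sup>2 \<le> rate * Ee n"
    using Suc rate r by (intro mult_mono) (auto simp: a_def r_def)
  finally show ?case by (simp add: noise a_def v_def r_def)
qed simp

lemma Ee_nonneg: "0 \<le> Ee n"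
  using Ee_ge[of n] by (rule order_trans[rotated]) simp

lemma He_nonneg: "0 \<le> He n"
  by (simp add: He_def Xe_nonneg Ee_nonneg)

lemma Xe_ge: "j \<le> CARD('p) \<Longrightarrow> rate ^ j * (X (int n - int j) \<omega>)\<^sup>2 \<le> Xe n"
proof (induction n arbitrary: j)
  case 0
  have "rate ^ j * (X (- int j) \<omega>)\<^sup>2 \<le> 1 * (X (- int j) \<omega>)\<^sup>2"
    using rate by (intro mult_right_mono power_le_one) auto
  also have "\<dots> \<le> Xe 0"
    using 0 by (simp, intro member_le_sum) auto
  finally show ?case by simp
next
  case (Suc n)
  show ?case
  proof (cases j)
    case 0
    then show ?thesis using rate Xe_nonneg[of n] by (simp add: add.commute)
  next
    case (Suc i)
    have "rate * (rate ^ i * (X (int n - int i) \<omega>)\<^sup>2) \<le> rate * Xe n"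
      using Suc.IH[of i] Suc.prems Suc rate by (intro mult_left_mono) auto
    then show ?thesis using Suc by (simp add: mult.assoc add_increasing2)
  qed
qed

text \<open>The entry U_(n-1) is not bounded directly: the model equation expresses it by X_n, ...,
  X_(n-p) and \<epsilon>_n.\<close>

lemma norm_regressor_le: "\<exists>C\<ge>0. \<forall>n\<ge>1. (norm (\<Phi> n \<omega>))\<^sup>2 \<le> C * He n"
proof -
  define T where "T = (\<Sum>j=1..CARD('p). (\<theta> $ e j)\<^sup>2)"
  define A where "A = (real CARD('p) + 1) / rate ^ CARD('p)"
  have T: "0 \<le> T" by (simp add: T_def sum_nonneg)
  have A: "0 \<le> A" using rate by (simp add: A_def)
  have "(norm (\<Phi> n \<omega>))\<^sup>2 \<le> ((4 + 3 * T) * A + 3) * He n" if n: "1 \<le> n" for n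
  proof -
    define Q where "Q = (\<Sum>j\<le>CARD('p). (X (int n - int j) \<omega>)\<^sup>2)"
    have Q: "Q \<le> A * Xe n"
    proof -
      have "Q \<le> (\<Sum>j\<le>CARD('p). Xe n / rate ^ CARD('p))"
        unfolding Q_def
      proof (rule sum_mono)
        fix j assume j: "j \<in> {..CARD('p)}"
        have "rate ^ CARD('p) * (X (int n - int j) \<omega>)\<^sup>2 \<le> rate ^ j * (X (int n - int j) \<omega>)\<^sup>2"
          using rate j by (intro mult_right_mono power_decreasing) auto
        also have "\<dots> \<le> Xe n" using Xe_ge j by auto
        finally show "(X (int n - int j) \<omega>)\<^sup>2 \<le> Xe n / rate ^ CARD('p)"
          using rate by (simp add: field_simps)
      qed
      then show ?thesis by (simp add: A_def add.commute)
    qed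
    have Q1: "(X (int n) \<omega>)\<^sup>2 \<le> Q"
      unfolding Q_def using member_le_sum[of 0 "{..CARD('p)}" "\<lambda>j. (X (int n - int j) \<omega>)\<^sup>2"] by simp
    have Q2: "(\<Sum>j=1..CARD('p). \<theta> $ e j * X (int n - int j) \<omega>)\<^sup>2 \<le> T * Q"
    proof -
      have "(\<Sum>j=1..CARD('p). \<theta> $ e j * X (int n - int j) \<omega>)\<^sup>2 \<le> T * (\<Sum>j=1..CARD('p). (X (int n - int j) \<omega>)\<^sup>2)"
        unfolding T_def by (rule Cauchy_Schwarz_ineq_sum)
      also have "\<dots> \<le> T * Q"
        unfolding Q_def using T by (intro mult_left_mono sum_mono2) auto
      finally show ?thesis .
    qed
    have "(norm (\<Phi> n \<omega>))\<^sup>2 = Q + (U (int n - 1) \<omega>)\<^sup>2"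
    proof -
      have nth: "\<Phi> n \<omega> $ ext_enum e (Suc j) = X (int n - int j) \<omega>" if "j \<le> CARD('p)" for j
        using that tuple_ext_enum[of "Suc j"] by (simp add: \<Phi>_eq regressor_def)
      have last: "\<Phi> n \<omega> $ ext_enum e (CARD('p) + 2) = U (int n - 1) \<omega>"
        using tuple_ext_enum[of "CARD('p) + 2"] by (simp add: \<Phi>_eq regressor_def)
      show ?thesis
        unfolding power2_norm_eq_inner inner_regressor[of "\<Phi> n \<omega>"] last Q_def
        by (simp add: nth power2_eq_square)
    qed
    also have "\<dots> \<le> Q + 3 * ((X (int n) \<omega>)\<^sup>2 + (\<Sum>j=1..CARD('p). \<theta> $ e j * X (int n - int j) \<omega>)\<^sup>2 + (\<epsilon> n \<omega>)\<^sup>2)"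
      unfolding U_eq[OF n]
      using square_add3_le[of "X (int n) \<omega>" "- (\<Sum>j=1..CARD('p). \<theta> $ e j * X (int n - int j) \<omega>)" "- \<epsilon> n \<omega>"]
      by simp
    also have "\<dots> \<le> Q + 3 * (Q + T * Q + Ee n)"
      using Q1 Q2 Ee_ge[of n] by simp
    also have "\<dots> = (4 + 3 * T) * Q + 3 * Ee n" by (simp add: algebra_simps)
    also have "\<dots> \<le> (4 + 3 * T) * (A * Xe n) + 3 * Ee n"
      using Q T by (intro add_right_mono mult_left_mono) auto
    also have "\<dots> \<le> ((4 + 3 * T) * A + 3) * He n"
      using T A Xe_nonneg[of n] Ee_nonneg[of n] by (simp add: He_def algebra_simps)
    finally show ?thesis .
  qed
  then show ?thesis using T A by (intro exI[of _ "(4 + 3 * T) * A + 3"]) auto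
qed

text \<open>Filtering $c \cdot \Phi$ by $1 - \rho L$, with $L$ the lag operator, removes the tail of the
  autoregressive noise.\<close>

definition cfilt :: "real ^ ('p + 2) \<Rightarrow> nat \<Rightarrow> real" where
  "cfilt c j = cf c j - (if j = 0 then 0 else \<rho> * cf c (j - 1))"

text \<open>The coefficients of V in the filtered regressor: with u the last coordinate of c, the
  filter leaves -u V_(k+1) of the term in \<epsilon>, and this is merged into lag 0.\<close>

definition cnoise :: "real ^ ('p + 2) \<Rightarrow> nat \<Rightarrow> real" where
  "cnoise c j = cfilt c j - (if j = 0 then c $ ext_enum e (CARD('p) + 2) else 0)"

text \<open>By \<open>tracking\<close>, each X is V plus reference plus prediction error. The bound
  on k ensures k - j \<ge> 1 at all lags j \<le> p + 1.\<close>

lemma filtered_regressor: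
  assumes k: "CARD('p) + 2 \<le> k"
  shows "c \<bullet> \<Phi> (Suc k) \<omega> - \<rho> * (c \<bullet> \<Phi> k \<omega>) =
    (\<Sum>j<CARD('p)+2. cnoise c j * V (Suc (k - j)) \<omega>) + (\<Sum>j<CARD('p)+2. cfilt c j * (x (Suc (k - j)) \<omega> + pe (k - j)))"
proof -
  let ?u = "c $ ext_enum e (CARD('p) + 2)"
  define Z where "Z i = X (int i + 1) \<omega>" for i
  have Z: "Z (k - j) = V (Suc (k - j)) \<omega> + (x (Suc (k - j)) \<omega> + pe (k - j))" if "j < CARD('p) + 2" for j
    unfolding Z_def using tracking[of "k - j"] k that by simp
  have 1: "c \<bullet> \<Phi> (Suc k) \<omega> = (\<Sum>j<CARD('p)+2. cf c j * Z (k - j)) - ?u * \<epsilon> (Suc k) \<omega>"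
  proof -
    have "(\<Sum>j\<le>CARD('p). cf c j * X (int (Suc k) - int j) \<omega>) = (\<Sum>j\<le>CARD('p). cf c j * Z (k - j))"
      using k by (intro sum.cong) (auto simp: Z_def of_nat_diff algebra_simps)
    also have "\<dots> = (\<Sum>j<CARD('p)+2. cf c j * Z (k - j))"
      by (rule sum.mono_neutral_cong_left) (auto simp: cf_def)
    finally show ?thesis using inner_regressor_cf[of "Suc k" c] by simp
  qed
  have 2: "\<rho> * (c \<bullet> \<Phi> k \<omega>) = (\<Sum>j<CARD('p)+2. (if j = 0 then 0 else \<rho> * cf c (j - 1)) * Z (k - j)) - \<rho> * ?u * \<epsilon> k \<omega>"
  proof -
    have "(\<Sum>j<CARD('p)+2. (if j = 0 then 0 else \<rho> * cf c (j - 1)) * Z (k - j))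
        = (\<Sum>j<Suc CARD('p). \<rho> * cf c j * Z (k - Suc j))"
      by (simp only: add_2_eq_Suc' sum.lessThan_Suc_shift) simp
    also have "\<dots> = (\<Sum>j\<le>CARD('p). \<rho> * cf c j * X (int k - int j) \<omega>)"
      using k by (intro sum.cong) (auto simp: Z_def of_nat_diff algebra_simps lessThan_Suc_atMost)
    finally have eq: "(\<Sum>j<CARD('p)+2. (if j = 0 then 0 else \<rho> * cf c (j - 1)) * Z (k - j))
        = (\<Sum>j\<le>CARD('p). \<rho> * cf c j * X (int k - int j) \<omega>)" .
    have "1 \<le> k" using k by simp
    then show ?thesis unfolding eq
      by (simp add: inner_regressor_cf sum_distrib_left right_diff_distrib mult.assoc)
  qed
  have "c \<bullet> \<Phi> (Suc k) \<omega> - \<rho> * (c \<bullet> \<Phi> k \<omega>) = (\<Sum>j<CARD('p)+2. cfilt c j * Z (k - j)) - ?u * V (Suc k) \<omega>"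
    unfolding 1 2 by (simp add: cfilt_def noise sum_subtractf algebra_simps)
  also have "(\<Sum>j<CARD('p)+2. cfilt c j * Z (k - j)) = (\<Sum>j<CARD('p)+2. cfilt c j * V (Suc (k - j)) \<omega>)
      + (\<Sum>j<CARD('p)+2. cfilt c j * (x (Suc (k - j)) \<omega> + pe (k - j)))"
    unfolding sum.distrib[symmetric] by (intro sum.cong) (auto simp: Z algebra_simps)
  also have "(\<Sum>j<CARD('p)+2. cfilt c j * V (Suc (k - j)) \<omega>) = (\<Sum>j<CARD('p)+2. cnoise c j * V (Suc (k - j)) \<omega>) + ?u * V (Suc k) \<omega>"
  proof -
    have "(\<Sum>j<CARD('p)+2. cfilt c j * V (Suc (k - j)) \<omega>)
        = (\<Sum>j<CARD('p)+2. cnoise c j * V (Suc (k - j)) \<omega> + (if j = 0 then ?u * V (Suc k) \<omega> else 0))"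
      by (intro sum.cong) (auto simp: cnoise_def algebra_simps)
    then show ?thesis by (simp add: sum.distrib)
  qed
  finally show ?thesis by simp
qed

text \<open>The coefficient \<open>cf c\<close> vanishes at lag p + 1 by definition, and
  \<open>cnoise c j\<close> = 0 for j \<ge> 1 says that it is \<rho> times its predecessor; so
  \<rho> \<noteq> 0 lets it be annihilated downwards from p to 0. Lag 0 then gives u = 0 and hence c
  = 0. For \<rho> = 0 the vector (0, \<theta>, 1) would be in the kernel.\<close>

lemma cnoise_eq_0:
  assumes "\<And>j. j < CARD('p) + 2 \<Longrightarrow> cnoise c j = 0"
  shows "c = 0"
proof -
  let ?u = "c $ ext_enum e (CARD('p) + 2)"
  have step: "cf c (j - 1) = 0" if "1 \<le> j" "j \<le> CARD('p) + 1" "cf c j = 0" for j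
    using assms[of j] that \<rho> by (simp add: cnoise_def cfilt_def)
  have cf0: "cf c (CARD('p) + 1 - i) = 0" if "i \<le> CARD('p) + 1" for i
    using that
  proof (induction i)
    case (Suc i)
    then show ?case using step[of "CARD('p) + 1 - i"] by simp
  qed (simp add: cf_def)
  have cf: "cf c j = 0" if "j \<le> CARD('p)" for j
    using cf0[of "CARD('p) + 1 - j"] that by simp
  have u: "?u = 0" using assms[of 0] cf[of 0] by (simp add: cnoise_def cfilt_def)
  have "c $ ext_enum e k = 0" if "k \<in> {1..CARD('p)+2}" for k
  proof (cases "k = CARD('p) + 2")
    case False
    then show ?thesis using cf[of "k - 1"] that u by (auto simp: cf_def split: if_splits)
  qed (use u in simp)
  then have "c \<bullet> c = 0" unfolding inner_ext_enum by simp
  then show ?thesis by simp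
qed

text \<open>An injective linear map on a finite-dimensional space is bounded below.\<close>

lemma cnoise_bounded_below: "\<exists>B>0. \<forall>c. B * (norm c)\<^sup>2 \<le> (\<Sum>j<CARD('p)+2. (cnoise c j)\<^sup>2)"
proof -
  define f :: "real ^ ('p + 2) \<Rightarrow> real ^ ('p + 2)" where "f c = tuple (ext_enum e) (\<lambda>k. cnoise c (k - 1))" for c
  have norm_f: "(norm (f c))\<^sup>2 = (\<Sum>j<CARD('p)+2. (cnoise c j)\<^sup>2)" for c
  proof -
    have "(norm (f c))\<^sup>2 = (\<Sum>k=1..CARD('p)+2. (cnoise c (k - 1))\<^sup>2)"
      unfolding power2_norm_eq_inner inner_ext_enum f_def
      by (intro sum.cong refl) (simp only: tuple_ext_enum power2_eq_square)
    also have "\<dots> = (\<Sum>j<CARD('p)+2. (cnoise c j)\<^sup>2)"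
      by (rule sum.reindex_bij_witness[of _ Suc "\<lambda>k. k - 1"]) auto
    finally show ?thesis .
  qed
  have "cnoise (a + b) j = cnoise a j + cnoise b j" "cnoise (r *\<^sub>R a) j = r * cnoise a j" for a b r j
    by (auto simp: cnoise_def cfilt_def cf_def algebra_simps)
  then have "linear f"
    by (intro linearI) (auto simp: f_def tuple_def vec_eq_iff)
  moreover have "inj f"
  proof (rule linear_injective_0[OF \<open>linear f\<close>, THEN iffD2], intro allI impI)
    fix c assume "f c = 0"
    then have "(\<Sum>j<CARD('p)+2. (cnoise c j)\<^sup>2) = 0" using norm_f[of c] by simp
    then have "\<forall>j\<in>{..<CARD('p)+2}. (cnoise c j)\<^sup>2 = 0" by (subst (asm) sum_nonneg_eq_0_iff) auto
    then show "c = 0" by (intro cnoise_eq_0) auto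
  qed
  ultimately obtain B where B: "B > 0" "\<And>c. B * norm c \<le> norm (f c)"
    using linear_inj_bounded_below_pos by blast
  have "B\<^sup>2 * (norm c)\<^sup>2 \<le> (\<Sum>j<CARD('p)+2. (cnoise c j)\<^sup>2)" for c
    unfolding norm_f[symmetric] power_mult_distrib[symmetric] using B by (intro power_mono) auto
  then show ?thesis using B(1) by (intro exI[of _ "B\<^sup>2"]) auto
qed

text \<open>Provides the comparison of coefficients required by \<open>excitation\<close>: the two
  families differ at lag 0 only, by a coordinate of c, and \<open>cnoise\<close> controls the norm
  of c.\<close>

lemma cfilt_le: "\<exists>L\<ge>0. \<forall>c. (\<Sum>j<CARD('p)+2. (cfilt c j)\<^sup>2) \<le> L * (\<Sum>j<CARD('p)+2. (cnoise c j)\<^sup>2)"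
proof -
  obtain B where B: "B > 0" "\<And>c. B * (norm c)\<^sup>2 \<le> (\<Sum>j<CARD('p)+2. (cnoise c j)\<^sup>2)"
    using cnoise_bounded_below by blast
  have "(\<Sum>j<CARD('p)+2. (cfilt c j)\<^sup>2) \<le> (2 + 2 / B) * (\<Sum>j<CARD('p)+2. (cnoise c j)\<^sup>2)" for c
  proof -
    let ?u = "c $ ext_enum e (CARD('p) + 2)"
    have "?u\<^sup>2 \<le> (norm c)\<^sup>2"
      using component_le_norm_cart[of c "ext_enum e (CARD('p) + 2)"] by (simp add: abs_le_square_iff[symmetric])
    also have "\<dots> \<le> (\<Sum>j<CARD('p)+2. (cnoise c j)\<^sup>2) / B"
      using B(1) B(2)[of c] by (simp add: field_simps)
    finally have u: "?u\<^sup>2 \<le> (\<Sum>j<CARD('p)+2. (cnoise c j)\<^sup>2) / B" .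
    have "(\<Sum>j<CARD('p)+2. (cfilt c j)\<^sup>2) \<le> (\<Sum>j<CARD('p)+2. 2 * (cnoise c j)\<^sup>2 + (if j = 0 then 2 * ?u\<^sup>2 else 0))"
    proof (rule sum_mono)
      fix j
      from square_add_le[of "cnoise c j" ?u]
      show "(cfilt c j)\<^sup>2 \<le> 2 * (cnoise c j)\<^sup>2 + (if j = 0 then 2 * ?u\<^sup>2 else 0)"
        by (auto simp: cnoise_def)
    qed
    also have "\<dots> = 2 * (\<Sum>j<CARD('p)+2. (cnoise c j)\<^sup>2) + 2 * ?u\<^sup>2"
      by (simp add: sum.distrib sum_distrib_left)
    also have "\<dots> \<le> 2 * (\<Sum>j<CARD('p)+2. (cnoise c j)\<^sup>2) + 2 * ((\<Sum>j<CARD('p)+2. (cnoise c j)\<^sup>2) / B)"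
      by (intro add_left_mono mult_left_mono u) simp
    also have "\<dots> = (2 + 2 / B) * (\<Sum>j<CARD('p)+2. (cnoise c j)\<^sup>2)"
      by (simp only: distrib_right times_divide_eq_right times_divide_eq_left)
    finally show ?thesis .
  qed
  then show ?thesis using B(1) by (intro exI[of _ "2 + 2 / B"]) auto
qed

end

section \<open>Rates, counts and lagged sums\<close>

lemma tendsto_0_powr_bound:
  fixes f :: "nat \<Rightarrow> real"
  assumes "\<And>n. 0 \<le> f n" "\<And>n. f n \<le> C * (1 + real n) powr a" "a < 1"
  shows "(\<lambda>n. f n / real n) \<longlonglongrightarrow> 0"
proof (rule real_tendsto_sandwich[of "\<lambda>_. 0"])
  show "eventually (\<lambda>n. f n / real n \<le> C * ((1 + real n) powr a / real n)) sequentially"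
    using assms(2) by (intro always_eventually allI) (simp add: divide_right_mono)
  show "(\<lambda>n. C * ((1 + real n) powr a / real n)) \<longlonglongrightarrow> 0"
    by (rule tendsto_mult_right_zero[OF powr_div_tendsto_0[OF \<open>a < 1\<close>]])
qed (use assms(1) in auto)

lemma one_plus_ln_le_powr:
  assumes "0 < a"
  shows "1 + ln (1 + real n) \<le> (1 + 1 / a) * (1 + real n) powr a"
proof -
  have "ln (1 + real n) \<le> (1 + real n) powr a / a"
    using assms by (intro ln_powr_bound) auto
  moreover have "1 \<le> (1 + real n) powr a"
    using assms by (intro ge_one_powr_ge_zero) auto
  ultimately show ?thesis by (simp add: algebra_simps)
qed

lemma partial_sums_le_linear:
  fixes f :: "nat \<Rightarrow> real"
  assumes "(\<lambda>n. (\<Sum>k<n. f k) / real n) \<longlonglongrightarrow> l"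
  obtains K where "0 \<le> K" "\<And>n. (\<Sum>k<n. f k) \<le> K * real n"
proof -
  have "Bseq (\<lambda>n. (\<Sum>k<n. f k) / real n)"
    using assms by (intro convergent_imp_Bseq) (auto simp: convergent_def)
  then obtain K where K: "0 < K" "\<And>n. norm ((\<Sum>k<n. f k) / real n) \<le> K"
    by (auto simp: Bseq_def)
  have "(\<Sum>k<n. f k) \<le> K * real n" for n
  proof (cases "n = 0")
    case False
    have "(\<Sum>k<n. f k) / real n \<le> K"
      using K(2)[of n] by (metis abs_le_D1 real_norm_def)
    then show ?thesis using False by (simp add: field_simps)
  qed simp
  then show thesis using that[of K] K(1) by simp
qed

lemma card_lagged_le:
  "card {k \<in> {J..<n}. \<exists>j<J. P (k - j)} \<le> J * card {k. k < n \<and> P k}"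
proof -
  have "{k \<in> {J..<n}. \<exists>j<J. P (k - j)} = (\<Union>j<J. {k \<in> {J..<n}. P (k - j)})" by auto
  also have "card \<dots> \<le> (\<Sum>j<J. card {k \<in> {J..<n}. P (k - j)})"
    by (rule card_UN_le) simp
  also have "\<dots> \<le> (\<Sum>j<J. card {k. k < n \<and> P k})"
  proof (rule sum_mono)
    fix j assume "j \<in> {..<J}"
    then show "card {k \<in> {J..<n}. P (k - j)} \<le> card {k. k < n \<and> P k}"
      by (intro card_inj_on_le[of "\<lambda>k. k - j"]) (auto simp: inj_on_def)
  qed
  finally show ?thesis by simp
qed

lemma sum_lagged_le:
  fixes f :: "nat \<Rightarrow> real"
  assumes "\<And>i. 0 \<le> f i" "j < J" "\<And>k. k \<in> G \<Longrightarrow> J \<le> k \<and> k - j \<in> T" "finite T"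
  shows "(\<Sum>k\<in>G. f (k - j)) \<le> sum f T"
proof -
  have inj: "inj_on (\<lambda>k. k - j) G"
  proof (rule inj_onI)
    fix k l assume "k \<in> G" "l \<in> G" "k - j = l - j"
    moreover have "j < k" "j < l" using assms(2) assms(3)[OF \<open>k \<in> G\<close>] assms(3)[OF \<open>l \<in> G\<close>] by auto
    ultimately show "k = l" by simp
  qed
  have "(\<Sum>k\<in>G. f (k - j)) = sum f ((\<lambda>k. k - j) ` G)"
    by (simp add: sum.reindex[OF inj])
  also have "\<dots> \<le> sum f T"
    using assms by (intro sum_mono2) auto
  finally show ?thesis .
qed

section \<open>Growth, excitation and the error bound along a trajectory\<close>

context arx_path
begin

definition tr :: "nat \<Rightarrow> real" where "tr n = (\<Sum>i\<in>Basis. i \<bullet> (ginv \<Phi> n \<omega> *v i))"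

text \<open>The d_k of the overview; the value at 0 stands in for a drop from a matrix S_(-1) that
  does not exist, and \<open>pe_le\<close> accordingly asks for k \<ge> 1.\<close>

definition dtr :: "nat \<Rightarrow> real" where "dtr k = (case k of 0 \<Rightarrow> 0 | Suc m \<Rightarrow> tr m - tr (Suc m))"

definition wpe :: "nat \<Rightarrow> real" where "wpe k = (1 - gain \<Phi> k \<omega>) * (pe k)\<^sup>2"

lemma wpe_nonneg: "0 \<le> wpe k"
  unfolding wpe_def using gain_bounds[of \<Phi> k \<omega>] by simp

lemma tr_nonneg: "0 \<le> tr n"
  unfolding tr_def by (intro sum_nonneg ginv_nonneg)

lemma dtr_nonneg: "0 \<le> dtr k"
proof (cases k)
  case (Suc m)
  then show ?thesis
    using trace_ginv_diff[of \<Phi> m \<omega>] rank_one_gain_nonneg[of \<Phi> m \<omega>] by (simp add: dtr_def tr_def)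
qed (simp add: dtr_def)

lemma sum_dtr: "(\<Sum>k\<le>n. dtr k) = tr 0 - tr n"
  by (induction n) (auto simp: dtr_def)

lemma dtr_le: "dtr k \<le> tr 0"
proof -
  have "dtr k \<le> (\<Sum>k\<le>k. dtr k)" using dtr_nonneg by (intro member_le_sum) auto
  then show ?thesis using sum_dtr[of k] tr_nonneg[of k] by linarith
qed

lemma dtr_tendsto: "dtr \<longlonglongrightarrow> 0"
proof -
  have "summable dtr"
  proof (rule summableI_nonneg_bounded[of _ "tr 0"])
    fix n
    have "(\<Sum>k<n. dtr k) \<le> (\<Sum>k\<le>n. dtr k)" using dtr_nonneg by (intro sum_mono2) auto
    then show "(\<Sum>k<n. dtr k) \<le> tr 0" using sum_dtr[of n] tr_nonneg[of n] by linarith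
  qed (rule dtr_nonneg)
  then show ?thesis by (rule summable_LIMSEQ_zero)
qed

lemma pe_le:
  assumes "1 \<le> k"
  shows "(pe k)\<^sup>2 \<le> wpe k * (2 + dtr k * (norm (\<Phi> k \<omega>))\<^sup>2)"
proof -
  obtain m where k: "k = Suc m" using assms by (cases k) auto
  have "1 \<le> (1 - gain \<Phi> k \<omega>) * (2 + dtr k * (norm (\<Phi> k \<omega>))\<^sup>2)"
    using one_le_gain_mult[of \<Phi> m \<omega>] by (simp add: k dtr_def tr_def)
  then have "1 * (pe k)\<^sup>2 \<le> ((1 - gain \<Phi> k \<omega>) * (2 + dtr k * (norm (\<Phi> k \<omega>))\<^sup>2)) * (pe k)\<^sup>2"
    by (rule mult_right_mono) simp
  then show ?thesis by (simp add: wpe_def mult_ac)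
qed

text \<open>The deterministic core. Its hypotheses are properties of the noise and the reference
  that hold for almost every outcome.\<close>

theorem err_bound:
  assumes mean: "(\<lambda>n. (\<Sum>k<n. (V (Suc k) \<omega>)\<^sup>2) / real n) \<longlonglongrightarrow> s" and "0 < s"
    and corr: "\<And>i. 1 \<le> i \<Longrightarrow> (\<lambda>n. (\<Sum>k<n. V (Suc k) \<omega> * V (Suc (k + i)) \<omega>) / real n) \<longlonglongrightarrow> 0"
    and growth: "\<And>n. (V (Suc n) \<omega>)\<^sup>2 \<le> CV * real (Suc n) powr \<mu>" and \<mu>: "0 < \<mu>" "\<mu> < 1"
    and track: "(\<lambda>n. (\<Sum>k=1..n. (x k \<omega>)\<^sup>2) / real n) \<longlonglongrightarrow> 0"
    and h1: "\<And>n. \<bar>\<Sum>k\<le>n. (1 - gain \<Phi> k \<omega>) * pe k * V (Suc k) \<omega>\<bar>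
      \<le> C1 + 1/4 * (\<Sum>k\<le>n. ((1 - gain \<Phi> k \<omega>) * pe k)\<^sup>2)"
    and h2: "\<And>n. (\<Sum>k\<le>n. gain \<Phi> k \<omega> * (V (Suc k) \<omega>)\<^sup>2) \<le> C2 + c2 * (\<Sum>k\<le>n. gain \<Phi> k \<omega>)" and "0 \<le> c2"
  shows "(\<lambda>n. (norm (err n))\<^sup>2) \<in> O(\<lambda>n. ln (real n) / real n)"
proof -
  define S where "S n = sqsum \<Phi> n \<omega>" for n
  have S1: "1 \<le> S n" for n by (simp add: S_def sqsum_ge_1)
  have monoS: "mono S"
    unfolding S_def sqsum_def by (intro monoI add_left_mono sum_mono2) auto
  obtain Ca where Ca: "0 \<le> Ca"
    and W: "\<And>n. err (Suc n) \<bullet> (gram \<Phi> n \<omega> *v err (Suc n)) \<le> Ca * (1 + ln (S n))"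
    and sum_wpe: "\<And>n. (\<Sum>k\<le>n. wpe k) \<le> Ca * (1 + ln (S n))"
    using least_squares_error_bound[of err "\<lambda>k. V (Suc k) \<omega>" pe \<Phi> \<omega> C1 C2 c2, OF err_Suc pe_def h1 h2 \<open>0 \<le> c2\<close>]
    unfolding wpe_def S_def by blast
  obtain CP where CP: "0 \<le> CP" "\<And>n. 1 \<le> n \<Longrightarrow> (norm (\<Phi> n \<omega>))\<^sup>2 \<le> CP * He n"
    using norm_regressor_le by blast

  have track': "(\<lambda>n. (\<Sum>k<n. (x (Suc k) \<omega>)\<^sup>2) / real n) \<longlonglongrightarrow> 0"
    using track by (simp add: sum.atLeast1_atMost_eq)
  obtain Kx where Kx: "0 \<le> Kx" "\<And>n. (\<Sum>k<n. (x (Suc k) \<omega>)\<^sup>2) \<le> Kx * real n"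
    using partial_sums_le_linear[OF track'] by blast
  obtain Kv where Kv: "0 \<le> Kv" "\<And>n. (\<Sum>k<n. (V (Suc k) \<omega>)\<^sup>2) \<le> Kv * real n"
    using partial_sums_le_linear[OF mean] by blast

  define cv where "cv = 3 + 1 / (1 - \<bar>\<rho>\<bar>)"
  have cv: "0 \<le> cv" using \<rho> by (simp add: cv_def)
  define c where "c = 3 * CP"
  have c: "0 \<le> c" using CP by (simp add: c_def)
  define \<xi> where "\<xi> k = 3 * (x (Suc k) \<omega>)\<^sup>2 + cv * (V (Suc k) \<omega>)\<^sup>2 + 6 * wpe k + (if k = 0 then He 1 else 0)" for k
  have \<xi>0: "0 \<le> \<xi> k" for k
    unfolding \<xi>_def using cv wpe_nonneg[of k] He_nonneg[of 1] by (auto intro!: add_nonneg_nonneg)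
  have rec: "He (Suc k) \<le> (rate + c * (wpe k * dtr k)) * He k + \<xi> k" for k
  proof (cases "k = 0")
    case True
    have "0 \<le> (rate + c * (wpe 0 * dtr 0)) * He 0"
      using rate c wpe_nonneg[of 0] dtr_nonneg[of 0] He_nonneg[of 0] by (intro mult_nonneg_nonneg add_nonneg_nonneg) auto
    then show ?thesis
      using True cv wpe_nonneg[of 0] unfolding \<xi>_def by (auto intro!: add_increasing)
  next
    case False
    have pe: "(pe k)\<^sup>2 \<le> 2 * wpe k + wpe k * dtr k * (CP * He k)"
    proof -
      have "(pe k)\<^sup>2 \<le> wpe k * (2 + dtr k * (norm (\<Phi> k \<omega>))\<^sup>2)"
        using False by (intro pe_le) simp
      also have "\<dots> \<le> wpe k * (2 + dtr k * (CP * He k))"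
        using False CP(2)[of k] wpe_nonneg dtr_nonneg by (intro mult_left_mono add_left_mono) auto
      finally show ?thesis by (simp add: algebra_simps)
    qed
    have "(X (int k + 1) \<omega>)\<^sup>2 \<le> 3 * ((x (Suc k) \<omega>)\<^sup>2 + (pe k)\<^sup>2 + (V (Suc k) \<omega>)\<^sup>2)"
      using False square_add3_le[of "x (Suc k) \<omega>" "pe k" "V (Suc k) \<omega>"] by (simp add: tracking)
    also have "\<dots> \<le> 3 * ((x (Suc k) \<omega>)\<^sup>2 + (2 * wpe k + wpe k * dtr k * (CP * He k)) + (V (Suc k) \<omega>)\<^sup>2)"
      using pe by simp
    finally have X: "(X (int k + 1) \<omega>)\<^sup>2 \<le> \<dots>" .
    have "He (Suc k) = rate * He k + (X (int k + 1) \<omega>)\<^sup>2 + (V (Suc k) \<omega>)\<^sup>2 / (1 - \<bar>\<rho>\<bar>)"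
      by (simp add: He_def algebra_simps)
    also have "\<dots> \<le> rate * He k + 3 * ((x (Suc k) \<omega>)\<^sup>2 + (2 * wpe k + wpe k * dtr k * (CP * He k)) + (V (Suc k) \<omega>)\<^sup>2)
        + (V (Suc k) \<omega>)\<^sup>2 / (1 - \<bar>\<rho>\<bar>)"
      using X by simp
    also have "\<dots> = (rate + c * (wpe k * dtr k)) * He k + \<xi> k"
      using False by (simp add: \<xi>_def cv_def c_def algebra_simps)
    finally show ?thesis .
  qed

  \<comment> \<open>One constant above all those that the growth lemma needs.\<close>
  define K where "K = 1 + Ca + 3 * Kx + cv * Kv + 6 * Ca + He 1 + (norm (\<Phi> 0 \<omega>))\<^sup>2 + CP"
  have K: "1 \<le> K" "Ca \<le> K" "3 * Kx + cv * Kv + 6 * Ca + He 1 \<le> K" "1 + (norm (\<Phi> 0 \<omega>))\<^sup>2 \<le> K" "CP \<le> K"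
    using Ca Kx Kv cv CP He_nonneg[of 1] by (auto simp: K_def)
  have sum_\<xi>: "(\<Sum>k\<le>n. \<xi> k) \<le> K * (1 + real n + ln (S n))" for n
  proof -
    have L: "0 \<le> ln (S n)" using S1 by simp
    have "(\<Sum>k\<le>n. \<xi> k) = 3 * (\<Sum>k<Suc n. (x (Suc k) \<omega>)\<^sup>2) + cv * (\<Sum>k<Suc n. (V (Suc k) \<omega>)\<^sup>2) + 6 * (\<Sum>k\<le>n. wpe k) + He 1"
      unfolding \<xi>_def by (simp only: sum.distrib sum_distrib_left[symmetric] lessThan_Suc_atMost) (simp add: sum.delta)
    also have "\<dots> \<le> 3 * (Kx * real (Suc n)) + cv * (Kv * real (Suc n)) + 6 * (Ca * (1 + ln (S n))) + He 1"
      by (intro add_mono mult_left_mono Kx(2) Kv(2) sum_wpe cv order_refl) simp_all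
    also have "\<dots> \<le> (3 * Kx + cv * Kv + 6 * Ca + He 1) * (1 + real n + ln (S n))"
    proof -
      define q where "q = 1 + real n + ln (S n)"
      have q: "real (Suc n) \<le> q" "1 + ln (S n) \<le> q" "1 \<le> q" using L by (auto simp: q_def)
      have "3 * (Kx * real (Suc n)) \<le> 3 * Kx * q" "cv * (Kv * real (Suc n)) \<le> cv * Kv * q"
        "6 * (Ca * (1 + ln (S n))) \<le> 6 * Ca * q"
        using q Kx Kv Ca cv by (auto simp: mult.assoc intro!: mult_left_mono)
      moreover have "He 1 * 1 \<le> He 1 * q" by (intro mult_left_mono q He_nonneg)
      ultimately show ?thesis unfolding q_def[symmetric] by (simp add: algebra_simps)
    qed
    also have "\<dots> \<le> K * (1 + real n + ln (S n))"
      using K(3) L by (intro mult_right_mono) auto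
    finally show ?thesis .
  qed
  have S_le: "S n \<le> K * (1 + (\<Sum>k\<le>n. He k))" for n
  proof -
    have "(\<Sum>k\<le>n. (norm (\<Phi> k \<omega>))\<^sup>2) \<le> (\<Sum>k\<le>n. (if k = 0 then (norm (\<Phi> 0 \<omega>))\<^sup>2 else 0) + CP * He k)"
      using CP He_nonneg by (intro sum_mono) (auto simp: add_increasing)
    also have "\<dots> = (norm (\<Phi> 0 \<omega>))\<^sup>2 + CP * (\<Sum>k\<le>n. He k)"
      by (simp add: sum.distrib sum_distrib_left)
    finally have "S n \<le> (1 + (norm (\<Phi> 0 \<omega>))\<^sup>2) * 1 + CP * (\<Sum>k\<le>n. He k)"
      by (simp add: S_def sqsum_def)
    also have "\<dots> \<le> K * 1 + K * (\<Sum>k\<le>n. He k)"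
      using K He_nonneg by (intro add_mono mult_right_mono sum_nonneg) auto
    finally show ?thesis by (simp add: algebra_simps)
  qed
  have sum_wpe': "(\<Sum>k\<le>n. wpe k) \<le> K * (1 + ln (S n))" for n
    using sum_wpe[of n] mult_right_mono[OF K(2), of "1 + ln (S n)"] S1[of n] by auto
  obtain CL where CL: "0 \<le> CL" "\<And>n. ln (S n) \<le> CL * (1 + ln (1 + real n))"
    using perturbed_recursion_ln_growth[of He rate c wpe dtr \<xi> K S, OF rec He_nonneg wpe_nonneg dtr_nonneg \<xi>0
        less_imp_le[OF rate(2)] c K(1) sum_wpe' dtr_tendsto sum_\<xi> S1 monoS S_le] by blast
  define l where "l n = 1 + ln (1 + real n)" for n
  have l1: "1 \<le> l n" for n by (simp add: l_def)
  have lS: "1 + ln (S n) \<le> (1 + CL) * l n" for n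
  proof -
    have "ln (S n) \<le> CL * l n" using CL(2)[of n] by (simp add: l_def)
    then show ?thesis using l1[of n] by (simp add: distrib_right)
  qed

  \<comment> \<open>Midway between \<mu>, the growth exponent of V^2, and 1: \<open>bad\<close>
    needs \<mu> < \<tau>, \<open>small\<close> needs \<tau> < 1.\<close>
  define \<tau> where "\<tau> = (1 + \<mu>) / 2"
  have \<tau>: "0 < \<tau>" "\<tau> < 1" "\<mu> < \<tau>" using \<mu> by (auto simp: \<tau>_def)
  define \<kappa> where "\<kappa> n = (1 + real n) powr \<tau>" for n
  have \<kappa>: "1 \<le> \<kappa> n" for n unfolding \<kappa>_def using \<tau> by (intro ge_one_powr_ge_zero) auto
  let ?J = "CARD('p) + 2"
  \<comment> \<open>The times at which H is below the threshold at every lag of the filtered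
    regressor.\<close>
  define G where "G n = {k \<in> {?J..<n}. \<forall>j<?J. He (k - j) < \<kappa> n}" for n

  \<comment> \<open>The perturbations contribute O(log n), as d_k is at most the initial trace; the
    inputs sum to O(n), and dividing by the threshold n^\<tau> leaves n^(1 - \<tau>).\<close>
  have count: "\<exists>A\<ge>0. \<forall>n. real (card {k. k < n \<and> \<kappa> n \<le> He k}) \<le> A * (1 + real n) powr (1 - \<tau>)"
  proof -
    define D where "D = ln (2 / (1 + rate))"
    have D: "0 < D" unfolding D_def using rate by (intro ln_gt_zero) (simp add: field_simps)
    define l1a where "l1a = 1 + 1 / (1 - \<tau>)"
    define A where "A = (He 0 + c * tr 0 * Ca * (1 + CL) * l1a / rate + (K * (1 + (1 + CL) * 2)))"
    have A: "0 \<le> A"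
      unfolding A_def l1a_def using He_nonneg[of 0] c tr_nonneg[of 0] Ca CL(1) rate \<tau> K
      by (intro add_nonneg_nonneg mult_nonneg_nonneg divide_nonneg_nonneg) auto
    have "real (card {k. k < n \<and> \<kappa> n \<le> He k}) * D \<le> A * (1 + real n) powr (1 - \<tau>)" for n
    proof -
      define q where "q = (1 + real n) powr (1 - \<tau>)"
      have q: "1 \<le> q" unfolding q_def using \<tau> by (intro ge_one_powr_ge_zero) auto
      have "real (card {k. k < n \<and> \<kappa> n \<le> He k}) * D
          \<le> ln (1 + He 0 / \<kappa> n) + (\<Sum>k<n. c * (wpe k * dtr k)) / rate + (\<Sum>k<n. \<xi> k) / \<kappa> n"
        unfolding D_def using rate(1,2) \<kappa>[of n] c wpe_nonneg dtr_nonneg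
        by (intro perturbed_recursion_count rec He_nonneg \<xi>0) auto
      also have "\<dots> \<le> He 0 * q + c * tr 0 * Ca * (1 + CL) * l1a / rate * q + (K * (1 + (1 + CL) * 2)) * q"
      proof (intro add_mono)
        have "ln (1 + He 0 / \<kappa> n) \<le> He 0 / \<kappa> n"
          using He_nonneg[of 0] \<kappa>[of n] by (intro ln_add_one_self_le_self) auto
        also have "\<dots> \<le> He 0 / 1" using He_nonneg[of 0] \<kappa>[of n] by (intro divide_left_mono) auto
        also have "\<dots> \<le> He 0 * q" using mult_left_mono[OF q He_nonneg[of 0]] by simp
        finally show "ln (1 + He 0 / \<kappa> n) \<le> He 0 * q" .
        have "(\<Sum>k<n. c * (wpe k * dtr k)) \<le> (\<Sum>k<n. c * (wpe k * tr 0))"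
          by (intro sum_mono mult_left_mono dtr_le wpe_nonneg c)
        also have "\<dots> \<le> (\<Sum>k\<le>n. c * (wpe k * tr 0))"
          by (rule sum_mono2) (auto intro!: mult_nonneg_nonneg c wpe_nonneg tr_nonneg)
        also have "\<dots> = c * tr 0 * (\<Sum>k\<le>n. wpe k)"
          by (simp add: sum_distrib_left mult_ac)
        also have "\<dots> \<le> c * tr 0 * (Ca * ((1 + CL) * (l1a * q)))"
        proof (intro mult_left_mono)
          have "l n \<le> l1a * q" unfolding l_def l1a_def q_def using \<tau> by (intro one_plus_ln_le_powr) auto
          then have "1 + ln (S n) \<le> (1 + CL) * (l1a * q)"
            using lS[of n] mult_left_mono[of "l n" "l1a * q" "1 + CL"] CL(1) by linarith
          then have "Ca * (1 + ln (S n)) \<le> Ca * ((1 + CL) * (l1a * q))"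
            by (rule mult_left_mono) (rule Ca)
          then show "(\<Sum>k\<le>n. wpe k) \<le> Ca * ((1 + CL) * (l1a * q))"
            using sum_wpe[of n] by (rule order_trans[rotated])
        qed (use c tr_nonneg[of 0] in auto)
        finally have "(\<Sum>k<n. c * (wpe k * dtr k)) / rate \<le> c * tr 0 * (Ca * ((1 + CL) * (l1a * q))) / rate"
          using rate by (intro divide_right_mono) auto
        then show "(\<Sum>k<n. c * (wpe k * dtr k)) / rate \<le> c * tr 0 * Ca * (1 + CL) * l1a / rate * q"
          by (simp add: mult_ac)
        have "(\<Sum>k<n. \<xi> k) \<le> (\<Sum>k\<le>n. \<xi> k)" using \<xi>0 by (intro sum_mono2) auto
        also have "\<dots> \<le> K * (1 + real n + ln (S n))" by (rule sum_\<xi>)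
        also have "\<dots> \<le> K * ((1 + (1 + CL) * 2) * (1 + real n))"
        proof (intro mult_left_mono)
          have "ln (1 + real n) \<le> real n" by (rule ln_add_one_self_le_self) simp
          then have "l n \<le> 2 * (1 + real n)" by (simp add: l_def)
          then have "1 + ln (S n) \<le> (1 + CL) * (2 * (1 + real n))"
            using lS[of n] mult_left_mono[of "l n" "2 * (1 + real n)" "1 + CL"] CL(1) by linarith
          then show "1 + real n + ln (S n) \<le> (1 + (1 + CL) * 2) * (1 + real n)"
            by (simp add: algebra_simps)
        qed (use K in auto)
        finally have "(\<Sum>k<n. \<xi> k) / \<kappa> n \<le> K * ((1 + (1 + CL) * 2) * (1 + real n)) / \<kappa> n"
          using \<kappa>[of n] by (intro divide_right_mono) auto
        also have "\<dots> = (K * (1 + (1 + CL) * 2)) * q"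
          by (simp add: q_def \<kappa>_def powr_diff)
        finally show "(\<Sum>k<n. \<xi> k) / \<kappa> n \<le> (K * (1 + (1 + CL) * 2)) * q" .
      qed
      also have "\<dots> = A * q" by (simp add: A_def algebra_simps)
      finally show ?thesis by (simp add: q_def)
    qed
    then have "real (card {k. k < n \<and> \<kappa> n \<le> He k}) \<le> A / D * (1 + real n) powr (1 - \<tau>)" for n
      using D by (simp add: field_simps)
    then show ?thesis using A D by (intro exI[of _ "A / D"]) auto
  qed
  then obtain A where A: "0 \<le> A" "\<And>n. real (card {k. k < n \<and> \<kappa> n \<le> He k}) \<le> A * (1 + real n) powr (1 - \<tau>)"
    by blast

  have CV0: "0 \<le> CV"
    using growth[of 0] order_trans[OF zero_le_power2] by fastforce
  \<comment> \<open>O(n^(1 - \<tau>)) omitted times, each with V^2 = O(n^\<mu>), and 1 - \<tau> +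
    \<mu> < 1.\<close>
  have bad: "(\<lambda>n. (\<Sum>k\<in>{?J..<n} - G n. (V (Suc (k - j)) \<omega>)\<^sup>2) / real n) \<longlonglongrightarrow> 0" if "j < ?J" for j
  proof (rule tendsto_0_powr_bound[of _ "real ?J * A * CV" "1 - \<tau> + \<mu>"])
    fix n
    have Beq: "{?J..<n} - G n = {k \<in> {?J..<n}. \<exists>j<?J. \<kappa> n \<le> He (k - j)}"
      by (auto simp: G_def not_less)
    have "real (card ({?J..<n} - G n)) \<le> real (?J * card {k. k < n \<and> \<kappa> n \<le> He k})"
      unfolding Beq by (intro of_nat_mono card_lagged_le)
    also have "\<dots> = real ?J * real (card {k. k < n \<and> \<kappa> n \<le> He k})" by (rule of_nat_mult)
    also have "\<dots> \<le> real ?J * (A * (1 + real n) powr (1 - \<tau>))"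
      by (intro mult_left_mono A) simp
    finally have card: "real (card ({?J..<n} - G n)) \<le> real ?J * (A * (1 + real n) powr (1 - \<tau>))" .
    have "(\<Sum>k\<in>{?J..<n} - G n. (V (Suc (k - j)) \<omega>)\<^sup>2) \<le> (\<Sum>k\<in>{?J..<n} - G n. CV * (1 + real n) powr \<mu>)"
    proof (rule sum_mono)
      fix k assume k: "k \<in> {?J..<n} - G n"
      have "(V (Suc (k - j)) \<omega>)\<^sup>2 \<le> CV * real (Suc (k - j)) powr \<mu>" by (rule growth)
      also have "\<dots> \<le> CV * (1 + real n) powr \<mu>"
        using k \<mu> CV0 by (intro mult_left_mono powr_mono2) auto
      finally show "(V (Suc (k - j)) \<omega>)\<^sup>2 \<le> CV * (1 + real n) powr \<mu>" .
    qed
    also have "\<dots> = real (card ({?J..<n} - G n)) * (CV * (1 + real n) powr \<mu>)" by simp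
    also have "\<dots> \<le> (real ?J * (A * (1 + real n) powr (1 - \<tau>))) * (CV * (1 + real n) powr \<mu>)"
      using card CV0 by (intro mult_right_mono) auto
    also have "\<dots> = real ?J * A * CV * (1 + real n) powr (1 - \<tau> + \<mu>)"
      by (simp add: powr_add mult_ac)
    finally show "(\<Sum>k\<in>{?J..<n} - G n. (V (Suc (k - j)) \<omega>)\<^sup>2) \<le> real ?J * A * CV * (1 + real n) powr (1 - \<tau> + \<mu>)" .
  qed (use \<tau> in \<open>auto intro: sum_nonneg\<close>)

  have small: "(\<lambda>n. (\<Sum>k\<in>G n. (x (Suc (k - j)) \<omega> + pe (k - j))\<^sup>2) / real n) \<longlonglongrightarrow> 0" if j: "j < ?J" for j
  proof -
    define T where "T n = {i. i < n \<and> 1 \<le> i \<and> He i < \<kappa> n}" for n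
    \<comment> \<open>Room for the logarithm: at kept times \<pi>^2 is at most a constant times
      \<alpha> n^\<tau>, and the sum of \<alpha>, being O(log n), is also O(n^\<eta>).\<close>
    define \<eta> where "\<eta> = (1 - \<tau>) / 2"
    have \<eta>: "0 < \<eta>" "\<eta> + \<tau> < 1" using \<tau> by (auto simp: \<eta>_def field_simps)
    define Q where "Q = Ca * (1 + CL) * (1 + 1 / \<eta>)"
    define R where "R n = (\<Sum>i\<in>T n. (pe i)\<^sup>2)" for n
    have Tlag: "?J \<le> k \<and> k - j \<in> T n" if "k \<in> G n" for k n
      using that j by (auto simp: G_def T_def)
    have "(\<lambda>n. R n / real n) \<longlonglongrightarrow> 0"
    proof (rule tendsto_0_powr_bound)
      fix n
      have "R n \<le> (\<Sum>i\<in>T n. wpe i * ((2 + tr 0 * CP) * \<kappa> n))"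
        unfolding R_def
      proof (rule sum_mono)
        fix i assume i: "i \<in> T n"
        have "(pe i)\<^sup>2 \<le> wpe i * (2 + dtr i * (norm (\<Phi> i \<omega>))\<^sup>2)"
          using i by (intro pe_le) (auto simp: T_def)
        also have "\<dots> \<le> wpe i * (2 * \<kappa> n + tr 0 * (CP * \<kappa> n))"
        proof (intro mult_left_mono add_mono mult_mono)
          have "(norm (\<Phi> i \<omega>))\<^sup>2 \<le> CP * He i" using i by (intro CP) (auto simp: T_def)
          also have "\<dots> \<le> CP * \<kappa> n" using i CP by (intro mult_left_mono) (auto simp: T_def)
          finally show "(norm (\<Phi> i \<omega>))\<^sup>2 \<le> CP * \<kappa> n" .
        qed (use \<kappa>[of n] dtr_le tr_nonneg[of 0] wpe_nonneg in auto)
        finally show "(pe i)\<^sup>2 \<le> wpe i * ((2 + tr 0 * CP) * \<kappa> n)" by (simp add: algebra_simps)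
      qed
      also have "\<dots> = (\<Sum>i\<in>T n. wpe i) * ((2 + tr 0 * CP) * \<kappa> n)" by (simp add: sum_distrib_right)
      also have "\<dots> \<le> (Q * (1 + real n) powr \<eta>) * ((2 + tr 0 * CP) * \<kappa> n)"
      proof (intro mult_right_mono)
        have "(\<Sum>i\<in>T n. wpe i) \<le> (\<Sum>i\<le>n. wpe i)"
          using wpe_nonneg by (intro sum_mono2) (auto simp: T_def)
        also have "\<dots> \<le> Ca * (1 + ln (S n))" by (rule sum_wpe)
        also have "\<dots> \<le> Ca * ((1 + CL) * l n)" using lS Ca by (intro mult_left_mono) auto
        also have "\<dots> \<le> Q * (1 + real n) powr \<eta>"
          unfolding l_def Q_def mult.assoc using \<eta> Ca CL(1)
          by (intro mult_left_mono one_plus_ln_le_powr) auto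
        finally show "(\<Sum>i\<in>T n. wpe i) \<le> Q * (1 + real n) powr \<eta>" .
      qed (use \<kappa>[of n] tr_nonneg[of 0] CP in auto)
      also have "\<dots> = (Q * (2 + tr 0 * CP)) * (1 + real n) powr (\<eta> + \<tau>)"
        by (simp add: \<kappa>_def powr_add mult_ac)
      finally show "R n \<le> (Q * (2 + tr 0 * CP)) * (1 + real n) powr (\<eta> + \<tau>)" .
    qed (use \<eta> in \<open>auto simp: R_def intro: sum_nonneg\<close>)
    with track' have lim: "(\<lambda>n. 2 * ((\<Sum>k<n. (x (Suc k) \<omega>)\<^sup>2) / real n) + 2 * (R n / real n)) \<longlonglongrightarrow> 2 * 0 + 2 * 0"
      by (intro tendsto_intros)
    show ?thesis
    proof (rule real_tendsto_sandwich[of "\<lambda>_. 0", OF _ _ tendsto_const])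
      show "(\<lambda>n. 2 * ((\<Sum>k<n. (x (Suc k) \<omega>)\<^sup>2) / real n) + 2 * (R n / real n)) \<longlonglongrightarrow> 0"
        using lim by simp
      show "eventually (\<lambda>n. (\<Sum>k\<in>G n. (x (Suc (k - j)) \<omega> + pe (k - j))\<^sup>2) / real n
          \<le> 2 * ((\<Sum>k<n. (x (Suc k) \<omega>)\<^sup>2) / real n) + 2 * (R n / real n)) sequentially"
      proof (intro always_eventually allI)
        fix n
        have "(\<Sum>k\<in>G n. (x (Suc (k - j)) \<omega> + pe (k - j))\<^sup>2)
            \<le> (\<Sum>k\<in>G n. 2 * (x (Suc (k - j)) \<omega>)\<^sup>2 + 2 * (pe (k - j))\<^sup>2)"
          by (intro sum_mono square_add_le)
        also have "\<dots> = 2 * (\<Sum>k\<in>G n. (x (Suc (k - j)) \<omega>)\<^sup>2) + 2 * (\<Sum>k\<in>G n. (pe (k - j))\<^sup>2)"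
          by (simp add: sum.distrib sum_distrib_left)
        also have "(\<Sum>k\<in>G n. (x (Suc (k - j)) \<omega>)\<^sup>2) \<le> (\<Sum>k<n. (x (Suc k) \<omega>)\<^sup>2)"
          by (rule sum_lagged_le[of "\<lambda>i. (x (Suc i) \<omega>)\<^sup>2", OF _ j]) (use Tlag[of _ n] in \<open>auto simp: T_def\<close>)
        also have "(\<Sum>k\<in>G n. (pe (k - j))\<^sup>2) \<le> R n"
          unfolding R_def
          by (rule sum_lagged_le[of "\<lambda>i. (pe i)\<^sup>2", OF _ j]) (use Tlag[of _ n] in \<open>auto simp: T_def\<close>)
        finally have "(\<Sum>k\<in>G n. (x (Suc (k - j)) \<omega> + pe (k - j))\<^sup>2) \<le> 2 * (\<Sum>k<n. (x (Suc k) \<omega>)\<^sup>2) + 2 * R n"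
          by simp
        then show "(\<Sum>k\<in>G n. (x (Suc (k - j)) \<omega> + pe (k - j))\<^sup>2) / real n
          \<le> 2 * ((\<Sum>k<n. (x (Suc k) \<omega>)\<^sup>2) / real n) + 2 * (R n / real n)"
          by (simp add: add_divide_distrib[symmetric] divide_right_mono)
      qed
    qed (intro always_eventually allI divide_nonneg_nonneg sum_nonneg zero_le_power2 of_nat_0_le_iff)
  qed

  obtain L where L: "0 \<le> L" "\<And>c. (\<Sum>j<?J. (cfilt c j)\<^sup>2) \<le> L * (\<Sum>j<?J. (cnoise c j)\<^sup>2)"
    using cfilt_le by blast
  obtain B where B: "0 < B" "\<And>c. B * (norm c)\<^sup>2 \<le> (\<Sum>j<?J. (cnoise c j)\<^sup>2)"
    using cnoise_bounded_below by blast
  have Gsub: "G n \<subseteq> {?J..<n}" for n by (auto simp: G_def)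
  define ex where "ex k0 n \<longleftrightarrow> (\<forall>\<beta> \<gamma>. (\<Sum>j<?J. (\<gamma> j)\<^sup>2) \<le> L * (\<Sum>j<?J. (\<beta> j)\<^sup>2) \<longrightarrow>
     k0 * real n * (\<Sum>j<?J. (\<beta> j)\<^sup>2) \<le> (\<Sum>k\<in>G n. ((\<Sum>j<?J. \<beta> j * V (Suc (k - j)) \<omega>)
       + (\<Sum>j<?J. \<gamma> j * (x (Suc (k - j)) \<omega> + pe (k - j))))\<^sup>2))" for k0 n
  obtain k0 where k0: "0 < k0" and ev: "eventually (ex k0) sequentially"
    using excitation[of "\<lambda>k. V (Suc k) \<omega>" s G ?J "\<lambda>k. x (Suc k) \<omega> + pe k" L,
        OF mean \<open>0 < s\<close> corr Gsub bad small L(1)] unfolding ex_def[abs_def] by auto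
  \<comment> \<open>A bound for all c at once, since it is applied to c =
    \<open>err (Suc n)\<close>. The 4 arises because the square of the filtered difference is at
    most 2 Y_(k+1) + 2 Y_k, and each of the two sums is at most the full sum of Y.\<close>
  have excite: "k0 * B / 4 * real n * (norm c)\<^sup>2 \<le> c \<bullet> (gram \<Phi> n \<omega> *v c)"
    if n: "ex k0 n" for n c
  proof -
    define Y where "Y k = (c \<bullet> \<Phi> k \<omega>)\<^sup>2" for k
    have "k0 * real n * (B * (norm c)\<^sup>2) \<le> k0 * real n * (\<Sum>j<?J. (cnoise c j)\<^sup>2)"
      using k0 B(2) by (intro mult_left_mono) auto
    also have "\<dots> \<le> (\<Sum>k\<in>G n. ((\<Sum>j<?J. cnoise c j * V (Suc (k - j)) \<omega>)
       + (\<Sum>j<?J. cfilt c j * (x (Suc (k - j)) \<omega> + pe (k - j))))\<^sup>2)"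
      using n L(2)[of c] unfolding ex_def by blast
    also have "\<dots> = (\<Sum>k\<in>G n. (c \<bullet> \<Phi> (Suc k) \<omega> - \<rho> * (c \<bullet> \<Phi> k \<omega>))\<^sup>2)"
      by (intro sum.cong refl) (subst filtered_regressor, auto simp: G_def)
    also have "\<dots> \<le> (\<Sum>k\<in>G n. 2 * Y (Suc k) + 2 * Y k)"
    proof (rule sum_mono)
      fix k
      have "\<rho>\<^sup>2 \<le> 1" using \<rho> by (simp add: abs_square_le_1)
      then have "(\<rho> * (c \<bullet> \<Phi> k \<omega>))\<^sup>2 \<le> 1 * Y k"
        unfolding Y_def power_mult_distrib by (intro mult_right_mono) auto
      then show "(c \<bullet> \<Phi> (Suc k) \<omega> - \<rho> * (c \<bullet> \<Phi> k \<omega>))\<^sup>2 \<le> 2 * Y (Suc k) + 2 * Y k"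
        using square_add_le[of "c \<bullet> \<Phi> (Suc k) \<omega>" "- (\<rho> * (c \<bullet> \<Phi> k \<omega>))"] by (simp add: Y_def)
    qed
    also have "\<dots> \<le> (\<Sum>k<n. 2 * Y (Suc k) + 2 * Y k)"
      using Gsub[of n] by (intro sum_mono2) (auto simp: Y_def)
    also have "\<dots> = 2 * (\<Sum>k<n. Y (Suc k)) + 2 * (\<Sum>k<n. Y k)"
      by (simp add: sum.distrib sum_distrib_left)
    also have "\<dots> \<le> 2 * (\<Sum>k\<le>n. Y k) + 2 * (\<Sum>k\<le>n. Y k)"
    proof (intro add_mono mult_left_mono)
      show "(\<Sum>k<n. Y (Suc k)) \<le> (\<Sum>k\<le>n. Y k)" by (simp add: sum.atMost_shift Y_def)
      show "(\<Sum>k<n. Y k) \<le> (\<Sum>k\<le>n. Y k)" by (intro sum_mono2) (auto simp: Y_def)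
    qed auto
    also have "\<dots> \<le> 4 * (c \<bullet> (gram \<Phi> n \<omega> *v c))"
      unfolding gram_inner by (simp add: Y_def power2_eq_square inner_commute)
    finally show ?thesis by (simp add: mult_ac)
  qed
  have "eventually (\<lambda>n. norm ((norm (err (Suc n)))\<^sup>2) \<le> (4 / (k0 * B) * (Ca * (1 + CL))) * norm (l n / real n)) sequentially"
    using ev eventually_gt_at_top[of 0]
  proof eventually_elim
    case (elim n)
    have "k0 * B / 4 * real n * (norm (err (Suc n)))\<^sup>2 \<le> Ca * (1 + ln (S n))"
      using excite[OF elim(1)] W order_trans by blast
    also have "\<dots> \<le> Ca * ((1 + CL) * l n)" using lS Ca by (intro mult_left_mono) auto
    finally have "(norm (err (Suc n)))\<^sup>2 \<le> 4 / (k0 * B) * (Ca * (1 + CL)) * (l n / real n)"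
      using k0 B(1) elim(2) by (simp add: field_simps)
    then show ?case using l1[of n] by simp
  qed
  then have "(\<lambda>n. (norm (err (Suc n)))\<^sup>2) \<in> O(\<lambda>n. l n / real n)"
    by (rule bigoI)
  also have "(\<lambda>n. l n / real n) \<in> O(\<lambda>n. ln (real (Suc n)) / real (Suc n))"
  proof (rule bigoI[of _ 4])
    show "eventually (\<lambda>n. norm (l n / real n) \<le> 4 * norm (ln (real (Suc n)) / real (Suc n))) sequentially"
      using eventually_ge_at_top[of 2]
    proof eventually_elim
      case (elim n)
      \<comment> \<open>For n \<ge> 2 the argument is at least 3, hence at least e.\<close>
      have "1 \<le> ln (real (Suc n))"
        using elim exp_le by (subst ln_ge_iff) (auto intro: order_trans)
      then have "l n \<le> 2 * ln (real (Suc n))" by (simp add: l_def add.commute)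
      then have "l n / real n \<le> (2 * ln (real (Suc n))) / real n"
        by (rule divide_right_mono) simp
      also have "\<dots> \<le> (2 * ln (real (Suc n))) / (real (Suc n) / 2)"
        using elim by (intro divide_left_mono) auto
      finally show ?case using l1[of n] by simp
    qed
  qed
  finally have "(\<lambda>n. (norm (err (Suc n)))\<^sup>2) \<in> O(\<lambda>n. ln (real (Suc n)) / real (Suc n))" .
  then obtain C where "eventually (\<lambda>n. norm ((norm (err (Suc n)))\<^sup>2) \<le> C * norm (ln (real (Suc n)) / real (Suc n))) sequentially"
    by (elim landau_o.bigE)
  then have "eventually (\<lambda>n. norm ((norm (err n))\<^sup>2) \<le> C * norm (ln (real n) / real n)) sequentially"
    by (subst (asm) eventually_sequentially_Suc)
  then show ?thesis by (rule bigoI)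
qed

end

section \<open>Adaptedness and conclusion\<close>

text \<open>Boundedness of \<open>a\<close> is what makes the product of the two errors O(a)
  again.\<close>

lemma bigo_mult_diff:
  fixes f g a :: "nat \<Rightarrow> real"
  assumes f: "(\<lambda>n. f n - F) \<in> O(a)" and g: "(\<lambda>n. g n - G) \<in> O(a)" and a: "a \<in> O(\<lambda>_. 1)"
  shows "(\<lambda>n. f n * g n - F * G) \<in> O(a)"
proof -
  have "(\<lambda>n. (f n - F) * (g n - G)) \<in> O(\<lambda>n. a n * 1)"
    by (rule landau_o.big.mult[OF f landau_o.big_trans[OF g a]])
  moreover have "(\<lambda>n. F * (g n - G)) \<in> O(a)" "(\<lambda>n. G * (f n - F)) \<in> O(a)"
    using f g by (simp_all add: landau_o.big.cmult_in_iff')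
  ultimately have "(\<lambda>n. (f n - F) * (g n - G) + (F * (g n - G) + G * (f n - F))) \<in> O(a)"
    by (intro sum_in_bigo) simp_all
  then show ?thesis by (simp add: algebra_simps)
qed

lemma bigo_power_diff:
  fixes f a :: "nat \<Rightarrow> real"
  assumes f: "(\<lambda>n. f n - F) \<in> O(a)" and a: "a \<in> O(\<lambda>_. 1)"
  shows "(\<lambda>n. f n ^ m - F ^ m) \<in> O(a)"
  by (induction m) (simp_all add: bigo_mult_diff[OF f _ a])

lemma theta_est_nth:
  fixes e :: "nat \<Rightarrow> 'p::finite"
  assumes "bij_betw e {1..CARD('p)} UNIV" "k \<in> {1..CARD('p)}"
  shows "theta_est e v $ e k = (\<Sum>i=1..k. rho_est e v ^ (k - i) * v $ ext_enum e i)
          + rho_est e v ^ (k - 1) * v $ ext_enum e (CARD('p) + 2)"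
  unfolding theta_est_def by (rule tuple_nth[OF assms])

text \<open>Both estimators are polynomials in the coordinates of the least squares estimate and
  return the true parameters at \<vartheta>. Errors, unlike their squares, pass through sums and
  products, hence the detour through a = sqrt r.\<close>

lemma estimators_bigo:
  fixes e :: "nat \<Rightarrow> 'p::finite" and v :: "nat \<Rightarrow> real ^ ('p + 2)"
  assumes e: "bij_betw e {1..CARD('p)} UNIV"
    and v: "(\<lambda>n. (norm (v n - vartheta e \<theta> \<rho>))\<^sup>2) \<in> O(r)"
    and r: "r \<in> O(\<lambda>_. 1)" "\<And>n. 0 \<le> r n"
  shows "(\<lambda>n. (norm (theta_est e (v n) - \<theta>))\<^sup>2) \<in> O(r)" "(\<lambda>n. (rho_est e (v n) - \<rho>)\<^sup>2) \<in> O(r)"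
proof -
  define a where "a n = sqrt (r n)" for n
  have sq: "(\<lambda>n. (f n)\<^sup>2) \<in> O(r)" if "f \<in> O(a)" for f :: "nat \<Rightarrow> real"
    using landau_o.big.mult[OF that that] r(2) by (simp add: a_def power2_eq_square)
  have unsq: "f \<in> O(\<lambda>n. sqrt (g n))" if f: "(\<lambda>n. (f n)\<^sup>2) \<in> O(g)" and g: "\<And>n. 0 \<le> g n" for f g :: "nat \<Rightarrow> real"
  proof -
    obtain c where c: "0 < c" "eventually (\<lambda>n. norm ((f n)\<^sup>2) \<le> c * norm (g n)) sequentially"
      using f by (elim landau_o.bigE)
    from c(2) have "eventually (\<lambda>n. norm (f n) \<le> sqrt c * norm (sqrt (g n))) sequentially"
    proof eventually_elim
      case (elim n)
      then have "sqrt ((f n)\<^sup>2) \<le> sqrt (c * g n)" using g[of n] by (intro real_sqrt_le_mono) simp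
      then show ?case using g[of n] by (simp add: real_sqrt_mult)
    qed
    then show ?thesis by (rule bigoI)
  qed
  have a: "a \<in> O(\<lambda>_. 1)"
    using unsq[of a "\<lambda>_. 1"] r by (simp add: a_def)
  have comp: "(\<lambda>n. v n $ i - vartheta e \<theta> \<rho> $ i) \<in> O(a)" for i
  proof -
    have "(\<lambda>n. norm (v n - vartheta e \<theta> \<rho>)) \<in> O(a)"
      unfolding a_def by (rule unsq[OF v r(2)])
    moreover have "(\<lambda>n. v n $ i - vartheta e \<theta> \<rho> $ i) \<in> O(\<lambda>n. norm (v n - vartheta e \<theta> \<rho>))"
      using component_le_norm_cart[of "v _ - vartheta e \<theta> \<rho>" i] by (intro bigoI[of _ 1]) simp
    ultimately show ?thesis by (rule landau_o.big_trans[rotated])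
  qed
  have rho: "(\<lambda>n. rho_est e (v n) - \<rho>) \<in> O(a)"
  proof -
    have eq: "rho_est e (v n) - \<rho> = - (v n $ ext_enum e (CARD('p) + 2) - vartheta e \<theta> \<rho> $ ext_enum e (CARD('p) + 2))" for n
      using rho_est_vartheta[OF e, of \<theta> \<rho>] by (simp add: rho_est_def)
    show ?thesis unfolding eq landau_o.big.uminus_in_iff by (rule comp)
  qed
  then show "(\<lambda>n. (rho_est e (v n) - \<rho>)\<^sup>2) \<in> O(r)" by (rule sq)
  have theta: "(\<lambda>n. theta_est e (v n) $ i - \<theta> $ i) \<in> O(a)" for i
  proof -
    obtain k where k: "k \<in> {1..CARD('p)}" "i = e k"
      using bij_betw_imp_surj_on[OF e] by (metis UNIV_I imageE)
    have eq: "\<theta> $ e k = (\<Sum>i=1..k. \<rho> ^ (k - i) * vartheta e \<theta> \<rho> $ ext_enum e i)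
          + \<rho> ^ (k - 1) * vartheta e \<theta> \<rho> $ ext_enum e (CARD('p) + 2)"
      using theta_est_nth[OF e k(1), of "vartheta e \<theta> \<rho>"]
      by (simp only: theta_est_vartheta[OF e] rho_est_vartheta[OF e])
    have prod: "(\<lambda>n. rho_est e (v n) ^ m * v n $ j - \<rho> ^ m * vartheta e \<theta> \<rho> $ j) \<in> O(a)" for m j
      by (rule bigo_mult_diff[OF bigo_power_diff[OF rho a] comp a])
    have "(\<lambda>n. (\<Sum>i=1..k. rho_est e (v n) ^ (k - i) * v n $ ext_enum e i - \<rho> ^ (k - i) * vartheta e \<theta> \<rho> $ ext_enum e i)
        + (rho_est e (v n) ^ (k - 1) * v n $ ext_enum e (CARD('p) + 2) - \<rho> ^ (k - 1) * vartheta e \<theta> \<rho> $ ext_enum e (CARD('p) + 2))) \<in> O(a)"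
      by (intro sum_in_bigo big_sum_in_bigo prod)
    then show ?thesis
      unfolding k(2) theta_est_nth[OF e k(1)] eq by (simp add: sum_subtractf algebra_simps)
  qed
  have "(norm (theta_est e (v n) - \<theta>))\<^sup>2 = (\<Sum>i\<in>UNIV. (theta_est e (v n) $ i - \<theta> $ i)\<^sup>2)" for n
    unfolding power2_norm_eq_inner by (simp add: inner_vec_def power2_eq_square)
  then show "(\<lambda>n. (norm (theta_est e (v n) - \<theta>))\<^sup>2) \<in> O(r)"
    using big_sum_in_bigo[of UNIV "\<lambda>i n. (theta_est e (v n) $ i - \<theta> $ i)\<^sup>2", OF sq[OF theta]] by simp
qed

lemma ln_over_n_tendsto_0: "(\<lambda>n. ln (real n) / real n) \<longlonglongrightarrow> 0"
  by (rule filterlim_compose[OF ln_x_over_x_tendsto_0 filterlim_real_sequentially])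

lemma tendsto_of_norm_sq_bigo:
  fixes f :: "nat \<Rightarrow> 'b::real_normed_vector"
  assumes "(\<lambda>n. (norm (f n - l))\<^sup>2) \<in> O(\<lambda>n. ln (real n) / real n)"
  shows "f \<longlonglongrightarrow> l"
proof -
  obtain c where c: "eventually (\<lambda>n. norm ((norm (f n - l))\<^sup>2) \<le> c * norm (ln (real n) / real n)) sequentially"
    using assms by (elim landau_o.bigE)
  have "(\<lambda>n. (norm (f n - l))\<^sup>2) \<longlonglongrightarrow> 0"
    by (rule Lim_null_comparison[OF c]) (rule tendsto_mult_right_zero[OF tendsto_norm_zero[OF ln_over_n_tendsto_0]])
  then have "(\<lambda>n. sqrt ((norm (f n - l))\<^sup>2)) \<longlonglongrightarrow> sqrt 0" by (rule tendsto_real_sqrt)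
  then show ?thesis by (simp add: tendsto_norm_zero_iff LIM_zero_iff)
qed

section \<open>Measurability of the least squares recursion\<close>

lemma borel_measurable_vecI:
  fixes f :: "'a \<Rightarrow> real ^ 'n::finite"
  assumes "\<And>i. (\<lambda>x. f x $ i) \<in> borel_measurable N"
  shows "f \<in> borel_measurable N"
proof -
  have "(\<lambda>x. f x \<bullet> b) \<in> borel_measurable N" if "b \<in> Basis" for b
  proof -
    obtain i where "b = axis i 1" using \<open>b \<in> Basis\<close> by (auto simp: Basis_vec_def)
    then show ?thesis using assms[of i] by (simp add: inner_axis)
  qed
  then show ?thesis by (subst borel_measurable_euclidean_space) auto
qed

lemma ginv_0: "ginv \<Phi> 0 \<omega> *v v = v - ((\<Phi> 0 \<omega> \<bullet> v) / (1 + \<Phi> 0 \<omega> \<bullet> \<Phi> 0 \<omega>)) *\<^sub>R \<Phi> 0 \<omega>"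
proof (rule ginv_eqI)
  define a b where "a = \<Phi> 0 \<omega> \<bullet> v" and "b = \<Phi> 0 \<omega> \<bullet> \<Phi> 0 \<omega>"
  have b: "0 \<le> b" by (simp add: b_def)
  have "gram \<Phi> 0 \<omega> *v (v - (a / (1 + b)) *\<^sub>R \<Phi> 0 \<omega>) = v + (a - a / (1 + b) * b - a / (1 + b)) *\<^sub>R \<Phi> 0 \<omega>"
    by (simp add: gram_vector_mult inner_diff_right a_def[symmetric] b_def[symmetric] algebra_simps)
  also have "a - a / (1 + b) * b - a / (1 + b) = 0" using b by (simp add: field_simps)
  finally show "gram \<Phi> 0 \<omega> *v (v - (\<Phi> 0 \<omega> \<bullet> v / (1 + \<Phi> 0 \<omega> \<bullet> \<Phi> 0 \<omega>)) *\<^sub>R \<Phi> 0 \<omega>) = v"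
    by (simp add: a_def b_def)
qed

text \<open>As \<open>matrix_inv\<close> is defined by choice, measurability is obtained from the
  Sherman-Morrison recursion. The vector w is arbitrary because the induction step applies the
  previous inverse to \<Phi>_(n+1) as well as to w.\<close>

lemma measurable_ginv_mult:
  fixes \<Phi> :: "nat \<Rightarrow> 'a \<Rightarrow> real ^ 'n::finite"
  assumes "\<And>k. k \<le> n \<Longrightarrow> \<Phi> k \<in> borel_measurable N" "w \<in> borel_measurable N"
  shows "(\<lambda>\<omega>. ginv \<Phi> n \<omega> *v w \<omega>) \<in> borel_measurable N"
  using assms
proof (induction n arbitrary: w)
  case 0
  have [measurable]: "\<Phi> 0 \<in> borel_measurable N" "w \<in> borel_measurable N" using 0 by auto
  show ?case unfolding ginv_0 by measurable
next
  case (Suc n)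
  have [measurable]: "\<Phi> (Suc n) \<in> borel_measurable N" "w \<in> borel_measurable N" using Suc.prems by auto
  have [measurable]: "(\<lambda>\<omega>. ginv \<Phi> n \<omega> *v \<Phi> (Suc n) \<omega>) \<in> borel_measurable N"
    "(\<lambda>\<omega>. ginv \<Phi> n \<omega> *v w \<omega>) \<in> borel_measurable N"
    using Suc by auto
  show ?case unfolding ginv_Suc by measurable
qed

lemma measurable_regressor:
  fixes e :: "nat \<Rightarrow> 'p::finite"
  assumes e: "bij_betw e {1..CARD('p)} UNIV"
    and X: "\<And>k. k \<le> int n \<Longrightarrow> X k \<in> borel_measurable N" and U: "U (int n - 1) \<in> borel_measurable N"
  shows "regressor e X U n \<in> borel_measurable N"
proof (rule borel_measurable_vecI)
  fix i :: "'p + 2"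
  have "i \<in> ext_enum e ` {1..CARD('p + 2)}"
    using bij_betw_imp_surj_on[OF bij_betw_ext_enum[OF e]] by simp
  then have "inv_into {1..CARD('p + 2)} (ext_enum e) i \<in> {1..CARD('p + 2)}"
    by (rule inv_into_into)
  then have k: "1 \<le> inv_into {1..CARD('p + 2)} (ext_enum e) i" by simp
  define k where "k = inv_into {1..CARD('p + 2)} (ext_enum e) i"
  have "(\<lambda>\<omega>. if k \<le> CARD('p) + 1 then X (int n - int k + 1) \<omega> else U (int n - 1) \<omega>) \<in> borel_measurable N"
    using X[of "int n - int k + 1"] U k by (cases "k \<le> CARD('p) + 1") (auto simp: k_def)
  then show "(\<lambda>\<omega>. regressor e X U n \<omega> $ i) \<in> borel_measurable N"
    unfolding regressor_def tuple_def k_def by simp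
qed

theorem corollary3p1:
  fixes M :: "'a measure" and F :: "nat \<Rightarrow> 'a measure"
    and e :: "nat \<Rightarrow> 'p::finite"
    and \<theta> :: "real ^ 'p" and \<rho> \<sigma> :: real
    and X U :: "int \<Rightarrow> 'a \<Rightarrow> real"
    and \<epsilon> V x :: "nat \<Rightarrow> 'a \<Rightarrow> real"
    and \<Phi> lse :: "nat \<Rightarrow> 'a \<Rightarrow> real ^ ('p + 2)"
  assumes "prob_space M"
    and "filtration (space M) F" and "\<And>n. subalgebra M (F n)"
    and "bij_betw e {1..CARD('p)} UNIV"
    and "\<bar>\<rho>\<bar> < 1" and "\<rho> \<noteq> 0"
    \<comment> \<open>initial values\<close>
    and "\<And>k. k \<le> 0 \<Longrightarrow> X k \<in> borel_measurable (F 0)"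
    and "\<epsilon> 0 \<in> borel_measurable (F 0)"
    and "U 0 \<in> borel_measurable (F 0)" and "U (-1) \<in> borel_measurable (F 0)"
    and "lse 0 \<in> borel_measurable (F 0)"
    \<comment> \<open>driving noise\<close>
    and "martingale_difference M F V"
    and "\<sigma>\<^sup>2 > 0"
    and "\<And>n. AE \<omega> in M. real_cond_exp M (F n) (\<lambda>\<omega>. (V (Suc n) \<omega>)\<^sup>2) \<omega> = \<sigma>\<^sup>2"
    and "finite_conditional_moment_gt2 M F V"
    \<comment> \<open>ARX model with autoregressive noise\<close>
    and "\<And>n \<omega>. \<omega> \<in> space M \<Longrightarrow>
      X (int n + 1) \<omega> =
        (\<Sum>k=1..CARD('p). \<theta> $ e k * X (int n - int k + 1) \<omega>) + U (int n) \<omega> + \<epsilon> (Suc n) \<omega>"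
    and "\<And>n \<omega>. \<omega> \<in> space M \<Longrightarrow> \<epsilon> (Suc n) \<omega> = \<rho> * \<epsilon> n \<omega> + V (Suc n) \<omega>"
    \<comment> \<open>least squares estimator\<close>
    and "\<Phi> = regressor e X U"
    and "\<And>n \<omega>. \<omega> \<in> space M \<Longrightarrow>
      lse (Suc n) \<omega> = lse n \<omega>
        + (X (int n + 1) \<omega> - U (int n) \<omega> - lse n \<omega> \<bullet> \<Phi> n \<omega>)
          *\<^sub>R (matrix_inv (gram \<Phi> n \<omega>) *v \<Phi> n \<omega>)"
    \<comment> \<open>adaptive tracking control\<close>
    and "\<And>n. x (Suc n) \<in> borel_measurable (F n)"
    and "AE \<omega> in M. (\<lambda>n. \<Sum>k=1..n. (x k \<omega>)\<^sup>2) \<in> o(\<lambda>n. real n)"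
    and "\<And>n \<omega>. n \<ge> 1 \<Longrightarrow> \<omega> \<in> space M \<Longrightarrow>
      U (int n) \<omega> = x (Suc n) \<omega> - lse n \<omega> \<bullet> \<Phi> n \<omega>"
  shows "(AE \<omega> in M. (\<lambda>n. theta_est e (lse n \<omega>)) \<longlonglongrightarrow> \<theta>) \<and>
    (AE \<omega> in M. (\<lambda>n. rho_est e (lse n \<omega>)) \<longlonglongrightarrow> \<rho>) \<and>
    (AE \<omega> in M. (\<lambda>n. (norm (theta_est e (lse n \<omega>) - \<theta>))\<^sup>2) \<in> O(\<lambda>n. ln (real n) / real n)) \<and>
    (AE \<omega> in M. (\<lambda>n. (rho_est e (lse n \<omega>) - \<rho>)\<^sup>2) \<in> O(\<lambda>n. ln (real n) / real n))"
proof -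
  note e = assms(4) and model = assms(16) and noise = assms(17) and \<Phi>_eq = assms(18)
    and lse = assms(19)[folded ginv_def] and control = assms(22)
  interpret white_noise M F V \<sigma>
    using assms(1-3,12-15)
    by (intro white_noise.intro filtered_prob_space.intro filtered_prob_space_axioms.intro white_noise_axioms.intro)
  have space_F: "space (F n) = space M" for n
    using filtration.space_F[OF filtr] .
  have cong: "f \<in> borel_measurable (F n)"
    if "g \<in> borel_measurable (F n)" "\<And>\<omega>. \<omega> \<in> space M \<Longrightarrow> f \<omega> = g \<omega>"
    for f g :: "'a \<Rightarrow> 'b::topological_space" and n
    using that measurable_cong[of "F n" f g] by (simp add: space_F)

  \<comment> \<open>The step follows the order of causality: \<epsilon>, X, the estimate, the
    regressor and finally the control, each from quantities already treated.\<close>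
  have adapted: "(\<forall>k\<le>int n. X k \<in> borel_measurable (F n)) \<and> U (int n) \<in> borel_measurable (F n)
      \<and> U (int n - 1) \<in> borel_measurable (F n) \<and> \<epsilon> n \<in> borel_measurable (F n)
      \<and> lse n \<in> borel_measurable (F n) \<and> (\<forall>k\<le>n. \<Phi> k \<in> borel_measurable (F n))" for n
  proof (induction n)
    case 0
    have "\<Phi> 0 \<in> borel_measurable (F 0)"
      unfolding \<Phi>_eq by (rule measurable_regressor[OF e]) (use assms(7,10) in auto)
    then show ?case using assms(7-11) by simp
  next
    case (Suc n)
    have up: "f \<in> borel_measurable (F n) \<Longrightarrow> f \<in> borel_measurable (F (Suc n))"
      for f :: "'a \<Rightarrow> 'b::topological_space"
      by (erule measurable_F_mono) simp
    have Xn[measurable]: "k \<le> int n \<Longrightarrow> X k \<in> borel_measurable (F (Suc n))" for k using Suc up by blast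
    have [measurable]: "U (int n) \<in> borel_measurable (F (Suc n))" "\<epsilon> n \<in> borel_measurable (F (Suc n))"
      "lse n \<in> borel_measurable (F (Suc n))" using Suc up by blast+
    have \<Phi>n: "k \<le> n \<Longrightarrow> \<Phi> k \<in> borel_measurable (F (Suc n))" for k using Suc up by blast
    then have [measurable]: "\<Phi> n \<in> borel_measurable (F (Suc n))" by simp
    note V_measurable[of n, measurable]
    have \<epsilon>[measurable]: "\<epsilon> (Suc n) \<in> borel_measurable (F (Suc n))"
      by (rule cong[OF _ noise]) measurable
    have XS[measurable]: "X (int n + 1) \<in> borel_measurable (F (Suc n))"
      by (rule cong[OF _ model]) (intro borel_measurable_add borel_measurable_sum borel_measurable_times
          borel_measurable_const Xn \<epsilon> \<open>U (int n) \<in> borel_measurable (F (Suc n))\<close>, auto)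
    have X: "X k \<in> borel_measurable (F (Suc n))" if "k \<le> int (Suc n)" for k
      using Xn[of k] XS that by (cases "k = int n + 1") auto
    have [measurable]: "(\<lambda>\<omega>. ginv \<Phi> n \<omega> *v \<Phi> n \<omega>) \<in> borel_measurable (F (Suc n))"
      by (rule measurable_ginv_mult) (use \<Phi>n in auto)
    have lseS[measurable]: "lse (Suc n) \<in> borel_measurable (F (Suc n))"
      by (rule cong[OF _ lse]) measurable
    have \<Phi>S[measurable]: "\<Phi> (Suc n) \<in> borel_measurable (F (Suc n))"
      unfolding \<Phi>_eq by (rule measurable_regressor[OF e X]) simp_all
    have "U (int (Suc n)) \<in> borel_measurable (F (Suc n))"
      by (rule cong[OF _ control])
        (auto intro: borel_measurable_diff assms(20) borel_measurable_inner lseS \<Phi>S)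
    then show ?case
      using X \<epsilon> lseS \<Phi>S \<Phi>n \<open>U (int n) \<in> borel_measurable (F (Suc n))\<close> by (auto simp: le_Suc_eq)
  qed
  have \<Phi>_meas: "\<Phi> n \<in> borel_measurable (F n)" and lse_meas: "lse n \<in> borel_measurable (F n)" for n
    using adapted[of n] by auto
  have ginv_meas: "(\<lambda>\<omega>. ginv \<Phi> n \<omega> *v \<Phi> n \<omega>) \<in> borel_measurable (F n)" for n
    by (rule measurable_ginv_mult) (use adapted[of n] in auto)
  have gain_meas: "gain \<Phi> n \<in> borel_measurable (F n)" for n
    unfolding gain_def using \<Phi>_meas[of n] ginv_meas[of n] by measurable
  \<comment> \<open>This is (1 - f_n) \<pi>_n, written out because \<open>pe\<close> exists only
    once the outcome is fixed; it is predictable, so its products with V form a martingale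
    transform.\<close>
  define h where "h n \<omega> = (1 - gain \<Phi> n \<omega>) * - (\<Phi> n \<omega> \<bullet> (lse n \<omega> - vartheta e \<theta> \<rho>))" for n \<omega>
  have h_meas: "h n \<in> borel_measurable (F n)" for n
    unfolding h_def using \<Phi>_meas[of n] gain_meas[of n] lse_meas[of n] by measurable

  have h1: "AE \<omega> in M. \<exists>C. \<forall>n. \<bar>\<Sum>k\<le>n. h k \<omega> * V (Suc k) \<omega>\<bar> \<le> C + 1/4 * (\<Sum>k\<le>n. (h k \<omega>)\<^sup>2)"
    by (rule V_sum_bound[OF h_meas]) simp
  have h2: "AE \<omega> in M. \<exists>C. \<forall>n. (\<Sum>k\<le>n. gain \<Phi> k \<omega> * (V (Suc k) \<omega>)\<^sup>2) \<le> C + (\<sigma>\<^sup>2 + 1) * (\<Sum>k\<le>n. gain \<Phi> k \<omega>)"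
    by (rule V2_sum_bound[OF gain_meas]) (auto intro!: AE_I2 gain_bounds(1) less_imp_le[OF gain_bounds(2)])
  \<comment> \<open>Lags are written \<open>Suc i\<close> so that a single almost sure event covers
    all of them.\<close>
  have corr: "AE \<omega> in M. \<forall>i. (\<lambda>n. (\<Sum>k<n. V (Suc k) \<omega> * V (Suc k + Suc i) \<omega>) / real n) \<longlonglongrightarrow> 0"
    unfolding AE_all_countable by (intro allI V_autocorrelation) simp

  have main: "AE \<omega> in M. (\<lambda>n. (norm (lse n \<omega> - vartheta e \<theta> \<rho>))\<^sup>2) \<in> O(\<lambda>n. ln (real n) / real n)"
    using AE_space h1 h2 corr V2_mean V2_growth assms(21)
  proof eventually_elim
    case (elim \<omega>)
    interpret arx_path e \<theta> \<rho> X U \<epsilon> V x \<Phi> lse \<omega>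
      using e assms(5,6) model[OF elim(1)] noise[OF elim(1)] \<Phi>_eq lse[OF elim(1)] control[OF _ elim(1)]
      by (intro arx_path.intro)
    have h: "h n \<omega> = (1 - gain \<Phi> n \<omega>) * pe n" for n
      by (simp add: h_def pe_def err_def)
    obtain C1 where C1: "\<And>n. \<bar>\<Sum>k\<le>n. (1 - gain \<Phi> k \<omega>) * pe k * V (Suc k) \<omega>\<bar>
        \<le> C1 + 1/4 * (\<Sum>k\<le>n. ((1 - gain \<Phi> k \<omega>) * pe k)\<^sup>2)"
      using elim(2) unfolding h by blast
    obtain C2 where C2: "\<And>n. (\<Sum>k\<le>n. gain \<Phi> k \<omega> * (V (Suc k) \<omega>)\<^sup>2) \<le> C2 + (\<sigma>\<^sup>2 + 1) * (\<Sum>k\<le>n. gain \<Phi> k \<omega>)"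
      using elim(3) by blast
    have corr': "(\<lambda>n. (\<Sum>k<n. V (Suc k) \<omega> * V (Suc (k + i)) \<omega>) / real n) \<longlonglongrightarrow> 0" if "1 \<le> i" for i
      using elim(4)[rule_format, of "i - 1"] that by simp
    obtain CV where CV: "\<And>n. (V (Suc n) \<omega>)\<^sup>2 \<le> CV * real (Suc n) powr vexp"
      using elim(6) by blast
    have track: "(\<lambda>n. (\<Sum>k=1..n. (x k \<omega>)\<^sup>2) / real n) \<longlonglongrightarrow> 0"
      using elim(7) by (rule smalloD_tendsto)
    have "(\<lambda>n. (norm (err n))\<^sup>2) \<in> O(\<lambda>n. ln (real n) / real n)"
      by (rule err_bound[OF elim(5) \<sigma>_pos corr' CV vexp track C1 C2]) simp_all
    then show ?case by (simp add: err_def)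
  qed
  have r: "(\<lambda>n. ln (real n) / real n) \<in> O(\<lambda>_. 1)"
    using ln_over_n_tendsto_0 by (intro bigoI_tendsto[of _ _ 0]) auto
  have r0: "0 \<le> ln (real n) / real n" for n by (cases n) auto
  have th: "AE \<omega> in M. (\<lambda>n. (norm (theta_est e (lse n \<omega>) - \<theta>))\<^sup>2) \<in> O(\<lambda>n. ln (real n) / real n)"
    using main by eventually_elim (rule estimators_bigo(1)[OF e _ r r0])
  have rh: "AE \<omega> in M. (\<lambda>n. (rho_est e (lse n \<omega>) - \<rho>)\<^sup>2) \<in> O(\<lambda>n. ln (real n) / real n)"
    using main by eventually_elim (rule estimators_bigo(2)[OF e _ r r0])
  have "AE \<omega> in M. (\<lambda>n. theta_est e (lse n \<omega>)) \<longlonglongrightarrow> \<theta>"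
    using th by eventually_elim (rule tendsto_of_norm_sq_bigo)
  moreover have "AE \<omega> in M. (\<lambda>n. rho_est e (lse n \<omega>)) \<longlonglongrightarrow> \<rho>"
    using rh by eventually_elim (rule tendsto_of_norm_sq_bigo, simp)
  ultimately show ?thesis using th rh by blast
qed

end
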